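(* Let $\mu$ be a finite Borel measure on $[0,T]$ and let $u\in L^2(\Omega\times[0,T],\mathbb{P}^\sigma_u\otimes\mu)$ be an admissible adapted drift. For any unbiased and adapted drift estimator $\xi=(\xi_t)_{t\in[0,T]}$ one has $$\mathbb{E}^\sigma_u\left[\int_0^T|\xi_t-u_t|^2\,\mu(dt)\right]\ \geq\ \mathrm{R}(\sigma,\mu,\hat u):=\int_0^T\int_0^t\sigma_s^2\,ds\,\mu(dt).$$ The bound $\mathrm{R}(\sigma,\mu,\hat u)$ does not depend on $u$, and it is attained by the estimator $\hat u=X=(X_t)_{t\in[0,T]}$, i.e. $\hat u$ is unbiased and adapted and $\mathbb{E}^\sigma_u\left[\int_0^T|X_t-u_t|^2\mu(dt)\right]=\mathrm{R}(\sigma,\mu,\hat u)$.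
   Context: Let $T>0$ and let $\sigma\in L^2([0,T],dt)$ be a deterministic, a.e. non-vanishing function. On a probability space $(\Omega,\mathcal F,\mathbb{P}^\sigma)$, $X_t=\int_0^t\sigma_s\,dW_s$, $t\in[0,T]$, with $W$ a standard Brownian motion, is a continuous Gaussian martingale with quadratic variation $\sigma_t^2dt$ (covariance $\gamma(s,t)=\int_0^{s\wedge t}\sigma_r^2dr$). $(\mathcal F_t)_{t\in[0,T]}$ is the filtration generated by $X$, and $\mathcal F$ is the $\sigma$-algebra generated by $X$. An admissible adapted drift is an $\mathcal F_t$-adapted process $u_t=\int_0^t\dot u_s\,ds$ with $\mathbb{E}^\sigma\left[\int_0^T\dot u_s^2\sigma_s^{-2}ds\right]<\infty$, for which $$\Lambda(u)=\exp\left(\int_0^T\frac{\dot u_s}{\sigma_s^2}dX_s-\frac12\int_0^T\frac{\dot u_s^2}{\sigma_s^2}ds\right)$$ is a probability density with respect to $\mathbb{P}^\sigma$. One sets $d\mathbb{P}^\sigma_u=\Lambda(u)\,d\mathbb{P}^\sigma$; by Girsanov's theorem, $X^u_t:=X_t-u_t$ is under $\mathbb{P}^\sigma_u$ a continuous Gaussian martingale with quadratic variation $\sigma_t^2dt$. $\mathbb{E}^\sigma_u$ denotes expectation under $\mathbb{P}^\sigma_u$. A drift estimator is a measurable process $\xi=(\xi_t)_{t\in[0,T]}$ on $(\Omega,\mathcal F)$ (not depending on the unknown drift). It is called adapted if it is $\mathcal F_t$-adapted. It is called unbiased if $\mathbb{E}^\sigma_v[\xi_t]=\mathbb{E}^\sigma_v[v_t]$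 for all $t\in[0,T]$ and all admissible (square-integrable) adapted drifts $v$ for which $v_t$ is $\mathbb{P}^\sigma_v$-integrable. *)

theory Defs
  imports "HOL-Probability.Probability"
begin

text \<open>
  A real-valued process on the time interval \<open>[0, T]\<close> is a function \<open>X :: real \<Rightarrow> 'a \<Rightarrow> real\<close>,
  with \<open>X t \<omega>\<close> its value at time \<open>t\<close>; only its values for \<open>t \<in> {0..T}\<close> matter.
\<close>

definition natural_filtration :: "'a measure \<Rightarrow> (real \<Rightarrow> 'a \<Rightarrow> real) \<Rightarrow> real \<Rightarrow> 'a measure" where
  "natural_filtration M X t =
     sigma (space M) (\<Union>s\<in>{0..t}. {X s -` A \<inter> space M | A. A \<in> sets borel})"

definition adapted :: "(real \<Rightarrow> 'a measure) \<Rightarrow> real \<Rightarrow> (real \<Rightarrow> 'a \<Rightarrow> real) \<Rightarrow> bool" where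
  "adapted F T Y \<longleftrightarrow> (\<forall>t\<in>{0..T}. Y t \<in> borel_measurable (F t))"

definition measurable_process :: "'a measure \<Rightarrow> real \<Rightarrow> (real \<Rightarrow> 'a \<Rightarrow> real) \<Rightarrow> bool" where
  "measurable_process N T Y \<longleftrightarrow>
     (\<lambda>(\<omega>, t). Y t \<omega>) \<in> borel_measurable (N \<Otimes>\<^sub>M restrict_space borel {0..T})"

definition brownian_motion :: "'a measure \<Rightarrow> real \<Rightarrow> (real \<Rightarrow> 'a \<Rightarrow> real) \<Rightarrow> bool" where
  "brownian_motion M T W \<longleftrightarrow>
     (\<forall>t\<in>{0..T}. W t \<in> borel_measurable M) \<and>
     (AE \<omega> in M. W 0 \<omega> = 0) \<and>
     (AE \<omega> in M. continuous_on {0..T} (\<lambda>t. W t \<omega>)) \<and>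
     (\<forall>s t. 0 \<le> s \<and> s < t \<and> t \<le> T \<longrightarrow>
        distributed M lborel (\<lambda>\<omega>. W t \<omega> - W s \<omega>) (normal_density 0 (sqrt (t - s))) \<and>
        prob_space.indep_set M (sets (natural_filtration M W s))
          {(\<lambda>\<omega>. W t \<omega> - W s \<omega>) -` A \<inter> space M | A. A \<in> sets borel})"

text \<open>
  The Ito integral on \<open>[0, T]\<close> against a square-integrable \<open>F\<close>-martingale \<open>Y\<close> with deterministic
  quadratic variation \<open>d\<langle>Y\<rangle>\<^sub>s = a s ds\<close>, as the \<open>L\<^sup>2\<close>-extension of the integral of simple processes.
  A triple \<open>(n, \<tau>, \<xi>)\<close> encodes the simple process with value \<open>\<xi> i\<close>
  on \<open>(\<tau> i, \<tau> (i + 1)]\<close>, for \<open>i < n\<close>.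
\<close>

definition is_simple :: "'a measure \<Rightarrow> (real \<Rightarrow> 'a measure) \<Rightarrow> real
    \<Rightarrow> nat \<times> (nat \<Rightarrow> real) \<times> (nat \<Rightarrow> 'a \<Rightarrow> real) \<Rightarrow> bool" where
  "is_simple M F T = (\<lambda>(n, \<tau>, \<xi>). \<forall>i<n.
     0 \<le> \<tau> i \<and> \<tau> i \<le> \<tau> (Suc i) \<and> \<tau> (Suc i) \<le> T \<and>
     \<xi> i \<in> borel_measurable (F (\<tau> i)) \<and> bounded (\<xi> i ` space M))"

definition simple_process ::
    "nat \<times> (nat \<Rightarrow> real) \<times> (nat \<Rightarrow> 'a \<Rightarrow> real) \<Rightarrow> real \<Rightarrow> 'a \<Rightarrow> real" where
  "simple_process = (\<lambda>(n, \<tau>, \<xi>) s \<omega>. \<Sum>i<n. \<xi> i \<omega> * indicator {\<tau> i<..\<tau> (Suc i)} s)"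

definition simple_integral :: "(real \<Rightarrow> 'a \<Rightarrow> real)
    \<Rightarrow> nat \<times> (nat \<Rightarrow> real) \<times> (nat \<Rightarrow> 'a \<Rightarrow> real) \<Rightarrow> 'a \<Rightarrow> real" where
  "simple_integral Y = (\<lambda>(n, \<tau>, \<xi>) \<omega>. \<Sum>i<n. \<xi> i \<omega> * (Y (\<tau> (Suc i)) \<omega> - Y (\<tau> i) \<omega>))"

text \<open>
  \<open>Z\<close> is a version of \<open>\<integral>\<^sub>0\<^sup>T H\<^sub>s dY\<^sub>s\<close>. By the Ito isometry \<open>Z\<close> is almost surely unique.
  The integrand need only be approximable by simple processes in \<open>L\<^sup>2(M \<otimes> a ds)\<close>, so it may be
  altered on a null set of that measure.
\<close>

definition has_ito_integral :: "'a measure \<Rightarrow> (real \<Rightarrow> 'a measure) \<Rightarrow> real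
    \<Rightarrow> (real \<Rightarrow> 'a \<Rightarrow> real) \<Rightarrow> (real \<Rightarrow> real)
    \<Rightarrow> (real \<Rightarrow> 'a \<Rightarrow> real) \<Rightarrow> ('a \<Rightarrow> real) \<Rightarrow> bool" where
  "has_ito_integral M F T Y a H Z \<longleftrightarrow>
     measurable_process M T H \<and> Z \<in> borel_measurable M \<and>
     (\<exists>S. (\<forall>k. is_simple M F T (S k)) \<and>
        (\<lambda>k. \<integral>\<^sup>+\<omega>. (\<integral>\<^sup>+s\<in>{0..T}.
            ennreal ((simple_process (S k) s \<omega> - H s \<omega>)\<^sup>2 * a s) \<partial>lborel) \<partial>M)
          \<longlonglongrightarrow> 0 \<and>
        (\<lambda>k. \<integral>\<^sup>+\<omega>. ennreal ((simple_integral Y (S k) \<omega> - Z \<omega>)\<^sup>2) \<partial>M)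
          \<longlonglongrightarrow> 0)"

definition ito_integrable :: "'a measure \<Rightarrow> (real \<Rightarrow> 'a measure) \<Rightarrow> real
    \<Rightarrow> (real \<Rightarrow> 'a \<Rightarrow> real) \<Rightarrow> (real \<Rightarrow> real) \<Rightarrow> (real \<Rightarrow> 'a \<Rightarrow> real) \<Rightarrow> bool" where
  "ito_integrable M F T Y a H \<longleftrightarrow> (\<exists>Z. has_ito_integral M F T Y a H Z)"

definition ito_integral :: "'a measure \<Rightarrow> (real \<Rightarrow> 'a measure) \<Rightarrow> real
    \<Rightarrow> (real \<Rightarrow> 'a \<Rightarrow> real) \<Rightarrow> (real \<Rightarrow> real) \<Rightarrow> (real \<Rightarrow> 'a \<Rightarrow> real) \<Rightarrow> 'a \<Rightarrow> real" where
  "ito_integral M F T Y a H = (SOME Z. has_ito_integral M F T Y a H Z)"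

text \<open>
  \<open>X\<^sub>t = \<integral>\<^sub>0\<^sup>t \<sigma>\<^sub>s dW\<^sub>s\<close>, in its continuous version. The \<open>\<sigma>\<close>-algebra of \<open>M\<close> may be larger than the
  one generated by \<open>X\<close>, since it has to carry \<open>W\<close> as well.
\<close>

definition wiener_integral_process :: "'a measure \<Rightarrow> real \<Rightarrow> (real \<Rightarrow> real)
    \<Rightarrow> (real \<Rightarrow> 'a \<Rightarrow> real) \<Rightarrow> (real \<Rightarrow> 'a \<Rightarrow> real) \<Rightarrow> bool" where
  "wiener_integral_process M T \<sigma> W X \<longleftrightarrow>
     (\<forall>t\<in>{0..T}. has_ito_integral M (natural_filtration M W) T W (\<lambda>s. 1)
        (\<lambda>s \<omega>. \<sigma> s * indicator {0..t} s) (X t)) \<and>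
     (\<forall>\<omega>\<in>space M. continuous_on {0..T} (\<lambda>t. X t \<omega>))"

text \<open>
  A drift \<open>u\<^sub>t = \<integral>\<^sub>0\<^sup>t u'\<^sub>s ds\<close> is given together with its density \<open>u'\<close> (\<open>udot\<close> below), which is
  determined by \<open>u\<close> up to null sets.
\<close>

definition girsanov_density :: "'a measure \<Rightarrow> real \<Rightarrow> (real \<Rightarrow> real) \<Rightarrow> (real \<Rightarrow> 'a \<Rightarrow> real)
    \<Rightarrow> (real \<Rightarrow> 'a \<Rightarrow> real) \<Rightarrow> 'a \<Rightarrow> real" where
  "girsanov_density M T \<sigma> X udot \<omega> =
     exp (ito_integral M (natural_filtration M X) T X (\<lambda>s. (\<sigma> s)\<^sup>2) (\<lambda>s \<omega>. udot s \<omega> / (\<sigma> s)\<^sup>2) \<omega>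
          - (LBINT s:{0..T}. (udot s \<omega>)\<^sup>2 / (\<sigma> s)\<^sup>2) / 2)"

definition girsanov_measure :: "'a measure \<Rightarrow> real \<Rightarrow> (real \<Rightarrow> real) \<Rightarrow> (real \<Rightarrow> 'a \<Rightarrow> real)
    \<Rightarrow> (real \<Rightarrow> 'a \<Rightarrow> real) \<Rightarrow> 'a measure" where
  "girsanov_measure M T \<sigma> X udot = density M (\<lambda>\<omega>. ennreal (girsanov_density M T \<sigma> X udot \<omega>))"

text \<open>
  The condition \<open>ito_integrable\<close> expresses that the stochastic integral in the Girsanov density is
  defined. It is not an extra restriction on \<open>u\<close>: as \<open>u\<close> is adapted, \<open>udot\<close> agrees almost everywhere
  with a predictable process, and predictable processes in \<open>L\<^sup>2(M \<otimes> \<sigma>\<^sup>2 ds)\<close> are limits of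
  simple ones.
\<close>

definition admissible_drift :: "'a measure \<Rightarrow> real \<Rightarrow> (real \<Rightarrow> real) \<Rightarrow> (real \<Rightarrow> 'a \<Rightarrow> real)
    \<Rightarrow> (real \<Rightarrow> 'a \<Rightarrow> real) \<Rightarrow> (real \<Rightarrow> 'a \<Rightarrow> real) \<Rightarrow> bool" where
  "admissible_drift M T \<sigma> X u udot \<longleftrightarrow>
     adapted (natural_filtration M X) T u \<and>
     measurable_process M T udot \<and>
     (AE \<omega> in M. set_integrable lborel {0..T} (\<lambda>s. udot s \<omega>) \<and>
        (\<forall>t\<in>{0..T}. u t \<omega> = (LBINT s:{0..t}. udot s \<omega>))) \<and>
     (\<integral>\<^sup>+\<omega>. (\<integral>\<^sup>+s\<in>{0..T}. ennreal ((udot s \<omega>)\<^sup>2 / (\<sigma> s)\<^sup>2) \<partial>lborel) \<partial>M) < \<infinity> \<and>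
     ito_integrable M (natural_filtration M X) T X (\<lambda>s. (\<sigma> s)\<^sup>2) (\<lambda>s \<omega>. udot s \<omega> / (\<sigma> s)\<^sup>2) \<and>
     prob_space (girsanov_measure M T \<sigma> X udot)"

definition drift_estimator :: "'a measure \<Rightarrow> real \<Rightarrow> (real \<Rightarrow> 'a \<Rightarrow> real)
    \<Rightarrow> (real \<Rightarrow> 'a \<Rightarrow> real) \<Rightarrow> bool" where
  "drift_estimator M T X \<xi> \<longleftrightarrow> measurable_process (natural_filtration M X T) T \<xi>"

definition unbiased :: "'a measure \<Rightarrow> real \<Rightarrow> (real \<Rightarrow> real) \<Rightarrow> (real \<Rightarrow> 'a \<Rightarrow> real)
    \<Rightarrow> (real \<Rightarrow> 'a \<Rightarrow> real) \<Rightarrow> bool" where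
  "unbiased M T \<sigma> X \<xi> \<longleftrightarrow>
     (\<forall>v vdot. admissible_drift M T \<sigma> X v vdot \<longrightarrow>
       (let P = girsanov_measure M T \<sigma> X vdot in
         \<forall>t\<in>{0..T}. integrable P (v t) \<longrightarrow>
           integrable P (\<xi> t) \<and> (\<integral>\<omega>. \<xi> t \<omega> \<partial>P) = (\<integral>\<omega>. v t \<omega> \<partial>P)))"

definition quadratic_risk :: "'a measure \<Rightarrow> real measure \<Rightarrow> (real \<Rightarrow> 'a \<Rightarrow> real)
    \<Rightarrow> (real \<Rightarrow> 'a \<Rightarrow> real) \<Rightarrow> ennreal" where
  "quadratic_risk P \<mu> \<xi> u = (\<integral>\<^sup>+\<omega>. (\<integral>\<^sup>+t. ennreal (\<bar>\<xi> t \<omega> - u t \<omega>\<bar>\<^sup>2) \<partial>\<mu>) \<partial>P)"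

definition risk_bound :: "(real \<Rightarrow> real) \<Rightarrow> real measure \<Rightarrow> ennreal" where
  "risk_bound \<sigma> \<mu> = (\<integral>\<^sup>+t. (\<integral>\<^sup>+s\<in>{0..t}. ennreal ((\<sigma> s)\<^sup>2) \<partial>lborel) \<partial>\<mu>)"

end

theory Submission
  imports Defs
begin

text \<open>
  Both halves of the theorem rest on a form of Girsanov's theorem: under the law \<open>P\<^sub>u\<close> with density
  \<open>\<Lambda>(u)\<close>, the centred variable \<open>X\<^sub>t - u\<^sub>t\<close> has the Laplace transform of a normal variable with
  variance \<open>\<gamma>\<^sub>t = \<integral>\<^sub>0\<^sup>t \<sigma>\<^sub>s\<^sup>2 ds\<close>. So it has mean \<open>0\<close> and variance \<open>\<gamma>\<^sub>t\<close>, which says that \<open>X\<close> is unbiased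
  with risk \<open>\<integral> \<gamma>\<^sub>t \<mu>(dt)\<close>. For the lower bound fix \<open>t\<close> and let \<open>h\<^sub>s = \<gamma>\<^bsub>s \<and> t\<^esub>\<close>, a deterministic drift. Then
  \<open>\<Lambda>(u + \<epsilon>h) = \<Lambda>(u) L\<^sub>\<epsilon>\<close> with \<open>L\<^sub>\<epsilon> = exp (\<epsilon>(X\<^sub>t - u\<^sub>t) - \<epsilon>\<^sup>2\<gamma>\<^sub>t/2)\<close>, and the Laplace transform says exactly that
  \<open>u + \<epsilon>h\<close> is again admissible. Unbiasedness at \<open>u\<close> and at \<open>u + \<epsilon>h\<close> gives
  \<open>E\<^sub>u[(\<xi>\<^sub>t - u\<^sub>t)(L\<^sub>\<epsilon> - 1)] = \<epsilon>\<gamma>\<^sub>t\<close>, while \<open>E\<^sub>u[(L\<^sub>\<epsilon> - 1)\<^sup>2] = exp (\<epsilon>\<^sup>2\<gamma>\<^sub>t) - 1\<close>. The inequality of Chapman and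
  Robbins, that is, Cauchy-Schwarz followed by \<open>\<epsilon> \<rightarrow> 0\<close>, yields \<open>E\<^sub>u[(\<xi>\<^sub>t - u\<^sub>t)\<^sup>2] \<ge> \<gamma>\<^sub>t\<close>; this replaces a
  differentiation under the expectation (\<open>chapman_robbins\<close>, \<open>cramer_rao_pointwise\<close>). Integrating over
  \<open>\<mu>\<close> finishes the proof.

  The form of Girsanov's theorem is obtained without stochastic calculus beyond the definition of the
  integral as an \<open>L\<^sup>2\<close>-limit. For a simple integrand the exponential has expectation \<open>1\<close> by conditioning on one
  interval after the other (\<open>simple_exponential\<close>), and adding a multiple of the indicator of \<open>(0, t]\<close>
  leaves the integrand simple (\<open>simple_add_indicator\<close>). In the limit, \<open>E \<Lambda>(u) = 1\<close> is given and
  \<open>E \<Lambda>(u + \<epsilon>h) = 1\<close> has to be shown. Here one uses that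
  \<open>\<Lambda>(u + \<epsilon>h)\<^sup>2\<close> is a constant times \<open>\<Lambda>(u) \<Lambda>(u + 2\<epsilon>h)\<close>, and the same for the approximations: Fatou's
  lemma applied to the gap in the arithmetic-geometric mean inequality excludes a loss of mass
  (\<open>nn_integral_limit_by_domination\<close>, \<open>exponential_shift_expectation\<close>).

  The same limit argument shows that \<open>X\<close> has independent Gaussian increments in its own filtration.
  The processes that approximate \<open>\<sigma>\<close> may be random, but evaluating each of them at a suitable sample point
  gives deterministic step functions that approximate \<open>\<sigma>\<close> as well. Their integrals
  against \<open>W\<close> are Gaussian (\<open>wiener_transform\<close>, \<open>wiener_gaussian_martingale\<close>).
\<close>

section \<open>Limits of integrals\<close>

lemma nn_integral_le_of_AE_limit:
  fixes f :: "nat \<Rightarrow> 'a \<Rightarrow> ennreal"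
  assumes [measurable]: "\<And>k. f k \<in> borel_measurable M"
    and lim: "AE x in M. (\<lambda>k. f k x) \<longlonglongrightarrow> F x"
    and le: "\<And>k. (\<integral>\<^sup>+x. f k x \<partial>M) \<le> c"
  shows "(\<integral>\<^sup>+x. F x \<partial>M) \<le> c"
proof -
  have "(\<integral>\<^sup>+x. F x \<partial>M) = (\<integral>\<^sup>+x. liminf (\<lambda>k. f k x) \<partial>M)"
    using lim by (intro nn_integral_cong_AE) (auto elim!: eventually_mono simp: lim_imp_Liminf)
  also have "\<dots> \<le> liminf (\<lambda>k. \<integral>\<^sup>+x. f k x \<partial>M)"
    by (rule nn_integral_liminf) simp
  also have "\<dots> \<le> c"
    by (rule Liminf_le) (auto simp: le)
  finally show ?thesis .
qed

text \<open>
  The functions \<open>f k\<close> do not lose mass in the limit; the lemma transfers this to \<open>h k\<close>. By the inequality of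
  the arithmetic and the geometric mean, \<open>h k \<le> f k / (2 d) + d C (g k) / 2\<close> for each \<open>d > 0\<close>, and Fatou's
  lemma for the difference of the two sides bounds \<open>\<integral> H\<close> below by \<open>m - d C B / 2\<close>. The masses of
  \<open>g k\<close> enter with the small factor \<open>d\<close>, so a bound for them suffices.
\<close>

lemma nn_integral_limit_by_domination:
  fixes f g h :: "nat \<Rightarrow> 'a \<Rightarrow> real" and m B C :: real
  assumes meas [measurable]: "\<And>k. f k \<in> borel_measurable M" "\<And>k. g k \<in> borel_measurable M"
      "\<And>k. h k \<in> borel_measurable M"
    and meas' [measurable]: "F \<in> borel_measurable M" "G \<in> borel_measurable M" "H \<in> borel_measurable M"
    and nn: "\<And>k x. 0 \<le> f k x" "\<And>k x. 0 \<le> g k x" "\<And>k x. 0 \<le> h k x"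
      "\<And>x. 0 \<le> F x" "\<And>x. 0 \<le> G x" "\<And>x. 0 \<le> H x"
    and lim: "AE x in M. (\<lambda>k. f k x) \<longlonglongrightarrow> F x" "AE x in M. (\<lambda>k. g k x) \<longlonglongrightarrow> G x"
      "AE x in M. (\<lambda>k. h k x) \<longlonglongrightarrow> H x"
    and C: "0 \<le> C" "\<And>k x. x \<in> space M \<Longrightarrow> (h k x)\<^sup>2 \<le> C * f k x * g k x"
    and m: "0 \<le> m" "\<And>k. (\<integral>\<^sup>+x. f k x \<partial>M) = ennreal m" "(\<integral>\<^sup>+x. F x \<partial>M) = ennreal m"
      "\<And>k. (\<integral>\<^sup>+x. h k x \<partial>M) = ennreal m"
    and B: "0 \<le> B" "\<And>k. (\<integral>\<^sup>+x. g k x \<partial>M) \<le> ennreal B"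
  shows "(\<integral>\<^sup>+x. H x \<partial>M) = ennreal m"
proof (rule antisym)
  show upper: "(\<integral>\<^sup>+x. H x \<partial>M) \<le> ennreal m"
    by (rule nn_integral_le_of_AE_limit[where f = "\<lambda>k x. ennreal (h k x)"])
       (use lim(3) m(4) in \<open>auto elim!: eventually_mono\<close>)
  have fin: "(\<integral>\<^sup>+x. H x \<partial>M) < \<infinity>"
    using upper by (simp add: le_less_trans[OF _ ennreal_less_top])
  define I where "I = enn2real (\<integral>\<^sup>+x. H x \<partial>M)"
  have I: "(\<integral>\<^sup>+x. H x \<partial>M) = ennreal I" "0 \<le> I"
    using fin by (auto simp: I_def less_top)
  have lower: "m \<le> I + d * (C * B / 2)" if d: "d > 0" for d :: real
  proof -
    \<comment> \<open>the gap in the inequality between the arithmetic and the geometric mean\<close>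
    define w where "w k x = f k x / (2 * d) + d * C * g k x / 2 - h k x" for k x
    define w' where "w' x = F x / (2 * d) + d * C * G x / 2 - H x" for x
    have [measurable]: "w k \<in> borel_measurable M" "w' \<in> borel_measurable M" for k
      unfolding w_def w'_def by measurable
    have w0: "0 \<le> w k x" if "x \<in> space M" for k x
    proof -
      define a where "a = f k x / d"
      define b where "b = d * C * g k x"
      have ab: "0 \<le> a" "0 \<le> b" using nn d C by (auto simp: a_def b_def)
      have "(h k x)\<^sup>2 \<le> a * b" using C(2)[OF that, of k] d by (simp add: a_def b_def ac_simps)
      also have "\<dots> \<le> ((a + b) / 2)\<^sup>2"
        using zero_le_power2[of "a - b"] by (simp add: power2_eq_square field_simps)
      finally have "h k x \<le> (a + b) / 2"
        using power2_le_imp_le[of "h k x" "(a+b)/2"] ab by auto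
      then show ?thesis by (simp add: w_def a_def b_def add_divide_distrib mult.commute)
    qed
    have wl: "AE x in M. (\<lambda>k. w k x) \<longlonglongrightarrow> w' x"
      using lim by eventually_elim (use d in \<open>auto simp: w_def w'_def intro!: tendsto_intros\<close>)
    have w'0: "AE x in M. 0 \<le> w' x"
      using wl by (rule AE_mp) (auto intro!: AE_I2 LIMSEQ_le_const simp: w0)
    have bnd: "m \<le> m / (2 * d) + d * C * B / 2 \<and>
        (\<integral>\<^sup>+x. w k x \<partial>M) \<le> ennreal (m / (2 * d) + d * C * B / 2 - m)" for k
    proof -
      have "(\<integral>\<^sup>+x. w k x \<partial>M) + ennreal m = (\<integral>\<^sup>+x. w k x + h k x \<partial>M)"
        using w0 nn by (subst m(4)[of k, symmetric], subst nn_integral_add[symmetric])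
          (auto intro!: nn_integral_cong)
      also have "\<dots> = (\<integral>\<^sup>+x. ennreal (1 / (2 * d)) * ennreal (f k x) + ennreal (d * C / 2) * ennreal (g k x) \<partial>M)"
        using d nn C by (intro nn_integral_cong) (simp add: w_def ennreal_plus[symmetric] ennreal_mult[symmetric] del: ennreal_plus)
      also have "\<dots> = ennreal (1 / (2 * d)) * ennreal m + ennreal (d * C / 2) * (\<integral>\<^sup>+x. g k x \<partial>M)"
        by (simp add: nn_integral_add nn_integral_cmult m)
      also have "\<dots> \<le> ennreal (1 / (2 * d)) * ennreal m + ennreal (d * C / 2) * ennreal B"
        by (intro add_mono mult_left_mono B order_refl) auto
      also have "\<dots> = ennreal (m / (2 * d) + d * C * B / 2)"
        using d m C B by (simp add: ennreal_plus[symmetric] ennreal_mult[symmetric] del: ennreal_plus)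
      finally have *: "(\<integral>\<^sup>+x. w k x \<partial>M) + ennreal m \<le> ennreal (m / (2 * d) + d * C * B / 2)" .
      then have "(\<integral>\<^sup>+x. w k x \<partial>M) < \<infinity>"
        by (metis add_increasing2 ennreal_less_top infinity_ennreal_def le_less_trans order_refl zero_le)
      then obtain j where j: "(\<integral>\<^sup>+x. w k x \<partial>M) = ennreal j" "0 \<le> j"
        by (metis ennreal_enn2real_if enn2real_nonneg infinity_ennreal_def less_irrefl)
      have "j + m \<le> m / (2 * d) + d * C * B / 2"
        using * j m d C B by (simp add: ennreal_plus[symmetric] ennreal_le_iff del: ennreal_plus)
      then show ?thesis using j by (auto simp: ennreal_leI)
    qed
    have w'b: "(\<integral>\<^sup>+x. w' x \<partial>M) \<le> ennreal (m / (2 * d) + d * C * B / 2 - m)"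
      by (rule nn_integral_le_of_AE_limit[where f = "\<lambda>k x. ennreal (w k x)"])
         (use wl bnd in \<open>auto elim!: eventually_mono\<close>)
    have "ennreal (m / (2 * d)) = (\<integral>\<^sup>+x. ennreal (1 / (2 * d)) * ennreal (F x) \<partial>M)"
      using d m by (simp add: nn_integral_cmult ennreal_mult[symmetric])
    also have "\<dots> \<le> (\<integral>\<^sup>+x. ennreal (w' x) + ennreal (H x) \<partial>M)"
      using w'0 by (intro nn_integral_mono_AE, eventually_elim)
        (use d nn C in \<open>auto simp: ennreal_mult[symmetric] ennreal_plus[symmetric] w'_def simp del: ennreal_plus intro!: ennreal_leI\<close>)
    also have "\<dots> = (\<integral>\<^sup>+x. w' x \<partial>M) + ennreal I"
      by (subst nn_integral_add) (auto simp: I)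
    also have "\<dots> \<le> ennreal (m / (2 * d) + d * C * B / 2 - m) + ennreal I"
      using w'b by (intro add_mono) auto
    finally have fin: "ennreal (m / (2 * d)) \<le> ennreal (m / (2 * d) + d * C * B / 2 - m) + ennreal I" .
    then have "m / (2 * d) \<le> m / (2 * d) + d * C * B / 2 - m + I"
      using bnd[of 0] I by (simp add: ennreal_plus[symmetric] ennreal_le_iff del: ennreal_plus)
    then show ?thesis by simp
  qed
  have "((\<lambda>d. I + d * (C * B / 2)) \<longlongrightarrow> I + 0 * (C * B / 2)) (at_right 0)"
    by (intro tendsto_intros)
  moreover have "\<forall>\<^sub>F d in at_right 0. m \<le> I + d * (C * B / 2)"
    by (rule eventually_mono[OF eventually_at_right_less]) (rule lower)
  ultimately have "m \<le> I + 0 * (C * B / 2)"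
    by (rule tendsto_lowerbound) (rule trivial_limit_at_right_real)
  then show "ennreal m \<le> (\<integral>\<^sup>+x. H x \<partial>M)"
    by (simp add: I ennreal_leI)
qed

text \<open>
  Choose the subsequence such that the integrals are below \<open>(1/2)^n\<close>; then the sum of the functions has
  finite integral, so its terms tend to \<open>0\<close> wherever it is finite.
\<close>

lemma AE_subseq_of_nn_integral_tendsto_0:
  fixes f :: "nat \<Rightarrow> 'a \<Rightarrow> ennreal"
  assumes [measurable]: "\<And>k. f k \<in> borel_measurable M"
    and lim: "(\<lambda>k. \<integral>\<^sup>+x. f k x \<partial>M) \<longlonglongrightarrow> 0"
  obtains r where "strict_mono (r :: nat \<Rightarrow> nat)" "AE x in M. (\<lambda>k. f (r k) x) \<longlonglongrightarrow> 0"
proof -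
  have "\<exists>k>n. (\<integral>\<^sup>+x. f k x \<partial>M) < ennreal ((1/2)^n')" for n n' :: nat
  proof -
    have "\<forall>\<^sub>F k in sequentially. (\<integral>\<^sup>+x. f k x \<partial>M) < ennreal ((1/2)^n')"
      by (rule order_tendstoD(2)[OF lim]) simp
    then have "\<forall>\<^sub>F k in sequentially. k > n \<and> (\<integral>\<^sup>+x. f k x \<partial>M) < ennreal ((1/2)^n')"
      using eventually_gt_at_top by (rule eventually_conj[rotated])
    then show ?thesis using eventually_happens by fastforce
  qed
  then obtain K where K: "\<And>n n'. K n n' > n" "\<And>n n'. (\<integral>\<^sup>+x. f (K n n') x \<partial>M) < ennreal ((1/2)^n')"
    by metis
  define r where "r = rec_nat (K 0 0) (\<lambda>n p. K p (Suc n))"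
  have r0: "r 0 = K 0 0" and rS: "\<And>n. r (Suc n) = K (r n) (Suc n)" by (auto simp: r_def)
  have mono: "strict_mono r" by (rule strict_monoI_Suc) (simp add: rS K)
  have b: "(\<integral>\<^sup>+x. f (r n) x \<partial>M) \<le> ennreal ((1/2)^n)" for n
  proof (cases n)
    case 0
    then show ?thesis using K(2)[of 0 0] by (simp add: r0 less_imp_le)
  next
    case (Suc j)
    then show ?thesis using K(2)[of "r j" n] by (simp add: rS less_imp_le del: power_Suc)
  qed
  have "(\<integral>\<^sup>+x. (\<Sum>n. f (r n) x) \<partial>M) = (\<Sum>n. \<integral>\<^sup>+x. f (r n) x \<partial>M)"
    by (rule nn_integral_suminf) simp
  also have "\<dots> \<le> (\<Sum>n. ennreal ((1/2)^n))"
    by (intro suminf_le b) auto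
  also have "\<dots> = ennreal (\<Sum>n. (1/2)^n)"
    by (intro suminf_ennreal2) (auto simp: summable_geometric)
  finally have "(\<integral>\<^sup>+x. (\<Sum>n. f (r n) x) \<partial>M) \<noteq> \<infinity>"
    by (metis ennreal_neq_top infinity_ennreal_def top.extremum_unique)
  then have "AE x in M. (\<Sum>n. f (r n) x) \<noteq> \<infinity>"
    by (intro nn_integral_noteq_infinite) auto
  then have "AE x in M. (\<lambda>k. f (r k) x) \<longlonglongrightarrow> 0"
  proof eventually_elim
    case (elim x)
    have fin: "f (r n) x \<noteq> top" for n
    proof
      assume "f (r n) x = top"
      then have "(\<Sum>n. f (r n) x) = top"
        using sum_le_suminf[of "\<lambda>n. f (r n) x" "{n}"] by (simp add: top.extremum_unique)
      then show False using elim by simp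
    qed
    define g where "g n = enn2real (f (r n) x)" for n
    have g: "f (r n) x = ennreal (g n)" "0 \<le> g n" for n
      using fin[of n] by (auto simp: g_def less_top[symmetric])
    have "summable g"
      using elim g by (intro summable_suminf_not_top) auto
    then have "g \<longlonglongrightarrow> 0" by (rule summable_LIMSEQ_zero)
    then have "(\<lambda>k. ennreal (g k)) \<longlonglongrightarrow> ennreal 0" by (rule tendsto_ennrealI)
    then show ?case by (simp add: g(1))
  qed
  with mono show ?thesis using that by blast
qed

lemma tendsto_of_ennreal_square:
  fixes f :: "nat \<Rightarrow> real"
  assumes "(\<lambda>k. ennreal ((f k - l)\<^sup>2)) \<longlonglongrightarrow> 0"
  shows "f \<longlonglongrightarrow> l"
proof -
  have "(\<lambda>k. enn2real (ennreal ((f k - l)\<^sup>2))) \<longlonglongrightarrow> enn2real (ennreal 0)"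
    using assms by (intro tendsto_enn2real) auto
  then have "(\<lambda>k. (f k - l)\<^sup>2) \<longlonglongrightarrow> 0" by simp
  then have "(\<lambda>k. sqrt ((f k - l)\<^sup>2)) \<longlonglongrightarrow> sqrt 0" by (intro tendsto_intros)
  then have "(\<lambda>k. f k - l) \<longlonglongrightarrow> 0" by (simp add: tendsto_rabs_zero_iff)
  then show ?thesis by (rule LIM_zero_cancel)
qed

lemma square_add_le: "((a::real) + b)\<^sup>2 \<le> 2 * a\<^sup>2 + 2 * b\<^sup>2"
  using zero_le_power2[of "a - b"] by (simp add: power2_eq_square algebra_simps)

lemma nn_integral_square_add_le:
  fixes f g :: "'a \<Rightarrow> real"
  assumes [measurable]: "f \<in> borel_measurable M" "g \<in> borel_measurable M"
  shows "(\<integral>\<^sup>+x. ennreal ((f x + g x)\<^sup>2) \<partial>M)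
    \<le> 2 * (\<integral>\<^sup>+x. ennreal ((f x)\<^sup>2) \<partial>M) + 2 * (\<integral>\<^sup>+x. ennreal ((g x)\<^sup>2) \<partial>M)"
proof -
  have "(\<integral>\<^sup>+x. ennreal ((f x + g x)\<^sup>2) \<partial>M) \<le> (\<integral>\<^sup>+x. 2 * ennreal ((f x)\<^sup>2) + 2 * ennreal ((g x)\<^sup>2) \<partial>M)"
  proof (rule nn_integral_mono)
    fix x
    have "2 * ennreal ((f x)\<^sup>2) + 2 * ennreal ((g x)\<^sup>2) = ennreal (2 * (f x)\<^sup>2 + 2 * (g x)\<^sup>2)"
      by (simp add: ennreal_plus ennreal_mult)
    then show "ennreal ((f x + g x)\<^sup>2) \<le> 2 * ennreal ((f x)\<^sup>2) + 2 * ennreal ((g x)\<^sup>2)"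
      by (simp add: ennreal_leI square_add_le del: ennreal_plus)
  qed
  then show ?thesis by (simp add: nn_integral_add nn_integral_cmult)
qed

lemma nn_integral_square_add_tendsto_0:
  fixes f g :: "nat \<Rightarrow> 'a \<Rightarrow> real"
  assumes [measurable]: "\<And>k. f k \<in> borel_measurable M" "\<And>k. g k \<in> borel_measurable M"
    and "(\<lambda>k. \<integral>\<^sup>+x. ennreal ((f k x)\<^sup>2) \<partial>M) \<longlonglongrightarrow> 0" "(\<lambda>k. \<integral>\<^sup>+x. ennreal ((g k x)\<^sup>2) \<partial>M) \<longlonglongrightarrow> 0"
  shows "(\<lambda>k. \<integral>\<^sup>+x. ennreal ((f k x + g k x)\<^sup>2) \<partial>M) \<longlonglongrightarrow> 0"
proof (rule tendsto_sandwich[OF _ _ tendsto_const])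
  show "\<forall>\<^sub>F k in sequentially. (\<integral>\<^sup>+x. ennreal ((f k x + g k x)\<^sup>2) \<partial>M)
    \<le> 2 * (\<integral>\<^sup>+x. ennreal ((f k x)\<^sup>2) \<partial>M) + 2 * (\<integral>\<^sup>+x. ennreal ((g k x)\<^sup>2) \<partial>M)"
    by (intro always_eventually allI nn_integral_square_add_le) auto
  have "(\<lambda>k. 2 * (\<integral>\<^sup>+x. ennreal ((f k x)\<^sup>2) \<partial>M) + 2 * (\<integral>\<^sup>+x. ennreal ((g k x)\<^sup>2) \<partial>M)) \<longlonglongrightarrow> 2 * 0 + 2 * 0"
    by (intro tendsto_add ennreal_tendsto_cmult assms) auto
  then show "(\<lambda>k. 2 * (\<integral>\<^sup>+x. ennreal ((f k x)\<^sup>2) \<partial>M) + 2 * (\<integral>\<^sup>+x. ennreal ((g k x)\<^sup>2) \<partial>M)) \<longlonglongrightarrow> 0"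
    by simp
qed auto

text \<open>
  Convergence in \<open>L\<^sup>2\<close> implies convergence of the norms, because
  \<open>\<bar>p\<^sup>2 - q\<^sup>2\<bar> \<le> (1 + 1/e) (p - q)\<^sup>2 + e q\<^sup>2\<close> for every \<open>e > 0\<close>.
\<close>

lemma integral_square_tendsto:
  fixes f :: "nat \<Rightarrow> 'a \<Rightarrow> real"
  assumes [measurable]: "\<And>k. f k \<in> borel_measurable M" "g \<in> borel_measurable M"
    and int: "\<And>k. integrable M (\<lambda>x. (f k x)\<^sup>2)" "integrable M (\<lambda>x. (g x)\<^sup>2)"
    and lim: "(\<lambda>k. \<integral>\<^sup>+x. ennreal ((f k x - g x)\<^sup>2) \<partial>M) \<longlonglongrightarrow> 0"
  shows "(\<lambda>k. \<integral>x. (f k x)\<^sup>2 \<partial>M) \<longlonglongrightarrow> (\<integral>x. (g x)\<^sup>2 \<partial>M)"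
proof -
  define d where "d k = (\<integral>x. (f k x - g x)\<^sup>2 \<partial>M)" for k
  have intd: "integrable M (\<lambda>x. (f k x - g x)\<^sup>2)" for k
    by (rule Bochner_Integration.integrable_bound[where f = "\<lambda>x. 2 * (f k x)\<^sup>2 + 2 * (g x)\<^sup>2"])
       (use int square_add_le[of _ "- g _"] in auto)
  have "(\<lambda>k. enn2real (\<integral>\<^sup>+x. ennreal ((f k x - g x)\<^sup>2) \<partial>M)) \<longlonglongrightarrow> enn2real 0"
    using lim by (intro tendsto_enn2real) (auto simp: zero_ennreal_def[symmetric])
  then have d0: "d \<longlonglongrightarrow> 0"
    unfolding d_def[abs_def] by (simp add: integral_eq_nn_integral)
  define b where "b = (\<integral>x. (g x)\<^sup>2 \<partial>M)"
  have b0: "0 \<le> b" unfolding b_def by simp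
  have bound: "\<bar>(\<integral>x. (f k x)\<^sup>2 \<partial>M) - b\<bar> \<le> (1 + 1 / e) * d k + e * b" if e: "e > 0" for e :: real and k
  proof -
    have pw: "\<bar>p\<^sup>2 - q\<^sup>2\<bar> \<le> (1 + 1 / e) * (p - q)\<^sup>2 + e * q\<^sup>2" for p q :: real
    proof -
      define r where "r = p - q"
      have p: "p = q + r" by (simp add: r_def)
      have "(sqrt e * q - r / sqrt e)\<^sup>2 = e * q\<^sup>2 - 2 * q * r + r\<^sup>2 / e"
        "(sqrt e * q + r / sqrt e)\<^sup>2 = e * q\<^sup>2 + 2 * q * r + r\<^sup>2 / e"
        using e by (simp_all add: power2_diff power2_sum power_mult_distrib power_divide)
      then have "\<bar>2 * q * r\<bar> \<le> e * q\<^sup>2 + r\<^sup>2 / e"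
        using zero_le_power2[of "sqrt e * q - r / sqrt e"] zero_le_power2[of "sqrt e * q + r / sqrt e"]
        by linarith
      moreover have "p\<^sup>2 - q\<^sup>2 = 2 * q * r + r\<^sup>2" by (simp add: p power2_sum)
      moreover have "0 \<le> r\<^sup>2" by simp
      moreover have "(1 + 1 / e) * r\<^sup>2 + e * q\<^sup>2 = r\<^sup>2 + (e * q\<^sup>2 + r\<^sup>2 / e)"
        by (simp add: algebra_simps)
      ultimately show ?thesis
        unfolding r_def[symmetric] by linarith
    qed
    have "\<bar>(\<integral>x. (f k x)\<^sup>2 \<partial>M) - b\<bar> = \<bar>\<integral>x. (f k x)\<^sup>2 - (g x)\<^sup>2 \<partial>M\<bar>"
      using int by (simp add: b_def)
    also have "\<dots> \<le> (\<integral>x. \<bar>(f k x)\<^sup>2 - (g x)\<^sup>2\<bar> \<partial>M)"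
      by (rule integral_abs_bound)
    also have "\<dots> \<le> (\<integral>x. (1 + 1 / e) * (f k x - g x)\<^sup>2 + e * (g x)\<^sup>2 \<partial>M)"
      by (intro integral_mono pw) (use int intd in auto)
    also have "\<dots> = (1 + 1 / e) * d k + e * b"
      using int intd by (simp add: d_def b_def)
    finally show ?thesis .
  qed
  show ?thesis
    unfolding b_def[symmetric]
  proof (rule LIMSEQ_I)
    fix r :: real assume r: "r > 0"
    define e where "e = r / (2 * (b + 1))"
    have e: "e > 0" using r b0 by (simp add: e_def)
    have "b / (b + 1) \<le> 1" using b0 by simp
    have eb: "e * b \<le> r / 2"
      using r b0 by (simp add: e_def field_simps)
    have "(\<lambda>k. (1 + 1 / e) * d k) \<longlonglongrightarrow> (1 + 1 / e) * 0" by (intro tendsto_intros d0)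
    then have "\<forall>\<^sub>F k in sequentially. (1 + 1 / e) * d k < r / 2"
      using r by (intro order_tendstoD(2)) auto
    then obtain N where N: "\<And>k. k \<ge> N \<Longrightarrow> (1 + 1 / e) * d k < r / 2"
      by (auto simp: eventually_sequentially)
    have "norm ((\<integral>x. (f n x)\<^sup>2 \<partial>M) - b) < r" if "n \<ge> N" for n
      using bound[OF e, of n] eb N[OF that] unfolding real_norm_def by linarith
    then show "\<exists>no. \<forall>n\<ge>no. norm ((\<integral>x. (f n x)\<^sup>2 \<partial>M) - b) < r" by blast
  qed
qed

section \<open>Increments that are Gaussian relative to a \<sigma>-algebra\<close>

text \<open>
  This encodes that \<open>D\<close> is independent of \<open>G\<close> and normal with mean \<open>0\<close> and variance \<open>v\<close>, by the
  conditional Laplace transform: \<open>E[exp (cD - c\<^sup>2v/2) | G] = 1\<close>. The argument \<open>c\<close> may itself be random, so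
  the condition is used directly for stochastic exponentials; the weight \<open>A\<close> plays the role of the test
  function of the conditional expectation. In this form the property survives sums over successive \<sigma>-algebras and
  limits in \<open>L\<^sup>2\<close> by elementary arguments.
\<close>

definition gaussian_increment :: "'a measure \<Rightarrow> 'a measure \<Rightarrow> ('a \<Rightarrow> real) \<Rightarrow> real \<Rightarrow> bool" where
  "gaussian_increment M G D v \<longleftrightarrow> subalgebra M G \<and> D \<in> borel_measurable M \<and> 0 \<le> v \<and>
    (\<forall>A c. A \<in> borel_measurable G \<longrightarrow> (\<forall>\<omega>. 0 \<le> A \<omega>) \<longrightarrow> (\<integral>\<^sup>+\<omega>. ennreal (A \<omega>) \<partial>M) < \<infinity> \<longrightarrow>
       c \<in> borel_measurable G \<longrightarrow> bounded (c ` space M) \<longrightarrow>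
       (\<integral>\<^sup>+\<omega>. ennreal (A \<omega> * exp (c \<omega> * D \<omega> - (c \<omega>)\<^sup>2 * v / 2)) \<partial>M) = (\<integral>\<^sup>+\<omega>. ennreal (A \<omega>) \<partial>M))"

lemma gaussian_incrementD:
  assumes "gaussian_increment M G D v"
  shows "subalgebra M G" "D \<in> borel_measurable M" "0 \<le> v"
  using assms by (auto simp: gaussian_increment_def)

lemma gaussian_increment_exp:
  assumes "gaussian_increment M G D v" "A \<in> borel_measurable G" "\<And>\<omega>. 0 \<le> A \<omega>"
    "(\<integral>\<^sup>+\<omega>. ennreal (A \<omega>) \<partial>M) < \<infinity>" "c \<in> borel_measurable G" "bounded (c ` space M)"
  shows "(\<integral>\<^sup>+\<omega>. ennreal (A \<omega> * exp (c \<omega> * D \<omega> - (c \<omega>)\<^sup>2 * v / 2)) \<partial>M) = (\<integral>\<^sup>+\<omega>. ennreal (A \<omega>) \<partial>M)"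
  using assms by (auto simp: gaussian_increment_def)

lemma gaussian_increment_antimono:
  assumes "gaussian_increment M G D v" "subalgebra G G'"
  shows "gaussian_increment M G' D v"
  using assms measurable_from_subalg[OF assms(2)]
  unfolding gaussian_increment_def subalgebra_def by blast

lemma gaussian_increment_zero:
  "subalgebra M G \<Longrightarrow> gaussian_increment M G (\<lambda>_. 0) 0"
  by (auto simp: gaussian_increment_def)

lemma gaussian_increment_cmult:
  assumes "gaussian_increment M G D v"
  shows "gaussian_increment M G (\<lambda>\<omega>. r * D \<omega>) (r\<^sup>2 * v)"
  unfolding gaussian_increment_def
proof (intro conjI allI impI)
  fix A c :: "'a \<Rightarrow> real"
  assume "A \<in> borel_measurable G" "\<forall>\<omega>. 0 \<le> A \<omega>" "(\<integral>\<^sup>+\<omega>. ennreal (A \<omega>) \<partial>M) < \<infinity>"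
    and [measurable]: "c \<in> borel_measurable G" and b: "bounded (c ` space M)"
  moreover have "bounded ((\<lambda>\<omega>. c \<omega> * r) ` space M)"
    using bounded_scaling[OF b, of r] by (simp add: image_image mult.commute)
  ultimately show "(\<integral>\<^sup>+\<omega>. ennreal (A \<omega> * exp (c \<omega> * (r * D \<omega>) - (c \<omega>)\<^sup>2 * (r\<^sup>2 * v) / 2)) \<partial>M) = (\<integral>\<^sup>+\<omega>. ennreal (A \<omega>) \<partial>M)"
    using gaussian_increment_exp[OF assms, of A "\<lambda>\<omega>. c \<omega> * r"] by (auto simp: power_mult_distrib mult.assoc)
qed (use gaussian_incrementD[OF assms] in auto)

lemma gaussian_increment_add:
  assumes D: "gaussian_increment M G D v" and E: "gaussian_increment M G' E w"
    and G: "subalgebra G' G" and [measurable]: "D \<in> borel_measurable G'"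
  shows "gaussian_increment M G (\<lambda>\<omega>. D \<omega> + E \<omega>) (v + w)"
  unfolding gaussian_increment_def
proof (intro conjI allI impI)
  fix A c :: "'a \<Rightarrow> real"
  assume A: "A \<in> borel_measurable G" "\<forall>\<omega>. 0 \<le> A \<omega>" "(\<integral>\<^sup>+\<omega>. ennreal (A \<omega>) \<partial>M) < \<infinity>"
    and c: "c \<in> borel_measurable G" and b: "bounded (c ` space M)"
  have [measurable]: "A \<in> borel_measurable G'" "c \<in> borel_measurable G'"
    using A c measurable_from_subalg[OF G] by auto
  define A' where "A' \<omega> = A \<omega> * exp (c \<omega> * D \<omega> - (c \<omega>)\<^sup>2 * v / 2)" for \<omega>
  have [measurable]: "A' \<in> borel_measurable G'" unfolding A'_def by measurable
  have eq: "(\<integral>\<^sup>+\<omega>. ennreal (A' \<omega>) \<partial>M) = (\<integral>\<^sup>+\<omega>. ennreal (A \<omega>) \<partial>M)"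
    unfolding A'_def by (rule gaussian_increment_exp[OF D]) (use A c b in auto)
  have "(\<integral>\<^sup>+\<omega>. ennreal (A' \<omega> * exp (c \<omega> * E \<omega> - (c \<omega>)\<^sup>2 * w / 2)) \<partial>M) = (\<integral>\<^sup>+\<omega>. ennreal (A' \<omega>) \<partial>M)"
    by (rule gaussian_increment_exp[OF E]) (use A eq b in \<open>auto simp: A'_def\<close>)
  then show "(\<integral>\<^sup>+\<omega>. ennreal (A \<omega> * exp (c \<omega> * (D \<omega> + E \<omega>) - (c \<omega>)\<^sup>2 * (v + w) / 2)) \<partial>M) = (\<integral>\<^sup>+\<omega>. ennreal (A \<omega>) \<partial>M)"
    using eq by (simp add: A'_def mult.assoc mult_exp_exp algebra_simps add_divide_distrib)
qed (use gaussian_incrementD[OF D] gaussian_incrementD[OF E] in auto)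

text \<open>
  With \<open>h k = A exp (c D\<^sub>k - c\<^sup>2v\<^sub>k/2)\<close> and \<open>g k\<close> the same expression for \<open>2c\<close>, one has
  \<open>(h k)\<^sup>2 = exp (c\<^sup>2v\<^sub>k) A (g k)\<close>. The factor is bounded since \<open>c\<close> is, so no mass is lost in the limit.
\<close>

lemma gaussian_increment_limit:
  fixes D :: "'a \<Rightarrow> real"
  assumes D: "\<And>k. gaussian_increment M G (Dk k) (v k)" and [measurable]: "D \<in> borel_measurable M"
    and lim: "(\<lambda>k. \<integral>\<^sup>+\<omega>. ennreal ((Dk k \<omega> - D \<omega>)\<^sup>2) \<partial>M) \<longlonglongrightarrow> 0" "v \<longlonglongrightarrow> w"
  shows "gaussian_increment M G D w"
proof -
  have [measurable]: "Dk k \<in> borel_measurable M" for k using D gaussian_incrementD by blast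
  have v0: "0 \<le> v k" for k using D gaussian_incrementD by blast
  have G: "subalgebra M G" using D gaussian_incrementD by blast
  have w0: "0 \<le> w" by (rule LIMSEQ_le_const[OF lim(2)]) (use v0 in auto)
  obtain r where r: "strict_mono r" "AE \<omega> in M. (\<lambda>k. ennreal ((Dk (r k) \<omega> - D \<omega>)\<^sup>2)) \<longlonglongrightarrow> 0"
    by (rule AE_subseq_of_nn_integral_tendsto_0[OF _ lim(1)]) auto
  have Dlim: "AE \<omega> in M. (\<lambda>k. Dk (r k) \<omega>) \<longlonglongrightarrow> D \<omega>"
    using r(2) by eventually_elim (rule tendsto_of_ennreal_square)
  have vlim: "(\<lambda>k. v (r k)) \<longlonglongrightarrow> w" using lim(2) r(1) by (rule LIMSEQ_subseq_LIMSEQ[unfolded o_def])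
  obtain V where V: "\<And>k. v k \<le> V"
    using convergent_imp_Bseq[OF convergentI[OF lim(2)]] unfolding Bseq_def real_norm_def
    by (meson abs_le_D1)
  show ?thesis
    unfolding gaussian_increment_def
  proof (intro conjI allI impI)
    fix A c :: "'a \<Rightarrow> real"
    assume A: "A \<in> borel_measurable G" "\<forall>\<omega>. 0 \<le> A \<omega>" "(\<integral>\<^sup>+\<omega>. ennreal (A \<omega>) \<partial>M) < \<infinity>"
      and c: "c \<in> borel_measurable G" and b: "bounded (c ` space M)"
    have [measurable]: "A \<in> borel_measurable M" "c \<in> borel_measurable M"
      using A c measurable_from_subalg[OF G] by auto
    obtain m where m: "(\<integral>\<^sup>+\<omega>. ennreal (A \<omega>) \<partial>M) = ennreal m" "0 \<le> m"
      using A(3) by (cases "\<integral>\<^sup>+\<omega>. ennreal (A \<omega>) \<partial>M") auto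
    obtain K where K: "\<And>\<omega>. \<omega> \<in> space M \<Longrightarrow> \<bar>c \<omega>\<bar> \<le> K"
      using b unfolding bounded_iff by auto
    define h where "h \<theta> k \<omega> = A \<omega> * exp (\<theta> * c \<omega> * Dk (r k) \<omega> - (\<theta> * c \<omega>)\<^sup>2 * v (r k) / 2)" for \<theta> :: real and k \<omega>
    define H where "H \<theta> \<omega> = A \<omega> * exp (\<theta> * c \<omega> * D \<omega> - (\<theta> * c \<omega>)\<^sup>2 * w / 2)" for \<theta> :: real and \<omega>
    have [measurable]: "h \<theta> k \<in> borel_measurable M" "H \<theta> \<in> borel_measurable M" for \<theta> k
      unfolding h_def H_def by measurable
    have nn: "0 \<le> h \<theta> k \<omega>" "0 \<le> H \<theta> \<omega>" for \<theta> k \<omega> using A by (auto simp: h_def H_def)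
    have hint: "(\<integral>\<^sup>+\<omega>. ennreal (h \<theta> k \<omega>) \<partial>M) = ennreal m" for \<theta> k
      unfolding h_def m(1)[symmetric]
      using gaussian_increment_exp[OF D, of A "\<lambda>\<omega>. \<theta> * c \<omega>" "r k"] A c bounded_scaling[OF b, of \<theta>]
      by (simp add: image_image)
    have hlim: "AE \<omega> in M. (\<lambda>k. h \<theta> k \<omega>) \<longlonglongrightarrow> H \<theta> \<omega>" for \<theta>
      using Dlim by eventually_elim (auto simp: h_def H_def intro!: tendsto_intros vlim)
    have "(\<integral>\<^sup>+\<omega>. ennreal (H 1 \<omega>) \<partial>M) = ennreal m"
    proof (rule nn_integral_limit_by_domination[where f = "\<lambda>_. A" and F = A and g = "h 2" and G = "H 2"
          and h = "h 1" and C = "exp (K\<^sup>2 * max 0 V)" and B = m])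
      fix k \<omega> assume \<omega>: "\<omega> \<in> space M"
      have "(c \<omega>)\<^sup>2 \<le> K\<^sup>2" using K[OF \<omega>] by (metis abs_ge_zero power2_abs power_mono)
      moreover have "v (r k) \<le> max 0 V" using V[of "r k"] by simp
      ultimately have "(c \<omega>)\<^sup>2 * v (r k) \<le> K\<^sup>2 * max 0 V" using v0[of "r k"] by (intro mult_mono) auto
      then have e: "exp ((c \<omega>)\<^sup>2 * v (r k)) \<le> exp (K\<^sup>2 * max 0 V)" by simp
      have "(h 1 k \<omega>)\<^sup>2 = exp ((c \<omega>)\<^sup>2 * v (r k)) * (A \<omega> * h 2 k \<omega>)"
        by (simp add: h_def power2_eq_square mult_exp_exp algebra_simps flip: exp_add)
      also have "\<dots> \<le> exp (K\<^sup>2 * max 0 V) * (A \<omega> * h 2 k \<omega>)"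
        using A by (intro mult_right_mono e) (auto simp: h_def)
      finally show "(h 1 k \<omega>)\<^sup>2 \<le> exp (K\<^sup>2 * max 0 V) * A \<omega> * h 2 k \<omega>" by (simp add: mult.assoc)
    qed (use A m hint hlim nn in auto)
    then show "(\<integral>\<^sup>+\<omega>. ennreal (A \<omega> * exp (c \<omega> * D \<omega> - (c \<omega>)\<^sup>2 * w / 2)) \<partial>M) = (\<integral>\<^sup>+\<omega>. ennreal (A \<omega>) \<partial>M)"
      by (simp add: H_def m)
  qed (use G w0 in auto)
qed

text \<open>
  By independence the pair of the identity into \<open>G\<close> and \<open>D\<close> has a product law. Integrating over \<open>D\<close> first,
  with \<open>c\<close> frozen, gives the total mass of the normal density with mean \<open>c v\<close>.
\<close>

lemma (in prob_space) gaussian_increment_of_independent: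
  assumes G: "subalgebra M G" and D: "distributed M lborel D (normal_density 0 (sqrt v))" and v: "0 < v"
    and ind: "indep_set (sets G) {D -` A \<inter> space M |A. A \<in> sets borel}"
  shows "gaussian_increment M G D v"
proof -
  have [measurable]: "D \<in> borel_measurable M" using D by (auto simp: distributed_def)
  have id [measurable]: "(\<lambda>x. x) \<in> measurable M G"
    using G by (auto simp: subalgebra_def intro!: measurableI)
  have sp: "space G = space M" using G by (simp add: subalgebra_def)
  have prod: "distr M G (\<lambda>x. x) \<Otimes>\<^sub>M distr M borel D = distr M (G \<Otimes>\<^sub>M borel) (\<lambda>x. (x, D x))"
  proof (rule pair_measure_eqI)
    show "sigma_finite_measure (distr M G (\<lambda>x. x))" "sigma_finite_measure (distr M borel D)"
      by (intro prob_space_imp_sigma_finite prob_space_distr; simp)+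
    fix B C assume B: "B \<in> sets (distr M G (\<lambda>x. x))" and C: "C \<in> sets (distr M borel D)"
    have BM: "B \<in> events" "(\<lambda>x. x) -` B \<inter> space M = B"
      using B G sets.sets_into_space[of B G] sp by (auto simp: subalgebra_def)
    have "prob (B \<inter> (D -` C \<inter> space M)) = prob B * prob (D -` C \<inter> space M)"
      using ind by (rule indep_setD) (use B C in auto)
    moreover have "(\<lambda>x. (x, D x)) -` (B \<times> C) \<inter> space M = B \<inter> (D -` C \<inter> space M)"
      using BM sets.sets_into_space[OF BM(1)] by auto
    ultimately show "emeasure (distr M G (\<lambda>x. x)) B * emeasure (distr M borel D) C
        = emeasure (distr M (G \<Otimes>\<^sub>M borel) (\<lambda>x. (x, D x))) (B \<times> C)"
      using B C BM by (simp add: emeasure_distr emeasure_eq_measure ennreal_mult[symmetric])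
  qed (simp cong: sets_pair_measure_cong)
  have distD: "distr M borel D = density lborel (normal_density 0 (sqrt v))"
    using D by (simp add: distributed_def cong: distr_cong)
  interpret Dp: prob_space "distr M borel D" by (rule prob_space_distr) simp
  have inner: "(\<integral>\<^sup>+y. ennreal (exp (c * y - c\<^sup>2 * v / 2)) \<partial>distr M borel D) = 1" for c
  proof -
    have eq: "normal_density 0 (sqrt v) y * exp (c * y - c\<^sup>2 * v / 2) = normal_density (c * v) (sqrt v) y" for y
      using v by (simp add: normal_density_def mult_exp_exp power2_eq_square field_simps)
    have "(\<integral>\<^sup>+y. ennreal (exp (c * y - c\<^sup>2 * v / 2)) \<partial>distr M borel D)
       = (\<integral>\<^sup>+y. ennreal (normal_density (c * v) (sqrt v) y) \<partial>lborel)"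
      unfolding distD by (subst nn_integral_density) (simp_all add: ennreal_mult[symmetric] eq)
    also have "\<dots> = 1"
      using v by (subst nn_integral_eq_integral) auto
    finally show ?thesis .
  qed
  show ?thesis
    unfolding gaussian_increment_def
  proof (intro conjI allI impI)
    fix A c :: "'a \<Rightarrow> real"
    assume [measurable]: "A \<in> borel_measurable G" "c \<in> borel_measurable G" and A: "\<forall>\<omega>. 0 \<le> A \<omega>"
    define \<Phi> where "\<Phi> = (\<lambda>(x, y). ennreal (A x * exp (c x * y - (c x)\<^sup>2 * v / 2)))"
    have [measurable]: "\<Phi> \<in> borel_measurable (G \<Otimes>\<^sub>M borel)" unfolding \<Phi>_def by measurable
    have "(\<integral>\<^sup>+\<omega>. ennreal (A \<omega> * exp (c \<omega> * D \<omega> - (c \<omega>)\<^sup>2 * v / 2)) \<partial>M)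
        = (\<integral>\<^sup>+z. \<Phi> z \<partial>distr M (G \<Otimes>\<^sub>M borel) (\<lambda>x. (x, D x)))"
      by (subst nn_integral_distr) (auto simp: \<Phi>_def)
    also have "\<dots> = (\<integral>\<^sup>+x. \<integral>\<^sup>+y. \<Phi> (x, y) \<partial>distr M borel D \<partial>distr M G (\<lambda>x. x))"
      unfolding prod[symmetric] by (subst Dp.nn_integral_fst) (auto cong: measurable_cong_sets)
    also have "\<dots> = (\<integral>\<^sup>+x. ennreal (A x) \<partial>distr M G (\<lambda>x. x))"
      by (intro nn_integral_cong) (simp add: \<Phi>_def ennreal_mult A nn_integral_cmult inner)
    also have "\<dots> = (\<integral>\<^sup>+\<omega>. ennreal (A \<omega>) \<partial>M)"
      by (subst nn_integral_distr) auto
    finally show "(\<integral>\<^sup>+\<omega>. ennreal (A \<omega> * exp (c \<omega> * D \<omega> - (c \<omega>)\<^sup>2 * v / 2)) \<partial>M) = (\<integral>\<^sup>+\<omega>. ennreal (A \<omega>) \<partial>M)" .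
  qed (use G v in auto)
qed

section \<open>Moments from the Laplace transform\<close>

text \<open>
  From \<open>1 + lx \<le> exp (lx)\<close> the function \<open>c exp (l\<^sup>2v/2) - c - l \<integral> D\<close> of \<open>l\<close> has a minimum at \<open>0\<close>, so its
  derivative, the negative of the mean, vanishes there. The second moment is the limit of the symmetric second
  difference quotients of the Laplace transform at \<open>0\<close>; these have the form \<open>\<integral> s\<^sub>n\<close> with squares \<open>s\<^sub>n\<close>, and
  exponential moments dominate them.
\<close>

lemma moments_of_gaussian_mgf:
  fixes D :: "'a \<Rightarrow> real" and c v :: real
  assumes "finite_measure N" and [measurable]: "D \<in> borel_measurable N" and c: "0 \<le> c"
    and mgf: "\<And>l::real. (\<integral>\<^sup>+\<omega>. ennreal (exp (l * D \<omega>)) \<partial>N) = ennreal (c * exp (l\<^sup>2 * v / 2))"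
  shows "integrable N D" "(\<integral>\<omega>. D \<omega> \<partial>N) = 0"
    "integrable N (\<lambda>\<omega>. (D \<omega>)\<^sup>2)" "(\<integral>\<omega>. (D \<omega>)\<^sup>2 \<partial>N) = c * v"
proof -
  interpret finite_measure N by fact
  have hE: "has_bochner_integral N (\<lambda>\<omega>. exp (l * D \<omega>)) (c * exp (l\<^sup>2 * v / 2))" for l
    by (rule has_bochner_integral_nn_integral) (use c mgf in auto)
  note iE = integrable.intros[OF hE] and eE = has_bochner_integral_integral_eq[OF hE]
  have exp_abs: "exp \<bar>x\<bar> \<le> exp x + exp (- x)" for x :: real
    by (cases "x \<ge> 0") auto
  have sq: "x\<^sup>2 \<le> 2 * exp \<bar>x\<bar>" for x :: real
    using exp_lower_Taylor_quadratic[of "\<bar>x\<bar>"] by (auto simp: field_simps)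
  have b2: "x\<^sup>2 \<le> 2 * (exp x + exp (- x))" for x :: real
    using sq[of x] exp_abs[of x] by simp
  have b1: "\<bar>x\<bar> \<le> exp x + exp (- x)" for x :: real
    using exp_ge_add_one_self[of "\<bar>x\<bar>"] exp_abs[of x] by linarith
  have iE1: "integrable N (\<lambda>\<omega>. exp (D \<omega>) + exp (- D \<omega>))"
    using iE[of 1] iE[of "-1"] by simp
  show iD: "integrable N D"
    by (rule Bochner_Integration.integrable_bound[OF iE1])
       (use b1 in \<open>auto simp: abs_of_nonneg add_nonneg_nonneg\<close>)
  have "integrable N (\<lambda>\<omega>. 2 * (exp (D \<omega>) + exp (- D \<omega>)))"
    by (rule integrable_mult_right) (rule iE1)
  then show iD2: "integrable N (\<lambda>\<omega>. (D \<omega>)\<^sup>2)"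
    by (rule Bochner_Integration.integrable_bound)
       (use b2 in \<open>auto simp: abs_of_nonneg add_nonneg_nonneg\<close>)
  have mass: "(\<integral>\<omega>. 1 \<partial>N) = c"
    using eE[of 0] by simp
  define \<mu> where "\<mu> = (\<integral>\<omega>. D \<omega> \<partial>N)"
  have "c + l * \<mu> \<le> c * exp (l\<^sup>2 * v / 2)" for l
  proof -
    have "c + l * \<mu> = (\<integral>\<omega>. 1 + l * D \<omega> \<partial>N)"
      using iD mass by (simp add: \<mu>_def)
    also have "\<dots> \<le> (\<integral>\<omega>. exp (l * D \<omega>) \<partial>N)"
      by (intro integral_mono iE) (use iD in auto)
    finally show ?thesis by (simp add: eE)
  qed
  moreover have "((\<lambda>l. c * exp (l\<^sup>2 * v / 2) - c - l * \<mu>) has_real_derivative - \<mu>) (at 0)"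
    by (auto intro!: derivative_eq_intros)
  ultimately have "- \<mu> = 0"
    by (intro DERIV_local_min[where d = 1 and x = 0 and f = "\<lambda>l. c * exp (l\<^sup>2 * v / 2) - c - l * \<mu>"])
       (auto simp: algebra_simps)
  then show "(\<integral>\<omega>. D \<omega> \<partial>N) = 0" by (simp add: \<mu>_def)
  define h where "h n = inverse (real (Suc n))" for n
  have h: "0 < h n" "h n \<le> 1" for n by (auto simp: h_def field_simps)
  have h0: "h \<longlonglongrightarrow> 0" unfolding h_def[abs_def] by (rule LIMSEQ_inverse_real_of_nat)
  define s where "s n \<omega> = ((exp (h n * D \<omega> / 2) - exp (- (h n * D \<omega> / 2))) / h n)\<^sup>2" for n \<omega>
  have sexp: "s n \<omega> = (exp (h n * D \<omega>) + exp (- h n * D \<omega>) - 2) / (h n)\<^sup>2" for n \<omega>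
  proof -
    have "(exp y - exp (- y))\<^sup>2 = exp (2 * y) + exp (- 2 * y) - 2" for y :: real
      using exp_double[of y] exp_double[of "- y"] by (simp add: power2_diff flip: exp_add)
    from this[of "h n * D \<omega> / 2"] show ?thesis by (simp add: s_def power_divide)
  qed
  have intS: "(\<integral>\<omega>. s n \<omega> \<partial>N) = 2 * c * ((exp ((h n)\<^sup>2 * (v / 2)) - 1) / (h n)\<^sup>2)" for n
  proof -
    have "(\<integral>\<omega>. (exp (h n * D \<omega>) + exp (- h n * D \<omega>)) - 2 \<partial>N) = (c * exp ((h n)\<^sup>2 * v / 2) + c * exp ((- h n)\<^sup>2 * v / 2)) - 2 * c"
      using iE[of "h n"] iE[of "- h n"] eE[of "h n"] eE[of "- h n"] mass
      by (subst Bochner_Integration.integral_diff, simp, simp, subst Bochner_Integration.integral_add) auto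
    then show ?thesis by (simp add: sexp right_diff_distrib)
  qed
  have "((\<lambda>y. exp (y * (v / 2))) has_real_derivative v / 2) (at 0)"
    by (auto intro!: derivative_eq_intros)
  then have L: "((\<lambda>y. (exp (y * (v / 2)) - 1) / y) \<longlongrightarrow> v / 2) (at 0)"
    by (simp add: DERIV_def)
  have "filterlim (\<lambda>n. (h n)\<^sup>2) (at 0) sequentially"
    using tendsto_power[OF h0, of 2] h less_imp_neq[OF h(1)]
    by (auto simp: filterlim_at intro!: always_eventually)
  then have "(\<lambda>n. (exp ((h n)\<^sup>2 * (v / 2)) - 1) / (h n)\<^sup>2) \<longlonglongrightarrow> v / 2"
    by (rule filterlim_compose[OF L])
  then have lim1: "(\<lambda>n. \<integral>\<omega>. s n \<omega> \<partial>N) \<longlonglongrightarrow> 2 * c * (v / 2)"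
    unfolding intS by (rule tendsto_mult[OF tendsto_const])
  have lim2: "(\<lambda>n. \<integral>\<omega>. s n \<omega> \<partial>N) \<longlonglongrightarrow> (\<integral>\<omega>. (D \<omega>)\<^sup>2 \<partial>N)"
  proof (rule integral_dominated_convergence[where w = "\<lambda>\<omega>. 2 * (exp (2 * D \<omega>) + exp (- 2 * D \<omega>))"])
    show "integrable N (\<lambda>\<omega>. 2 * (exp (2 * D \<omega>) + exp (- 2 * D \<omega>)))"
      using iE[of 2] iE[of "-2"] by simp
    show "AE \<omega> in N. (\<lambda>n. s n \<omega>) \<longlonglongrightarrow> (D \<omega>)\<^sup>2"
    proof (rule AE_I2)
      fix \<omega>
      have "((\<lambda>y. exp (y * D \<omega> / 2) - exp (- (y * D \<omega> / 2))) has_real_derivative D \<omega>) (at 0)"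
        by (auto intro!: derivative_eq_intros)
      then have "((\<lambda>y. (exp (y * D \<omega> / 2) - exp (- (y * D \<omega> / 2))) / y) \<longlongrightarrow> D \<omega>) (at 0)"
        by (simp add: DERIV_def)
      moreover have "filterlim h (at 0) sequentially"
        using h0 less_imp_neq[OF h(1)] by (auto simp: filterlim_at intro!: always_eventually)
      ultimately have "(\<lambda>n. (exp (h n * D \<omega> / 2) - exp (- (h n * D \<omega> / 2))) / h n) \<longlonglongrightarrow> D \<omega>"
        by (rule filterlim_compose)
      then show "(\<lambda>n. s n \<omega>) \<longlonglongrightarrow> (D \<omega>)\<^sup>2"
        unfolding s_def by (intro tendsto_intros)
    qed
    show "AE \<omega> in N. norm (s n \<omega>) \<le> 2 * (exp (2 * D \<omega>) + exp (- 2 * D \<omega>))" for n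
    proof (rule AE_I2)
      fix \<omega>
      have sinh_le: "\<bar>exp y - exp (- y)\<bar> \<le> 2 * \<bar>y\<bar> * exp \<bar>y\<bar>" for y :: real
      proof -
        have *: "\<bar>exp z - exp (- z)\<bar> \<le> 2 * z * exp z" if "0 \<le> z" for z :: real
        proof -
          have "1 - exp (- 2 * z) \<le> 2 * z" using exp_ge_add_one_self[of "- 2 * z"] by simp
          then have "exp z * (1 - exp (- 2 * z)) \<le> exp z * (2 * z)" by (rule mult_left_mono) simp
          moreover have "exp z * (1 - exp (- 2 * z)) = exp z - exp (- z)"
            by (simp add: right_diff_distrib flip: exp_add)
          moreover have "0 \<le> exp z - exp (- z)" using that by simp
          moreover have "exp z * (2 * z) = 2 * z * exp z" by simp
          ultimately show ?thesis by linarith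
        qed
        show ?thesis
          by (cases "0 \<le> y") (use *[of y] *[of "- y"] in \<open>auto simp: abs_minus_commute\<close>)
      qed
      define y where "y = h n * D \<omega> / 2"
      have "\<bar>(exp y - exp (- y)) / h n\<bar> \<le> 2 * \<bar>y\<bar> * exp \<bar>y\<bar> / h n"
        using sinh_le[of y] h(1)[of n] by (simp add: abs_divide divide_right_mono)
      also have "\<dots> = \<bar>D \<omega>\<bar> * exp (h n * \<bar>D \<omega>\<bar> / 2)"
        using h(1)[of n] by (simp add: y_def abs_mult)
      also have "\<dots> \<le> \<bar>D \<omega>\<bar> * exp (\<bar>D \<omega>\<bar> / 2)"
        using h(2)[of n] by (intro mult_left_mono) (auto simp: mult_left_le_one_le h less_imp_le)
      finally have "\<bar>(exp y - exp (- y)) / h n\<bar>\<^sup>2 \<le> (\<bar>D \<omega>\<bar> * exp (\<bar>D \<omega>\<bar> / 2))\<^sup>2"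
        by (rule power_mono) simp
      then have "s n \<omega> \<le> (D \<omega>)\<^sup>2 * exp \<bar>D \<omega>\<bar>"
        unfolding power2_abs
        by (simp add: s_def y_def power_mult_distrib power2_eq_square[of "exp _"] flip: exp_add)
      also have "\<dots> \<le> 2 * exp \<bar>D \<omega>\<bar> * exp \<bar>D \<omega>\<bar>"
        by (intro mult_right_mono sq) auto
      also have "\<dots> = 2 * exp \<bar>2 * D \<omega>\<bar>" by (simp flip: exp_add)
      also have "\<dots> \<le> 2 * (exp (2 * D \<omega>) + exp (- 2 * D \<omega>))"
        using exp_abs[of "2 * D \<omega>"] by simp
      finally show "norm (s n \<omega>) \<le> 2 * (exp (2 * D \<omega>) + exp (- 2 * D \<omega>))"
        by (simp add: s_def)
    qed
  qed (auto simp: s_def)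
  show "(\<integral>\<omega>. (D \<omega>)\<^sup>2 \<partial>N) = c * v"
    using LIMSEQ_unique[OF lim2 lim1] by simp
qed

text \<open>
  The Laplace transform of \<open>D\<close> under the finite measure with density \<open>A\<close> is that of a normal variable.
\<close>

lemma gaussian_increment_moments_nonneg:
  assumes D: "gaussian_increment M G D v" and A: "A \<in> borel_measurable G" "\<And>\<omega>. 0 \<le> A \<omega>" "integrable M A"
  shows "integrable M (\<lambda>\<omega>. A \<omega> * D \<omega>)" "(\<integral>\<omega>. A \<omega> * D \<omega> \<partial>M) = 0"
    "integrable M (\<lambda>\<omega>. A \<omega> * (D \<omega>)\<^sup>2)" "(\<integral>\<omega>. A \<omega> * (D \<omega>)\<^sup>2 \<partial>M) = v * (\<integral>\<omega>. A \<omega> \<partial>M)"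
proof -
  have [measurable]: "A \<in> borel_measurable M" "D \<in> borel_measurable M"
    using gaussian_incrementD[OF D] measurable_from_subalg A by auto
  define N where "N = density M (\<lambda>\<omega>. ennreal (A \<omega>))"
  have m: "(\<integral>\<^sup>+\<omega>. ennreal (A \<omega>) \<partial>M) = ennreal (\<integral>\<omega>. A \<omega> \<partial>M)"
    using A by (intro nn_integral_eq_integral) auto
  have fin: "finite_measure N"
    by (rule finite_measureI) (simp add: N_def emeasure_density m cong: nn_integral_cong)
  have "(\<integral>\<^sup>+\<omega>. ennreal (exp (l * D \<omega>)) \<partial>N) = ennreal ((\<integral>\<omega>. A \<omega> \<partial>M) * exp (l\<^sup>2 * v / 2))" for l :: real
  proof -
    have "bounded ((\<lambda>_. l) ` space M)"
      by (rule finite_imp_bounded) (rule finite_subset[of _ "{l}"], auto)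
    note E = gaussian_increment_exp[OF D A(1,2) _ _ this]
    have "(\<integral>\<^sup>+\<omega>. ennreal (exp (l * D \<omega>)) \<partial>N)
      = (\<integral>\<^sup>+\<omega>. ennreal (exp (l\<^sup>2 * v / 2)) * ennreal (A \<omega> * exp (l * D \<omega> - l\<^sup>2 * v / 2)) \<partial>M)"
      unfolding N_def using A(2)
      by (subst nn_integral_density) (auto simp: ennreal_mult[symmetric] mult_exp_exp intro!: nn_integral_cong)
    also have "\<dots> = ennreal (exp (l\<^sup>2 * v / 2)) * (\<integral>\<^sup>+\<omega>. ennreal (A \<omega>) \<partial>M)"
      using E by (subst nn_integral_cmult) (auto simp: m)
    finally show ?thesis
      using A(2) by (simp add: m ennreal_mult mult.commute)
  qed
  note mom = moments_of_gaussian_mgf[OF fin _ _ this]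
  have "D \<in> borel_measurable N" "0 \<le> (\<integral>\<omega>. A \<omega> \<partial>M)" using A(2) by (auto simp: N_def)
  note mom = mom[OF this]
  show "integrable M (\<lambda>\<omega>. A \<omega> * D \<omega>)" "(\<integral>\<omega>. A \<omega> * D \<omega> \<partial>M) = 0"
    "integrable M (\<lambda>\<omega>. A \<omega> * (D \<omega>)\<^sup>2)" "(\<integral>\<omega>. A \<omega> * (D \<omega>)\<^sup>2 \<partial>M) = v * (\<integral>\<omega>. A \<omega> \<partial>M)"
    using mom A(2) by (simp_all add: N_def integrable_density integral_density)
qed

lemma gaussian_increment_moments:
  assumes D: "gaussian_increment M G D v" and A: "A \<in> borel_measurable G" "integrable M A"
  shows "integrable M (\<lambda>\<omega>. A \<omega> * D \<omega>)" "(\<integral>\<omega>. A \<omega> * D \<omega> \<partial>M) = 0"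
    "integrable M (\<lambda>\<omega>. A \<omega> * (D \<omega>)\<^sup>2)" "(\<integral>\<omega>. A \<omega> * (D \<omega>)\<^sup>2 \<partial>M) = v * (\<integral>\<omega>. A \<omega> \<partial>M)"
proof -
  have [measurable]: "A \<in> borel_measurable G" by fact
  have p: "(\<lambda>\<omega>. max 0 (A \<omega>)) \<in> borel_measurable G" "(\<lambda>\<omega>. max 0 (- A \<omega>)) \<in> borel_measurable G" by auto
  have i: "integrable M (\<lambda>\<omega>. max 0 (A \<omega>))" "integrable M (\<lambda>\<omega>. max 0 (- A \<omega>))" using A by auto
  note P = gaussian_increment_moments_nonneg[OF D p(1) _ i(1)] and N = gaussian_increment_moments_nonneg[OF D p(2) _ i(2)]
  have e: "A \<omega> = max 0 (A \<omega>) - max 0 (- A \<omega>)" for \<omega> by (auto simp: max_def)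
  have e1: "(\<lambda>\<omega>. A \<omega> * f \<omega>) = (\<lambda>\<omega>. max 0 (A \<omega>) * f \<omega> - max 0 (- A \<omega>) * f \<omega>)" for f :: "'a \<Rightarrow> real"
    by (subst e) (simp add: left_diff_distrib)
  show "integrable M (\<lambda>\<omega>. A \<omega> * D \<omega>)" "(\<integral>\<omega>. A \<omega> * D \<omega> \<partial>M) = 0"
    "integrable M (\<lambda>\<omega>. A \<omega> * (D \<omega>)\<^sup>2)"
    unfolding e1 using P N by auto
  have "(\<integral>\<omega>. A \<omega> \<partial>M) = (\<integral>\<omega>. max 0 (A \<omega>) \<partial>M) - (\<integral>\<omega>. max 0 (- A \<omega>) \<partial>M)"
    by (subst Bochner_Integration.integral_diff[symmetric]) (use i e in auto)
  then show "(\<integral>\<omega>. A \<omega> * (D \<omega>)\<^sup>2 \<partial>M) = v * (\<integral>\<omega>. A \<omega> \<partial>M)"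
    unfolding e1 using P N by (simp add: right_diff_distrib)
qed

section \<open>Martingales with independent Gaussian increments\<close>

text \<open>
  The variance of the increment over \<open>(s, t]\<close> is recorded as the mass of this interval under a measure \<open>\<nu>\<close> on the time
  axis, so that the isometry reads \<open>E(\<integral> S dY)\<^sup>2 = E \<integral> S\<^sup>2 d\<nu>\<close>. The locale serves both for \<open>W\<close>, with Lebesgue
  measure, and for \<open>X\<close>, with \<open>\<sigma>\<^sub>s\<^sup>2 ds\<close>.
\<close>

locale gaussian_martingale = prob_space M for M :: "'a measure" +
  fixes F :: "real \<Rightarrow> 'a measure" and T :: real and Y :: "real \<Rightarrow> 'a \<Rightarrow> real" and \<nu> :: "real measure"
  assumes subalg: "t \<in> {0..T} \<Longrightarrow> subalgebra M (F t)"
    and mono_filtration: "0 \<le> s \<Longrightarrow> s \<le> t \<Longrightarrow> t \<le> T \<Longrightarrow> sets (F s) \<subseteq> sets (F t)"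
    and adapted: "t \<in> {0..T} \<Longrightarrow> Y t \<in> borel_measurable (F t)"
    and sets_\<nu> [measurable_cong]: "sets \<nu> = sets borel" and finite_\<nu>: "finite_measure \<nu>"
    and increment_less: "0 \<le> s \<Longrightarrow> s < t \<Longrightarrow> t \<le> T \<Longrightarrow>
      gaussian_increment M (F s) (\<lambda>\<omega>. Y t \<omega> - Y s \<omega>) (measure \<nu> {s<..t})"
begin

sublocale \<nu>: finite_measure \<nu> by (rule finite_\<nu>)

lemma subalg_le: "0 \<le> s \<Longrightarrow> s \<le> t \<Longrightarrow> t \<le> T \<Longrightarrow> subalgebra (F t) (F s)"
  using subalg[of s] subalg[of t] mono_filtration[of s t] by (auto simp: subalgebra_def)

lemma measurable_le: "0 \<le> s \<Longrightarrow> s \<le> t \<Longrightarrow> t \<le> T \<Longrightarrow> f \<in> borel_measurable (F s) \<Longrightarrow> f \<in> borel_measurable (F t)"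
  by (rule measurable_from_subalg[OF subalg_le])

lemma measurable_M: "t \<in> {0..T} \<Longrightarrow> f \<in> borel_measurable (F t) \<Longrightarrow> f \<in> borel_measurable M"
  by (rule measurable_from_subalg[OF subalg])

lemma Y_measurable_le: "0 \<le> s \<Longrightarrow> s \<le> t \<Longrightarrow> t \<le> T \<Longrightarrow> Y s \<in> borel_measurable (F t)"
  by (rule measurable_le[of s]) (auto intro: adapted)

lemma Y_measurable: "t \<in> {0..T} \<Longrightarrow> Y t \<in> borel_measurable M"
  by (rule measurable_M[OF _ adapted])

lemma increment:
  assumes "0 \<le> s" "s \<le> t" "t \<le> T"
  shows "gaussian_increment M (F s) (\<lambda>\<omega>. Y t \<omega> - Y s \<omega>) (measure \<nu> {s<..t})"
proof (cases "s = t")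
  case True
  then show ?thesis using gaussian_increment_zero[OF subalg[of s]] assms by simp
next
  case False
  then show ?thesis using assms by (intro increment_less) auto
qed

lemma integrable_increment:
  assumes "0 \<le> s" "s \<le> t" "t \<le> T"
  shows "integrable M (\<lambda>\<omega>. Y t \<omega> - Y s \<omega>)"
proof -
  have "integrable M (\<lambda>\<omega>. 1 * (Y t \<omega> - Y s \<omega>))"
    by (rule gaussian_increment_moments(1)[OF increment[OF assms]]) simp_all
  then show ?thesis by simp
qed

lemma bounded_measurable_integrable:
  fixes \<eta> Z :: "'a \<Rightarrow> real"
  assumes "t \<in> {0..T}" "\<eta> \<in> borel_measurable (F t)" "bounded (\<eta> ` space M)" "integrable M Z"
  shows "integrable M (\<lambda>\<omega>. \<eta> \<omega> * Z \<omega>)"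
proof -
  obtain K where K: "\<And>\<omega>. \<omega> \<in> space M \<Longrightarrow> \<bar>\<eta> \<omega>\<bar> \<le> K"
    using assms(3) unfolding bounded_iff by auto
  have [measurable]: "\<eta> \<in> borel_measurable M" "Z \<in> borel_measurable M"
    using measurable_M[OF assms(1,2)] borel_measurable_integrable[OF assms(4)] .
  show ?thesis
  proof (rule Bochner_Integration.integrable_bound[where f = "\<lambda>\<omega>. K * Z \<omega>"])
    show "AE \<omega> in M. norm (\<eta> \<omega> * Z \<omega>) \<le> norm (K * Z \<omega>)"
    proof (rule AE_I2)
      fix \<omega> assume "\<omega> \<in> space M"
      then have "\<bar>\<eta> \<omega>\<bar> \<le> \<bar>K\<bar>" using K[of \<omega>] by simp
      then show "norm (\<eta> \<omega> * Z \<omega>) \<le> norm (K * Z \<omega>)" by (simp add: abs_mult mult_right_mono)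
    qed
  qed (use assms in auto)
qed

lemma orthogonal_increment:
  assumes st: "0 \<le> s" "s \<le> t" "t \<le> T"
    and \<eta>: "\<eta> \<in> borel_measurable (F s)" "bounded (\<eta> ` space M)"
    and Z: "Z \<in> borel_measurable (F s)" "integrable M Z"
  shows "integrable M (\<lambda>\<omega>. \<eta> \<omega> * Z \<omega> * (Y t \<omega> - Y s \<omega>))"
    "(\<integral>\<omega>. \<eta> \<omega> * Z \<omega> * (Y t \<omega> - Y s \<omega>) \<partial>M) = 0"
proof -
  have "(\<lambda>\<omega>. \<eta> \<omega> * Z \<omega>) \<in> borel_measurable (F s)" using \<eta> Z by auto
  moreover have "integrable M (\<lambda>\<omega>. \<eta> \<omega> * Z \<omega>)"
    by (rule bounded_measurable_integrable[of s]) (use assms in auto)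
  ultimately show "integrable M (\<lambda>\<omega>. \<eta> \<omega> * Z \<omega> * (Y t \<omega> - Y s \<omega>))"
    "(\<integral>\<omega>. \<eta> \<omega> * Z \<omega> * (Y t \<omega> - Y s \<omega>) \<partial>M) = 0"
    using gaussian_increment_moments(1,2)[OF increment[OF st]] by auto
qed

lemma bounded_times:
  fixes f g :: "'a \<Rightarrow> real"
  shows "bounded (f ` S) \<Longrightarrow> bounded (g ` S) \<Longrightarrow> bounded ((\<lambda>x. f x * g x) ` S)"
proof -
  assume "bounded (f ` S)" "bounded (g ` S)"
  then obtain K L where K: "\<And>x. x \<in> S \<Longrightarrow> \<bar>f x\<bar> \<le> K" and L: "\<And>x. x \<in> S \<Longrightarrow> \<bar>g x\<bar> \<le> L"
    unfolding bounded_iff by auto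
  have "\<bar>f x * g x\<bar> \<le> K * L" if "x \<in> S" for x
    unfolding abs_mult using K[OF that] L[OF that] by (intro mult_mono) auto
  then show ?thesis unfolding bounded_iff by auto
qed

text \<open>
  Cut the two increments at \<open>a'\<close> and at the smaller right end point. Then only the square of the increment over the
  common part \<open>(a', m]\<close> contributes; every other product contains an increment over an interval that starts after
  everything else in it is known.
\<close>

lemma covariance_ordered:
  assumes ab: "0 \<le> a" "a \<le> b" "b \<le> T" and ab': "0 \<le> a'" "a' \<le> b'" "b' \<le> T" and le: "a \<le> a'"
    and \<xi>: "\<xi> \<in> borel_measurable (F a)" "bounded (\<xi> ` space M)"
    and \<xi>': "\<xi>' \<in> borel_measurable (F a')" "bounded (\<xi>' ` space M)"
  shows "has_bochner_integral M (\<lambda>\<omega>. (\<xi> \<omega> * (Y b \<omega> - Y a \<omega>)) * (\<xi>' \<omega> * (Y b' \<omega> - Y a' \<omega>)))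
    ((\<integral>\<omega>. \<xi> \<omega> * \<xi>' \<omega> \<partial>M) * measure \<nu> ({a<..b} \<inter> {a'<..b'}))"
proof -
  define \<eta> where "\<eta> \<omega> = \<xi> \<omega> * \<xi>' \<omega>" for \<omega>
  have \<eta>m: "\<eta> \<in> borel_measurable (F a')"
    using measurable_le[OF ab(1) le _ \<xi>(1)] ab' \<xi>'(1) unfolding \<eta>_def by auto
  have \<eta>b: "bounded (\<eta> ` space M)" unfolding \<eta>_def using \<xi> \<xi>' by (intro bounded_times)
  have \<eta>i: "integrable M \<eta>"
    using bounded_measurable_integrable[OF _ \<eta>m \<eta>b, of "\<lambda>_. 1"] ab' by simp
  note hbi = has_bochner_integral_iff
  show ?thesis
  proof (cases "b \<le> a'")
    case True
    then have S: "{a<..b} \<inter> {a'<..b'} = {}" by auto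
    have "has_bochner_integral M (\<lambda>\<omega>. \<eta> \<omega> * (Y b \<omega> - Y a \<omega>) * (Y b' \<omega> - Y a' \<omega>)) 0"
      unfolding hbi using orthogonal_increment[OF ab' \<eta>m \<eta>b, of "\<lambda>\<omega>. Y b \<omega> - Y a \<omega>"]
        integrable_increment[OF ab] Y_measurable_le[of b a'] Y_measurable_le[of a a'] ab ab' True by auto
    then show ?thesis unfolding S by (simp add: \<eta>_def mult_ac)
  next
    case False
    \<comment> \<open>one of \<open>R\<close> and \<open>R'\<close> below is zero, whichever interval ends first\<close>
    define m where "m = min b b'"
    have m: "a' \<le> m" "m \<le> b" "m \<le> b'" "m = b \<or> m = b'" using False ab' by (auto simp: m_def)
    define P where "P \<omega> = Y a' \<omega> - Y a \<omega>" for \<omega>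
    define Q where "Q \<omega> = Y m \<omega> - Y a' \<omega>" for \<omega>
    define R where "R \<omega> = Y b \<omega> - Y m \<omega>" for \<omega>
    define R' where "R' \<omega> = Y b' \<omega> - Y m \<omega>" for \<omega>
    have \<eta>m': "\<eta> \<in> borel_measurable (F m)" by (rule measurable_le[OF _ _ _ \<eta>m]) (use m ab ab' in auto)
    have I: "integrable M P" "integrable M Q"
      unfolding P_def Q_def using ab ab' le m by (auto intro!: integrable_increment)
    have Pm: "P \<in> borel_measurable (F a')" "P \<in> borel_measurable (F m)" and Qm: "Q \<in> borel_measurable (F m)"
      unfolding P_def Q_def using ab ab' le m by (auto intro!: borel_measurable_diff Y_measurable_le)
    have 1: "has_bochner_integral M (\<lambda>\<omega>. \<eta> \<omega> * P \<omega> * Q \<omega>) 0"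
      unfolding hbi Q_def using orthogonal_increment[OF _ m(1) _ \<eta>m \<eta>b Pm(1) I(1)] ab ab' m by auto
    have 2: "has_bochner_integral M (\<lambda>\<omega>. \<eta> \<omega> * P \<omega> * R' \<omega>) 0"
      unfolding hbi R'_def using orthogonal_increment[OF _ m(3) _ \<eta>m' \<eta>b Pm(2) I(1)] ab ab' m by auto
    have 3: "has_bochner_integral M (\<lambda>\<omega>. \<eta> \<omega> * Q \<omega> * R' \<omega>) 0"
      unfolding hbi R'_def using orthogonal_increment[OF _ m(3) _ \<eta>m' \<eta>b Qm I(2)] ab ab' m by auto
    have 4: "has_bochner_integral M (\<lambda>\<omega>. \<eta> \<omega> * Q \<omega> * R \<omega>) 0"
      unfolding hbi R_def using orthogonal_increment[OF _ m(2) _ \<eta>m' \<eta>b Qm I(2)] ab ab' m by auto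
    have 5: "has_bochner_integral M (\<lambda>\<omega>. \<eta> \<omega> * (Q \<omega>)\<^sup>2) ((\<integral>\<omega>. \<eta> \<omega> \<partial>M) * measure \<nu> {a'<..m})"
      unfolding hbi Q_def using gaussian_increment_moments(3,4)[OF increment[OF _ m(1)] \<eta>m \<eta>i] ab ab' m
      by (auto simp: mult.commute)
    have S: "{a<..b} \<inter> {a'<..b'} = {a'<..m}" using le by (auto simp: m_def)
    have E: "(\<lambda>\<omega>. (\<xi> \<omega> * (Y b \<omega> - Y a \<omega>)) * (\<xi>' \<omega> * (Y b' \<omega> - Y a' \<omega>)))
      = (\<lambda>\<omega>. \<eta> \<omega> * P \<omega> * Q \<omega> + \<eta> \<omega> * P \<omega> * R' \<omega> + \<eta> \<omega> * Q \<omega> * R' \<omega> + \<eta> \<omega> * Q \<omega> * R \<omega> + \<eta> \<omega> * (Q \<omega>)\<^sup>2)"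
    proof
      fix \<omega>
      have z: "R \<omega> * R' \<omega> = 0" using m(4) by (auto simp: R_def R'_def)
      have "Y b \<omega> - Y a \<omega> = P \<omega> + Q \<omega> + R \<omega>" "Y b' \<omega> - Y a' \<omega> = Q \<omega> + R' \<omega>"
        by (simp_all add: P_def Q_def R_def R'_def)
      then have "(\<xi> \<omega> * (Y b \<omega> - Y a \<omega>)) * (\<xi>' \<omega> * (Y b' \<omega> - Y a' \<omega>))
        = \<eta> \<omega> * P \<omega> * Q \<omega> + \<eta> \<omega> * P \<omega> * R' \<omega> + \<eta> \<omega> * Q \<omega> * R' \<omega> + \<eta> \<omega> * Q \<omega> * R \<omega> + \<eta> \<omega> * (Q \<omega>)\<^sup>2
          + \<eta> \<omega> * (R \<omega> * R' \<omega>)"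
        by (simp add: \<eta>_def power2_eq_square algebra_simps)
      with z show "(\<xi> \<omega> * (Y b \<omega> - Y a \<omega>)) * (\<xi>' \<omega> * (Y b' \<omega> - Y a' \<omega>))
        = \<eta> \<omega> * P \<omega> * Q \<omega> + \<eta> \<omega> * P \<omega> * R' \<omega> + \<eta> \<omega> * Q \<omega> * R' \<omega> + \<eta> \<omega> * Q \<omega> * R \<omega> + \<eta> \<omega> * (Q \<omega>)\<^sup>2"
        by simp
    qed
    show ?thesis
      unfolding S E
      using has_bochner_integral_add[OF has_bochner_integral_add[OF has_bochner_integral_add[OF
          has_bochner_integral_add[OF 1 2] 3] 4] 5]
      by (simp add: \<eta>_def)
  qed
qed

lemma covariance:
  assumes "0 \<le> a" "a \<le> b" "b \<le> T" and "0 \<le> a'" "a' \<le> b'" "b' \<le> T"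
    and "\<xi> \<in> borel_measurable (F a)" "bounded (\<xi> ` space M)"
    and "\<xi>' \<in> borel_measurable (F a')" "bounded (\<xi>' ` space M)"
  shows "has_bochner_integral M (\<lambda>\<omega>. (\<xi> \<omega> * (Y b \<omega> - Y a \<omega>)) * (\<xi>' \<omega> * (Y b' \<omega> - Y a' \<omega>)))
    ((\<integral>\<omega>. \<xi> \<omega> * \<xi>' \<omega> \<partial>M) * measure \<nu> ({a<..b} \<inter> {a'<..b'}))"
  using covariance_ordered[of a b a' b' \<xi> \<xi>'] covariance_ordered[of a' b' a b \<xi>' \<xi>] assms
  by (cases "a \<le> a'") (auto simp: mult.commute Int_commute)

text \<open>
  The intervals may overlap. Hence differences of simple processes over different partitions are covered
  without passing to a common refinement.
\<close>

lemma ito_isometry: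
  fixes a b :: "'i \<Rightarrow> real" and \<xi> :: "'i \<Rightarrow> 'a \<Rightarrow> real"
  assumes I: "finite I" and ab: "\<And>i. i \<in> I \<Longrightarrow> 0 \<le> a i \<and> a i \<le> b i \<and> b i \<le> T"
    and \<xi>: "\<And>i. i \<in> I \<Longrightarrow> \<xi> i \<in> borel_measurable (F (a i))" "\<And>i. i \<in> I \<Longrightarrow> bounded (\<xi> i ` space M)"
  shows "(\<integral>\<^sup>+\<omega>. ennreal ((\<Sum>i\<in>I. \<xi> i \<omega> * (Y (b i) \<omega> - Y (a i) \<omega>))\<^sup>2) \<partial>M)
     = (\<integral>\<^sup>+\<omega>. (\<integral>\<^sup>+s. ennreal ((\<Sum>i\<in>I. \<xi> i \<omega> * indicator {a i<..b i} s)\<^sup>2) \<partial>\<nu>) \<partial>M)"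
proof -
  define m where "m i j = measure \<nu> ({a i<..b i} \<inter> {a j<..b j})" for i j
  have int\<xi>: "integrable M (\<lambda>\<omega>. \<xi> i \<omega> * \<xi> j \<omega>)" if "i \<in> I" "j \<in> I" for i j
  proof -
    have "integrable M (\<xi> j)"
      using bounded_measurable_integrable[of "a j" "\<xi> j" "\<lambda>_. 1"] \<xi> ab that by force
    then show ?thesis using bounded_measurable_integrable[of "a i" "\<xi> i" "\<xi> j"] \<xi> ab that by force
  qed
  have "has_bochner_integral M (\<lambda>\<omega>. \<Sum>i\<in>I. \<Sum>j\<in>I. (\<xi> i \<omega> * (Y (b i) \<omega> - Y (a i) \<omega>)) * (\<xi> j \<omega> * (Y (b j) \<omega> - Y (a j) \<omega>)))
     (\<Sum>i\<in>I. \<Sum>j\<in>I. (\<integral>\<omega>. \<xi> i \<omega> * \<xi> j \<omega> \<partial>M) * m i j)"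
    unfolding m_def
    by (intro has_bochner_integral_sum covariance) (use ab \<xi> in auto)
  then have L: "has_bochner_integral M (\<lambda>\<omega>. (\<Sum>i\<in>I. \<xi> i \<omega> * (Y (b i) \<omega> - Y (a i) \<omega>))\<^sup>2)
     (\<Sum>i\<in>I. \<Sum>j\<in>I. (\<integral>\<omega>. \<xi> i \<omega> * \<xi> j \<omega> \<partial>M) * m i j)"
    by (simp add: power2_eq_square sum_product)
  have inner: "has_bochner_integral \<nu> (\<lambda>s. (\<Sum>i\<in>I. \<xi> i \<omega> * indicator {a i<..b i} s)\<^sup>2) (\<Sum>i\<in>I. \<Sum>j\<in>I. \<xi> i \<omega> * \<xi> j \<omega> * m i j)" for \<omega>
  proof -
    have "has_bochner_integral \<nu> (\<lambda>s. \<Sum>i\<in>I. \<Sum>j\<in>I. \<xi> i \<omega> * \<xi> j \<omega> * indicator ({a i<..b i} \<inter> {a j<..b j}) s)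
       (\<Sum>i\<in>I. \<Sum>j\<in>I. \<xi> i \<omega> * \<xi> j \<omega> * m i j)"
      unfolding m_def
      by (intro has_bochner_integral_sum has_bochner_integral_mult_right has_bochner_integral_real_indicator)
        (auto simp: sets_\<nu> less_top[symmetric])
    then show ?thesis
      by (simp add: power2_eq_square sum_product indicator_inter_arith mult_ac del: Int_greaterThanAtMost)
  qed
  have R: "has_bochner_integral M (\<lambda>\<omega>. \<Sum>i\<in>I. \<Sum>j\<in>I. \<xi> i \<omega> * \<xi> j \<omega> * m i j) (\<Sum>i\<in>I. \<Sum>j\<in>I. (\<integral>\<omega>. \<xi> i \<omega> * \<xi> j \<omega> \<partial>M) * m i j)"
    by (intro has_bochner_integral_sum has_bochner_integral_mult_left has_bochner_integral_integrable int\<xi>)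
  have nnR: "0 \<le> (\<Sum>i\<in>I. \<Sum>j\<in>I. \<xi> i \<omega> * \<xi> j \<omega> * m i j)" for \<omega>
    by (subst has_bochner_integral_integral_eq[OF inner, symmetric]) simp
  have "(\<integral>\<^sup>+\<omega>. (\<integral>\<^sup>+s. ennreal ((\<Sum>i\<in>I. \<xi> i \<omega> * indicator {a i<..b i} s)\<^sup>2) \<partial>\<nu>) \<partial>M)
    = (\<integral>\<^sup>+\<omega>. ennreal (\<Sum>i\<in>I. \<Sum>j\<in>I. \<xi> i \<omega> * \<xi> j \<omega> * m i j) \<partial>M)"
    using inner by (intro nn_integral_cong) (auto simp: has_bochner_integral_iff nn_integral_eq_integral)
  also have "\<dots> = ennreal (\<Sum>i\<in>I. \<Sum>j\<in>I. (\<integral>\<omega>. \<xi> i \<omega> * \<xi> j \<omega> \<partial>M) * m i j)"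
    using R nnR by (auto simp: has_bochner_integral_iff nn_integral_eq_integral)
  also have "\<dots> = (\<integral>\<^sup>+\<omega>. ennreal ((\<Sum>i\<in>I. \<xi> i \<omega> * (Y (b i) \<omega> - Y (a i) \<omega>))\<^sup>2) \<partial>M)"
    using L by (auto simp: has_bochner_integral_iff nn_integral_eq_integral)
  finally show ?thesis by simp
qed

end

section \<open>Integrals of simple processes\<close>

lemma is_simple_mono:
  assumes "is_simple M F T (n, \<tau>, \<xi>)" "i \<le> j" "j \<le> n"
  shows "\<tau> i \<le> \<tau> j"
  using assms(2,3)
proof (induction j rule: dec_induct)
  case (step k)
  then have "\<tau> k \<le> \<tau> (Suc k)" using assms(1) by (auto simp: is_simple_def)
  then show ?case using step by simp
qed simp

lemma is_simpleD:
  assumes "is_simple M F T (n, \<tau>, \<xi>)" "i < n"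
  shows "0 \<le> \<tau> i" "\<tau> i \<le> \<tau> (Suc i)" "\<tau> (Suc i) \<le> T" "\<xi> i \<in> borel_measurable (F (\<tau> i))" "bounded (\<xi> i ` space M)"
  using assms by (auto simp: is_simple_def)

text \<open>
  In the square of the sum all mixed terms vanish, as the intervals are disjoint.
\<close>

lemma step_square_integral:
  fixes \<tau> :: "nat \<Rightarrow> real" and c :: "nat \<Rightarrow> real"
  assumes \<nu>: "finite_measure \<nu>" "sets \<nu> = sets borel" and mono: "\<And>i j. i \<le> j \<Longrightarrow> j \<le> n \<Longrightarrow> \<tau> i \<le> \<tau> j"
  shows "has_bochner_integral \<nu> (\<lambda>s. (\<Sum>i<n. c i * indicator {\<tau> i<..\<tau> (Suc i)} s)\<^sup>2)
     (\<Sum>i<n. (c i)\<^sup>2 * measure \<nu> {\<tau> i<..\<tau> (Suc i)})"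
  using mono
proof (induction n)
  case (Suc n)
  interpret finite_measure \<nu> by fact
  have "(\<Sum>i<n. c i * indicator {\<tau> i<..\<tau> (Suc i)} s) * indicator {\<tau> n<..\<tau> (Suc n)} s = 0" for s
    unfolding sum_distrib_right
  proof (intro sum.neutral ballI)
    fix i assume "i \<in> {..<n}"
    then have "\<tau> (Suc i) \<le> \<tau> n" using Suc.prems[of "Suc i" n] by auto
    then show "c i * indicator {\<tau> i<..\<tau> (Suc i)} s * indicator {\<tau> n<..\<tau> (Suc n)} s = 0"
      by (auto simp: indicator_def)
  qed
  then have "(\<Sum>i<Suc n. c i * indicator {\<tau> i<..\<tau> (Suc i)} s)\<^sup>2
      = (\<Sum>i<n. c i * indicator {\<tau> i<..\<tau> (Suc i)} s)\<^sup>2 + (c n)\<^sup>2 * indicator {\<tau> n<..\<tau> (Suc n)} s" for s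
    by (simp add: power2_sum power_mult_distrib power2_eq_square[of "indicator _ _"] mult_ac flip: indicator_inter_arith)
  moreover have "has_bochner_integral \<nu> (\<lambda>s. (c n)\<^sup>2 * indicator {\<tau> n<..\<tau> (Suc n)} s) ((c n)\<^sup>2 * measure \<nu> {\<tau> n<..\<tau> (Suc n)})"
    by (intro has_bochner_integral_mult_right has_bochner_integral_real_indicator) (auto simp: \<nu> less_top[symmetric])
  ultimately show ?case
    using has_bochner_integral_add[OF Suc.IH] Suc.prems by (simp del: sum_mult_indicator)
qed (simp add: has_bochner_integral_zero)

context gaussian_martingale
begin

lemma simple_coefficient_measurable:
  assumes "is_simple M F T (n, \<tau>, \<xi>)" "i < n"
  shows "\<xi> i \<in> borel_measurable M"
  by (rule measurable_M[of "\<tau> i"]) (use is_simpleD[OF assms] in auto)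

lemma simple_process_measurable:
  assumes "is_simple M F T S"
  shows "(\<lambda>(\<omega>, s). simple_process S s \<omega>) \<in> borel_measurable (M \<Otimes>\<^sub>M borel)"
proof -
  obtain n \<tau> \<xi> where S: "S = (n, \<tau>, \<xi>)" by (cases S)
  have [measurable]: "\<xi> i \<in> borel_measurable M" if "i \<in> {..<n}" for i
    using simple_coefficient_measurable[of n \<tau> \<xi> i] assms that S by simp
  show ?thesis unfolding S simple_process_def prod.case by measurable
qed

lemma simple_integral_measurable:
  assumes "is_simple M F T S"
  shows "simple_integral Y S \<in> borel_measurable M"
proof -
  obtain n \<tau> \<xi> where S: "S = (n, \<tau>, \<xi>)" by (cases S)
  have "(\<lambda>\<omega>. \<xi> i \<omega> * (Y (\<tau> (Suc i)) \<omega> - Y (\<tau> i) \<omega>)) \<in> borel_measurable M" if "i \<in> {..<n}" for i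
    using simple_coefficient_measurable[of n \<tau> \<xi> i] is_simpleD[of M F T n \<tau> \<xi> i] assms that S
    by (intro borel_measurable_times borel_measurable_diff Y_measurable) auto
  then show ?thesis unfolding S simple_integral_def by (simp add: borel_measurable_sum)
qed

abbreviation mean_square :: "(real \<Rightarrow> 'a \<Rightarrow> real) \<Rightarrow> ennreal" where
  "mean_square G \<equiv> \<integral>\<^sup>+\<omega>. (\<integral>\<^sup>+s. ennreal ((G s \<omega>)\<^sup>2) \<partial>\<nu>) \<partial>M"

lemma nn_integral_product:
  assumes "(\<lambda>(\<omega>, s). G s \<omega>) \<in> borel_measurable (M \<Otimes>\<^sub>M borel)"
  shows "(\<integral>\<^sup>+\<omega>. (\<integral>\<^sup>+s. ennreal ((G s \<omega>)\<^sup>2) \<partial>\<nu>) \<partial>M) = (\<integral>\<^sup>+z. ennreal ((case z of (\<omega>, s) \<Rightarrow> G s \<omega>)\<^sup>2) \<partial>(M \<Otimes>\<^sub>M \<nu>))"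
proof -
  have [measurable]: "(\<lambda>(\<omega>, s). G s \<omega>) \<in> borel_measurable (M \<Otimes>\<^sub>M \<nu>)"
    using assms by (simp cong: measurable_cong_sets sets_pair_measure_cong add: sets_\<nu>)
  show ?thesis by (subst \<nu>.nn_integral_fst[symmetric]) auto
qed

lemma mean_square_add_tendsto_0:
  assumes p: "\<And>k. (\<lambda>(\<omega>, s). p k s \<omega>) \<in> borel_measurable (M \<Otimes>\<^sub>M borel)"
    and q: "\<And>k. (\<lambda>(\<omega>, s). q k s \<omega>) \<in> borel_measurable (M \<Otimes>\<^sub>M borel)"
    and lim: "(\<lambda>k. mean_square (p k)) \<longlonglongrightarrow> 0" "(\<lambda>k. mean_square (q k)) \<longlonglongrightarrow> 0"
  shows "(\<lambda>k. mean_square (\<lambda>s \<omega>. p k s \<omega> + q k s \<omega>)) \<longlonglongrightarrow> 0"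
proof -
  have m: "(\<lambda>(\<omega>, s). p k s \<omega>) \<in> borel_measurable (M \<Otimes>\<^sub>M \<nu>)" "(\<lambda>(\<omega>, s). q k s \<omega>) \<in> borel_measurable (M \<Otimes>\<^sub>M \<nu>)" for k
    using p q by (simp_all cong: measurable_cong_sets sets_pair_measure_cong add: sets_\<nu>)
  have pq: "(\<lambda>(\<omega>, s). p k s \<omega> + q k s \<omega>) = (\<lambda>z. (case z of (\<omega>, s) \<Rightarrow> p k s \<omega>) + (case z of (\<omega>, s) \<Rightarrow> q k s \<omega>))" for k
    by auto
  have "(\<lambda>(\<omega>, s). p k s \<omega> + q k s \<omega>) \<in> borel_measurable (M \<Otimes>\<^sub>M borel)" for k
    unfolding pq by (intro borel_measurable_add p q)
  from nn_integral_product[OF this] show ?thesis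
    using nn_integral_square_add_tendsto_0[OF m lim[unfolded nn_integral_product[OF p] nn_integral_product[OF q]]]
    by (simp add: fun_cong[OF pq, simplified] split_beta')
qed

text \<open>
  The three partitions are combined into one family over the disjoint sum of their index sets. Three processes are
  needed below to compare an increment \<open>X\<^sub>t - X\<^sub>s\<close>, approximated by two of them, with a third.
\<close>

lemma simple_integral_isometry:
  assumes S: "is_simple M F T S1" "is_simple M F T S2" "is_simple M F T S3"
  shows "(\<integral>\<^sup>+\<omega>. ennreal ((simple_integral Y S1 \<omega> - simple_integral Y S2 \<omega> - simple_integral Y S3 \<omega>)\<^sup>2) \<partial>M)
    = mean_square (\<lambda>s \<omega>. simple_process S1 s \<omega> - simple_process S2 s \<omega> - simple_process S3 s \<omega>)"
proof -
  obtain n1 \<tau>1 \<xi>1 n2 \<tau>2 \<xi>2 n3 \<tau>3 \<xi>3 where eq: "S1 = (n1, \<tau>1, \<xi>1)" "S2 = (n2, \<tau>2, \<xi>2)" "S3 = (n3, \<tau>3, \<xi>3)"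
    by (cases S1, cases S2, cases S3) auto
  define I where "I = ({..<n1} <+> {..<n2}) <+> {..<n3}"
  define a where "a = case_sum (case_sum \<tau>1 \<tau>2) \<tau>3"
  define b where "b = case_sum (case_sum (\<lambda>i. \<tau>1 (Suc i)) (\<lambda>i. \<tau>2 (Suc i))) (\<lambda>i. \<tau>3 (Suc i))"
  define \<xi> where "\<xi> = case_sum (case_sum \<xi>1 (\<lambda>i \<omega>. - \<xi>2 i \<omega>)) (\<lambda>i \<omega>. - \<xi>3 i \<omega>)"
  have neg: "bounded ((\<lambda>\<omega>. - f \<omega>) ` A)" if "bounded (f ` A)" for f :: "'a \<Rightarrow> real" and A
    using that by (simp add: bounded_iff)
  note D = is_simpleD[OF S(1)[unfolded eq]] is_simpleD[OF S(2)[unfolded eq]] is_simpleD[OF S(3)[unfolded eq]]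
  have "(\<integral>\<^sup>+\<omega>. ennreal ((\<Sum>i\<in>I. \<xi> i \<omega> * (Y (b i) \<omega> - Y (a i) \<omega>))\<^sup>2) \<partial>M)
     = mean_square (\<lambda>s \<omega>. \<Sum>i\<in>I. \<xi> i \<omega> * indicator {a i<..b i} s)"
    by (rule ito_isometry) (use D in \<open>auto simp: I_def a_def b_def \<xi>_def intro!: neg borel_measurable_uminus\<close>)
  moreover have "(\<Sum>i\<in>I. \<xi> i \<omega> * (Y (b i) \<omega> - Y (a i) \<omega>))
      = simple_integral Y S1 \<omega> - simple_integral Y S2 \<omega> - simple_integral Y S3 \<omega>" for \<omega>
    by (simp add: I_def a_def b_def \<xi>_def sum.Plus eq simple_integral_def sum_negf)
  moreover have "(\<Sum>i\<in>I. \<xi> i \<omega> * indicator {a i<..b i} s)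
      = simple_process S1 s \<omega> - simple_process S2 s \<omega> - simple_process S3 s \<omega>" for \<omega> s
    by (simp add: I_def a_def b_def \<xi>_def sum.Plus eq simple_process_def sum_negf del: sum_mult_indicator)
  ultimately show ?thesis by simp
qed

lemma simple_process_square_integrable:
  assumes "is_simple M F T S"
  shows "integrable \<nu> (\<lambda>s. (simple_process S s \<omega>)\<^sup>2)"
proof -
  obtain n \<tau> \<xi> where S: "S = (n, \<tau>, \<xi>)" by (cases S)
  show ?thesis
    unfolding S simple_process_def prod.case
    by (rule integrable.intros[OF step_square_integral[OF finite_\<nu> sets_\<nu> is_simple_mono[OF assms[unfolded S]]]])
qed

text \<open>
  On \<open>(\<tau>\<^sub>m, \<tau>\<^sub>m\<^sub>+\<^sub>1]\<close> the coefficient is known at time \<open>\<tau>\<^sub>m\<close>, and so is the exponential of the earlier terms. The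
  defining property of the next increment, with that exponential as weight, removes one factor at a time.
\<close>

lemma simple_exponential:
  assumes "is_simple M F T S"
  shows "(\<integral>\<^sup>+\<omega>. ennreal (exp (simple_integral Y S \<omega> - (\<integral>s. (simple_process S s \<omega>)\<^sup>2 \<partial>\<nu>) / 2)) \<partial>M) = 1"
proof -
  obtain n \<tau> \<xi> where S: "S = (n, \<tau>, \<xi>)" by (cases S)
  note D = is_simpleD[OF assms[unfolded S]] and mono = is_simple_mono[OF assms[unfolded S]]
  define L where "L m \<omega> = (\<Sum>i<m. \<xi> i \<omega> * (Y (\<tau> (Suc i)) \<omega> - Y (\<tau> i) \<omega>) - (\<xi> i \<omega>)\<^sup>2 * measure \<nu> {\<tau> i<..\<tau> (Suc i)} / 2)" for m \<omega>
  have "(\<integral>\<^sup>+\<omega>. ennreal (exp (L m \<omega>)) \<partial>M) = 1" if "m \<le> n" for m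
    using that
  proof (induction m)
    case 0
    then show ?case by (simp add: L_def emeasure_space_1)
  next
    case (Suc m)
    then have m: "m < n" by simp
    have "L m \<in> borel_measurable (F (\<tau> m))"
      unfolding L_def
    proof (rule borel_measurable_sum)
      fix i assume "i \<in> {..<m}"
      then have i: "i < n" "\<tau> (Suc i) \<le> \<tau> m" "\<tau> i \<le> \<tau> m" using m mono[of "Suc i" m] mono[of i m] by auto
      have [measurable]: "\<xi> i \<in> borel_measurable (F (\<tau> m))"
        by (rule measurable_le[of "\<tau> i"]) (use D[OF i(1)] D[OF m] i in auto)
      have [measurable]: "Y (\<tau> (Suc i)) \<in> borel_measurable (F (\<tau> m))" "Y (\<tau> i) \<in> borel_measurable (F (\<tau> m))"
        using D[OF i(1)] D[OF m] i by (auto intro!: Y_measurable_le)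
      show "(\<lambda>\<omega>. \<xi> i \<omega> * (Y (\<tau> (Suc i)) \<omega> - Y (\<tau> i) \<omega>) - (\<xi> i \<omega>)\<^sup>2 * measure \<nu> {\<tau> i<..\<tau> (Suc i)} / 2) \<in> borel_measurable (F (\<tau> m))"
        by measurable
    qed
    then have meas: "(\<lambda>\<omega>. exp (L m \<omega>)) \<in> borel_measurable (F (\<tau> m))" by measurable
    have IH: "(\<integral>\<^sup>+\<omega>. ennreal (exp (L m \<omega>)) \<partial>M) = 1" using Suc by simp
    have "(\<integral>\<^sup>+\<omega>. ennreal (exp (L (Suc m) \<omega>)) \<partial>M)
      = (\<integral>\<^sup>+\<omega>. ennreal (exp (L m \<omega>) * exp (\<xi> m \<omega> * (Y (\<tau> (Suc m)) \<omega> - Y (\<tau> m) \<omega>) - (\<xi> m \<omega>)\<^sup>2 * measure \<nu> {\<tau> m<..\<tau> (Suc m)} / 2)) \<partial>M)"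
      by (simp add: L_def mult_exp_exp)
    also have "\<dots> = 1"
      by (subst gaussian_increment_exp[OF increment[OF D(1,2,3)[OF m]] meas _ _ D(4,5)[OF m]]) (simp_all add: IH)
    finally show ?case .
  qed
  from this[of n] have "(\<integral>\<^sup>+\<omega>. ennreal (exp (L n \<omega>)) \<partial>M) = 1" by simp
  moreover have "L n \<omega> = simple_integral Y S \<omega> - (\<integral>s. (simple_process S s \<omega>)\<^sup>2 \<partial>\<nu>) / 2" for \<omega>
  proof -
    have "(\<integral>s. (simple_process S s \<omega>)\<^sup>2 \<partial>\<nu>) = (\<Sum>i<n. (\<xi> i \<omega>)\<^sup>2 * measure \<nu> {\<tau> i<..\<tau> (Suc i)})"
      unfolding S simple_process_def prod.case
      by (rule has_bochner_integral_integral_eq[OF step_square_integral[OF finite_\<nu> sets_\<nu> mono]])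
    then show ?thesis by (simp add: L_def S simple_integral_def sum_subtractf sum_divide_distrib)
  qed
  ultimately show ?thesis by simp
qed

end

section \<open>Shifting the integrand by an indicator\<close>

lemma sum_even_odd: "(\<Sum>j<2 * m. f j) = (\<Sum>i<m. f (2 * i) + f (Suc (2 * i)))" for f :: "nat \<Rightarrow> real"
  by (induction m) (auto simp: algebra_simps)

context gaussian_martingale
begin

text \<open>
  Extend the partition to all of \<open>[0, T]\<close> with zero coefficients and split each interval
  \<open>[\<rho>\<^sub>j, \<rho>\<^sub>j\<^sub>+\<^sub>1]\<close> at its point \<open>q\<^sub>j\<close> nearest to \<open>t\<close>; the additional \<open>l\<close> goes to the left parts,
  whose union is \<open>(0, t]\<close>. The process and its integral are both sums of increments of a function of
  time, namely of \<open>g r = 1\<^bsub>(0,r]\<^esub>(s)\<close> and of \<open>g = Y\<close>, so one telescoping computation serves for both.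
\<close>

lemma simple_add_indicator:
  assumes S: "is_simple M F T S" and t: "t \<in> {0..T}"
  obtains S' where "is_simple M F T S'"
    "\<And>s \<omega>. simple_process S' s \<omega> = simple_process S s \<omega> + l * indicator {0<..t} s"
    "\<And>\<omega>. simple_integral Y S' \<omega> = simple_integral Y S \<omega> + l * (Y t \<omega> - Y 0 \<omega>)"
proof -
  obtain n \<tau> \<xi> where eq: "S = (n, \<tau>, \<xi>)" by (cases S)
  note D = is_simpleD[OF S[unfolded eq]] and mono = is_simple_mono[OF S[unfolded eq]]
  define m where "m = Suc (Suc n)"
  \<comment> \<open>for \<open>n = 0\<close> the times \<open>\<tau>\<close> are unconstrained and must not be used\<close>
  define \<rho> where "\<rho> j = (if j = 0 then 0 else if j \<le> Suc n \<and> 0 < n then \<tau> (j - 1) else T)" for j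
  define \<eta> where "\<eta> j \<omega> = (if 0 < j \<and> j \<le> n then \<xi> (j - 1) \<omega> else 0)" for j \<omega>
  define q where "q j = max (\<rho> j) (min t (\<rho> (Suc j)))" for j
  define \<tau>' where "\<tau>' k = (if even k then \<rho> (k div 2) else q (k div 2))" for k
  define \<xi>' where "\<xi>' k \<omega> = \<eta> (k div 2) \<omega> + (if even k then l else 0)" for k \<omega>
  have \<tau>_range: "0 \<le> \<tau> i \<and> \<tau> i \<le> T" if "i \<le> n" "0 < n" for i
    using D(1)[of 0] D(3)[of "n - 1"] mono[of 0 i] mono[of i n] that by auto
  have \<rho>_range: "0 \<le> \<rho> j" "\<rho> j \<le> T" for j using \<tau>_range[of "j - 1"] t by (auto simp: \<rho>_def)
  have \<rho>_Suc: "\<rho> j \<le> \<rho> (Suc j)" for j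
    using \<rho>_range(1)[of "Suc j"] \<rho>_range(2)[of j] mono[of "j - 1" j] by (auto simp: \<rho>_def)
  have \<eta>_meas: "\<eta> j \<in> borel_measurable (F (\<rho> j))" for j
  proof (cases "0 < j \<and> j \<le> n")
    case True
    then have "\<eta> j = \<xi> (j - 1)" "\<rho> j = \<tau> (j - 1)" by (auto simp: \<eta>_def \<rho>_def)
    then show ?thesis using D(4)[of "j - 1"] True by (simp add: less_le_trans[OF diff_less])
  next
    case False
    then have "\<eta> j = (\<lambda>_. 0)" by (auto simp: \<eta>_def)
    then show ?thesis by simp
  qed
  have \<eta>_bdd: "bounded (\<eta> j ` space M)" for j
  proof (cases "0 < j \<and> j \<le> n")
    case True
    then have "\<eta> j = \<xi> (j - 1)" by (auto simp: \<eta>_def)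
    then show ?thesis using D(5)[of "j - 1"] True by (simp add: less_le_trans[OF diff_less])
  next
    case False
    then have "\<eta> j = (\<lambda>_. 0)" by (auto simp: \<eta>_def)
    then show ?thesis by (auto simp: bounded_iff)
  qed
  have q: "\<rho> j \<le> q j" "q j \<le> \<rho> (Suc j)" "0 \<le> q j" "q j \<le> T" for j
    using \<rho>_Suc[of j] \<rho>_range[of j] \<rho>_range[of "Suc j"] by (auto simp: q_def)
  have \<xi>'_bdd: "bounded (\<xi>' k ` space M)" for k
  proof -
    obtain B where B: "\<And>\<omega>. \<omega> \<in> space M \<Longrightarrow> \<bar>\<eta> (k div 2) \<omega>\<bar> \<le> B"
      using \<eta>_bdd[of "k div 2"] unfolding bounded_iff by auto
    have "\<bar>\<xi>' k \<omega>\<bar> \<le> B + \<bar>l\<bar>" if "\<omega> \<in> space M" for \<omega>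
      using B[OF that] by (auto simp: \<xi>'_def)
    then show ?thesis unfolding bounded_iff by auto
  qed
  have simple: "is_simple M F T (2 * m, \<tau>', \<xi>')"
    unfolding is_simple_def prod.case
  proof (intro allI impI)
    fix k :: nat
    define j where "j = k div 2"
    have \<eta>q: "\<eta> j \<in> borel_measurable (F (q j))"
      by (rule measurable_le[OF _ _ _ \<eta>_meas]) (use \<rho>_range q in auto)
    show "0 \<le> \<tau>' k \<and> \<tau>' k \<le> \<tau>' (Suc k) \<and> \<tau>' (Suc k) \<le> T \<and> \<xi>' k \<in> borel_measurable (F (\<tau>' k)) \<and> bounded (\<xi>' k ` space M)"
    proof (cases "even k")
      case True
      then have "\<tau>' k = \<rho> j" "\<tau>' (Suc k) = q j" "\<xi>' k = (\<lambda>\<omega>. \<eta> j \<omega> + l)"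
        by (auto simp: \<tau>'_def \<xi>'_def j_def)
      then show ?thesis using \<rho>_range q \<eta>_meas[of j] \<xi>'_bdd[of k] by auto
    next
      case False
      then have "\<tau>' k = q j" "\<tau>' (Suc k) = \<rho> (Suc j)" "\<xi>' k = (\<lambda>\<omega>. \<eta> j \<omega>)"
        by (auto simp: \<tau>'_def \<xi>'_def j_def)
      then show ?thesis using \<rho>_range q \<eta>q \<xi>'_bdd[of k] by auto
    qed
  qed
  have key: "(\<Sum>k<2 * m. \<xi>' k \<omega> * (g (\<tau>' (Suc k)) - g (\<tau>' k)))
      = (\<Sum>i<n. \<xi> i \<omega> * (g (\<tau> (Suc i)) - g (\<tau> i))) + l * (g t - g 0)" for g :: "real \<Rightarrow> real" and \<omega>
  proof -
    have "(\<Sum>k<2 * m. \<xi>' k \<omega> * (g (\<tau>' (Suc k)) - g (\<tau>' k)))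
      = (\<Sum>j<m. (\<eta> j \<omega> + l) * (g (q j) - g (\<rho> j)) + \<eta> j \<omega> * (g (\<rho> (Suc j)) - g (q j)))"
      unfolding sum_even_odd by (intro sum.cong) (auto simp: \<xi>'_def \<tau>'_def)
    also have "\<dots> = (\<Sum>j<m. \<eta> j \<omega> * (g (\<rho> (Suc j)) - g (\<rho> j)) + l * (g (min t (\<rho> (Suc j))) - g (min t (\<rho> j))))"
    proof (intro sum.cong refl)
      fix j :: nat
      have "g (q j) - g (\<rho> j) = g (min t (\<rho> (Suc j))) - g (min t (\<rho> j))"
        using \<rho>_Suc[of j] unfolding q_def by (cases "t \<le> \<rho> j"; cases "t \<le> \<rho> (Suc j)") (auto simp: min_def max_def)
      from arg_cong[OF this, of "(*) l"]
      show "(\<eta> j \<omega> + l) * (g (q j) - g (\<rho> j)) + \<eta> j \<omega> * (g (\<rho> (Suc j)) - g (q j))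
        = \<eta> j \<omega> * (g (\<rho> (Suc j)) - g (\<rho> j)) + l * (g (min t (\<rho> (Suc j))) - g (min t (\<rho> j)))"
        by (simp add: algebra_simps)
    qed
    also have "\<dots> = (\<Sum>j<m. \<eta> j \<omega> * (g (\<rho> (Suc j)) - g (\<rho> j))) + l * (\<Sum>j<m. g (min t (\<rho> (Suc j))) - g (min t (\<rho> j)))"
      by (simp add: sum.distrib sum_distrib_left)
    also have "(\<Sum>j<m. g (min t (\<rho> (Suc j))) - g (min t (\<rho> j))) = g t - g 0"
      using t by (subst sum_lessThan_telescope) (auto simp: m_def \<rho>_def)
    also have "(\<Sum>j<m. \<eta> j \<omega> * (g (\<rho> (Suc j)) - g (\<rho> j))) = (\<Sum>i<n. \<xi> i \<omega> * (g (\<tau> (Suc i)) - g (\<tau> i)))"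
      unfolding m_def by (subst sum.lessThan_Suc_shift) (auto simp: \<eta>_def \<rho>_def intro!: sum.cong)
    finally show ?thesis .
  qed
  have ind: "indicator {a<..b} s = (indicator {0<..b} s - indicator {0<..a} s :: real)" if "0 \<le> a" "a \<le> b" for a b s :: real
    using that by (auto simp: indicator_def)
  have "simple_process (2 * m, \<tau>', \<xi>') s \<omega> = simple_process S s \<omega> + l * indicator {0<..t} s" for s \<omega>
  proof -
    have 1: "\<xi>' k \<omega> * indicator {\<tau>' k<..\<tau>' (Suc k)} s
        = \<xi>' k \<omega> * (indicator {0<..\<tau>' (Suc k)} s - indicator {0<..\<tau>' k} s)" if "k < 2 * m" for k
      by (simp only: ind[OF is_simpleD(1,2)[OF simple that]])
    have 2: "\<xi> i \<omega> * indicator {\<tau> i<..\<tau> (Suc i)} s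
        = \<xi> i \<omega> * (indicator {0<..\<tau> (Suc i)} s - indicator {0<..\<tau> i} s)" if "i < n" for i
      by (simp only: ind[OF D(1,2)[OF that]])
    have "simple_process (2 * m, \<tau>', \<xi>') s \<omega> = (\<Sum>k<2 * m. \<xi>' k \<omega> * (indicator {0<..\<tau>' (Suc k)} s - indicator {0<..\<tau>' k} s))"
      unfolding simple_process_def prod.case by (intro sum.cong 1) auto
    also have "\<dots> = (\<Sum>i<n. \<xi> i \<omega> * (indicator {0<..\<tau> (Suc i)} s - indicator {0<..\<tau> i} s)) + l * (indicator {0<..t} s - indicator {0<..0} s)"
      by (rule key)
    also have "(\<Sum>i<n. \<xi> i \<omega> * (indicator {0<..\<tau> (Suc i)} s - indicator {0<..\<tau> i} s)) = simple_process S s \<omega>"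
      unfolding eq simple_process_def prod.case by (intro sum.cong 2[symmetric]) auto
    finally show ?thesis by simp
  qed
  moreover have "simple_integral Y (2 * m, \<tau>', \<xi>') \<omega> = simple_integral Y S \<omega> + l * (Y t \<omega> - Y 0 \<omega>)" for \<omega>
    using key[of \<omega> "\<lambda>s. Y s \<omega>"] by (simp add: simple_integral_def eq)
  ultimately show ?thesis using that simple by blast
qed

text \<open>
  The approximation part of the definition of the stochastic integral, with the time integral written
  against \<open>\<nu>\<close>.
\<close>

definition ito_approximates ::
    "(nat \<Rightarrow> nat \<times> (nat \<Rightarrow> real) \<times> (nat \<Rightarrow> 'a \<Rightarrow> real)) \<Rightarrow> (real \<Rightarrow> 'a \<Rightarrow> real) \<Rightarrow> ('a \<Rightarrow> real) \<Rightarrow> bool" where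
  "ito_approximates S H Z \<longleftrightarrow> (\<forall>k. is_simple M F T (S k)) \<and>
     (\<lambda>k. mean_square (\<lambda>s \<omega>. simple_process (S k) s \<omega> - H s \<omega>)) \<longlonglongrightarrow> 0 \<and>
     (\<lambda>k. \<integral>\<^sup>+\<omega>. ennreal ((simple_integral Y (S k) \<omega> - Z \<omega>)\<^sup>2) \<partial>M) \<longlonglongrightarrow> 0"

lemma ito_approximatesD:
  assumes "ito_approximates S H Z"
  shows "is_simple M F T (S k)"
    "(\<lambda>k. mean_square (\<lambda>s \<omega>. simple_process (S k) s \<omega> - H s \<omega>)) \<longlonglongrightarrow> 0"
    "(\<lambda>k. \<integral>\<^sup>+\<omega>. ennreal ((simple_integral Y (S k) \<omega> - Z \<omega>)\<^sup>2) \<partial>M) \<longlonglongrightarrow> 0"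
  using assms by (auto simp: ito_approximates_def)

lemma time_integral_measurable:
  assumes "(\<lambda>(\<omega>, s). G s \<omega>) \<in> borel_measurable (M \<Otimes>\<^sub>M borel)"
  shows "(\<lambda>\<omega>. \<integral>\<^sup>+s. ennreal ((G s \<omega>)\<^sup>2) \<partial>\<nu>) \<in> borel_measurable M"
    "(\<lambda>\<omega>. \<integral>s. (G s \<omega>)\<^sup>2 \<partial>\<nu>) \<in> borel_measurable M"
    "\<omega> \<in> space M \<Longrightarrow> (\<lambda>s. G s \<omega>) \<in> borel_measurable \<nu>"
proof -
  have [measurable]: "(\<lambda>(\<omega>, s). G s \<omega>) \<in> borel_measurable (M \<Otimes>\<^sub>M \<nu>)"
    using assms by (simp cong: measurable_cong_sets sets_pair_measure_cong add: sets_\<nu>)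
  show "(\<lambda>\<omega>. \<integral>\<^sup>+s. ennreal ((G s \<omega>)\<^sup>2) \<partial>\<nu>) \<in> borel_measurable M"
    "(\<lambda>\<omega>. \<integral>s. (G s \<omega>)\<^sup>2 \<partial>\<nu>) \<in> borel_measurable M" by measurable
  show "\<omega> \<in> space M \<Longrightarrow> (\<lambda>s. G s \<omega>) \<in> borel_measurable \<nu>" by measurable
qed

lemma ito_integral_unique:
  fixes Z Z' :: "'a \<Rightarrow> real"
  assumes A: "ito_approximates S H Z" "ito_approximates S' H Z'"
    and H: "(\<lambda>(\<omega>, s). H s \<omega>) \<in> borel_measurable (M \<Otimes>\<^sub>M borel)"
    and [measurable]: "Z \<in> borel_measurable M" "Z' \<in> borel_measurable M"
  shows "AE \<omega> in M. Z \<omega> = Z' \<omega>"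
proof -
  note D = ito_approximatesD[OF A(1)] and D' = ito_approximatesD[OF A(2)]
  note S = D(1) D'(1) and approx = D(2) D'(2) and lim = D(3) D'(3)
  have [measurable]: "simple_integral Y (S k) \<in> borel_measurable M" "simple_integral Y (S' k) \<in> borel_measurable M" for k
    using S simple_integral_measurable by auto
  have p: "(\<lambda>(\<omega>, s). simple_process (S k) s \<omega> - H s \<omega>) \<in> borel_measurable (M \<Otimes>\<^sub>M borel)"
    "(\<lambda>(\<omega>, s). H s \<omega> - simple_process (S' k) s \<omega>) \<in> borel_measurable (M \<Otimes>\<^sub>M borel)" for k
    using borel_measurable_diff[OF simple_process_measurable[OF S(1)] H]
      borel_measurable_diff[OF H simple_process_measurable[OF S(2)]] by (auto simp: split_beta')
  have z: "is_simple M F T (0, \<lambda>_. 0, \<lambda>_ _. 0)" by (simp add: is_simple_def)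
  have z0: "simple_integral Y (0, \<lambda>_. 0, \<lambda>_ _. 0) \<omega> = 0" "simple_process (0, \<lambda>_. 0, \<lambda>_ _. 0) s \<omega> = 0" for \<omega> s
    by (simp_all add: simple_integral_def simple_process_def)
  have "(\<lambda>k. mean_square (\<lambda>s \<omega>. H s \<omega> - simple_process (S' k) s \<omega>)) \<longlonglongrightarrow> 0"
    using approx(2) by (simp add: power2_commute[of "H _ _"])
  from mean_square_add_tendsto_0[OF p approx(1) this]
  have "(\<lambda>k. mean_square (\<lambda>s \<omega>. simple_process (S k) s \<omega> - simple_process (S' k) s \<omega>)) \<longlonglongrightarrow> 0"
    by simp
  then have mid: "(\<lambda>k. \<integral>\<^sup>+\<omega>. ennreal ((simple_integral Y (S k) \<omega> - simple_integral Y (S' k) \<omega>)\<^sup>2) \<partial>M) \<longlonglongrightarrow> 0"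
    using simple_integral_isometry[OF S(1) S(2) z] by (simp add: z0)
  have "(\<lambda>k. \<integral>\<^sup>+\<omega>. ennreal (((Z \<omega> - simple_integral Y (S k) \<omega>) + ((simple_integral Y (S k) \<omega> - simple_integral Y (S' k) \<omega>)
      + (simple_integral Y (S' k) \<omega> - Z' \<omega>)))\<^sup>2) \<partial>M) \<longlonglongrightarrow> 0"
    using lim mid by (intro nn_integral_square_add_tendsto_0) (auto simp: power2_commute[of "Z _"])
  then have "(\<integral>\<^sup>+\<omega>. ennreal ((Z \<omega> - Z' \<omega>)\<^sup>2) \<partial>M) = 0"
    by (simp add: LIMSEQ_const_iff)
  then have "AE \<omega> in M. ennreal ((Z \<omega> - Z' \<omega>)\<^sup>2) = 0"
    by (subst (asm) nn_integral_0_iff_AE) auto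
  then show ?thesis by eventually_elim simp
qed

text \<open>
  This is the substitute for Girsanov's theorem. Along a subsequence the exponentials
  \<open>E \<theta>\<close> of the approximating simple processes, shifted by \<open>\<theta>\<close>, converge almost surely for \<open>\<theta> = 0\<close>, \<open>l\<close> and \<open>2l\<close>.
  They all have expectation \<open>1\<close> and satisfy \<open>(E l)\<^sup>2 = exp (l\<^sup>2 \<nu>(0, t]) (E 0) (E (2l))\<close>. At \<open>\<theta> = 0\<close> the limit has
  expectation \<open>1\<close> by hypothesis, and this carries over to \<open>\<theta> = l\<close>.
\<close>

lemma exponential_shift_expectation:
  fixes Z :: "'a \<Rightarrow> real"
  assumes A: "ito_approximates S H Z"
    and H: "(\<lambda>(\<omega>, s). H s \<omega>) \<in> borel_measurable (M \<Otimes>\<^sub>M borel)"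
    and [measurable]: "Z \<in> borel_measurable M"
    and t: "t \<in> {0..T}"
    and fin: "mean_square (\<lambda>s \<omega>. H s \<omega>) < \<infinity>"
    and one: "(\<integral>\<^sup>+\<omega>. ennreal (exp (Z \<omega> - (\<integral>s. (H s \<omega>)\<^sup>2 \<partial>\<nu>) / 2)) \<partial>M) = 1"
  shows "(\<integral>\<^sup>+\<omega>. ennreal (exp (Z \<omega> + l * (Y t \<omega> - Y 0 \<omega>)
    - (\<integral>s. (H s \<omega> + l * indicator {0<..t} s)\<^sup>2 \<partial>\<nu>) / 2)) \<partial>M) = 1"
proof -
  note S = ito_approximatesD(1)[OF A] and approx = ito_approximatesD(2)[OF A] and lim = ito_approximatesD(3)[OF A]
  note Sm = simple_process_measurable[OF S]
  have [measurable]: "simple_integral Y (S k) \<in> borel_measurable M" for k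
    using S simple_integral_measurable by auto
  have [measurable]: "Y t \<in> borel_measurable M" "Y 0 \<in> borel_measurable M"
    using t by (auto intro!: Y_measurable)
  have dm: "(\<lambda>(\<omega>, s). simple_process (S k) s \<omega> - H s \<omega>) \<in> borel_measurable (M \<Otimes>\<^sub>M borel)" for k
    using borel_measurable_diff[OF Sm H] by (simp add: split_beta')
  obtain r1 where r1: "strict_mono (r1 :: nat \<Rightarrow> nat)"
    "AE \<omega> in M. (\<lambda>k. \<integral>\<^sup>+s. ennreal ((simple_process (S (r1 k)) s \<omega> - H s \<omega>)\<^sup>2) \<partial>\<nu>) \<longlonglongrightarrow> 0"
    by (rule AE_subseq_of_nn_integral_tendsto_0[OF _ approx]) (rule time_integral_measurable(1)[OF dm])
  obtain r2 where r2: "strict_mono (r2 :: nat \<Rightarrow> nat)"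
    "AE \<omega> in M. (\<lambda>k. ennreal ((simple_integral Y (S (r1 (r2 k))) \<omega> - Z \<omega>)\<^sup>2)) \<longlonglongrightarrow> 0"
    by (rule AE_subseq_of_nn_integral_tendsto_0[OF _ LIMSEQ_subseq_LIMSEQ[OF lim r1(1), unfolded o_def]]) auto
  define R where "R k = S (r1 (r2 k))" for k
  have R: "is_simple M F T (R k)" for k using S by (simp add: R_def)
  have [measurable]: "simple_integral Y (R k) \<in> borel_measurable M" for k
    by (rule simple_integral_measurable[OF R])
  have AEproc: "AE \<omega> in M. (\<lambda>k. \<integral>\<^sup>+s. ennreal ((simple_process (R k) s \<omega> - H s \<omega>)\<^sup>2) \<partial>\<nu>) \<longlonglongrightarrow> 0"
    using r1(2)
  proof eventually_elim
    case (elim \<omega>)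
    from LIMSEQ_subseq_LIMSEQ[OF this r2(1)] show ?case by (simp add: R_def o_def)
  qed
  have AEint: "AE \<omega> in M. (\<lambda>k. simple_integral Y (R k) \<omega>) \<longlonglongrightarrow> Z \<omega>"
    using r2(2) unfolding R_def by eventually_elim (rule tendsto_of_ennreal_square)
  define D where "D \<omega> = Y t \<omega> - Y 0 \<omega>" for \<omega>
  have [measurable]: "D \<in> borel_measurable M" unfolding D_def by measurable
  have "\<forall>\<theta> k. \<exists>S'. is_simple M F T S' \<and>
    (\<forall>s \<omega>. simple_process S' s \<omega> = simple_process (R k) s \<omega> + \<theta> * indicator {0<..t} s) \<and>
    (\<forall>\<omega>. simple_integral Y S' \<omega> = simple_integral Y (R k) \<omega> + \<theta> * D \<omega>)"
    by (intro allI, rule simple_add_indicator[OF R t]) (auto simp: D_def)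
  then obtain Q where Q: "\<And>\<theta> k. is_simple M F T (Q \<theta> k)"
    "\<And>\<theta> k s \<omega>. simple_process (Q \<theta> k) s \<omega> = simple_process (R k) s \<omega> + \<theta> * indicator {0<..t} s"
    "\<And>\<theta> k \<omega>. simple_integral Y (Q \<theta> k) \<omega> = simple_integral Y (R k) \<omega> + \<theta> * D \<omega>"
    by metis
  define J where "J \<theta> k \<omega> = (\<integral>s. (simple_process (R k) s \<omega> + \<theta> * indicator {0<..t} s)\<^sup>2 \<partial>\<nu>)" for \<theta> k \<omega>
  define J' where "J' \<theta> \<omega> = (\<integral>s. (H s \<omega> + \<theta> * indicator {0<..t} s)\<^sup>2 \<partial>\<nu>)" for \<theta> \<omega>
  define E where "E \<theta> k \<omega> = exp (simple_integral Y (R k) \<omega> + \<theta> * D \<omega> - J \<theta> k \<omega> / 2)" for \<theta> k \<omega>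
  define E' where "E' \<theta> \<omega> = exp (Z \<omega> + \<theta> * D \<omega> - J' \<theta> \<omega> / 2)" for \<theta> \<omega>
  have sqi: "integrable \<nu> (\<lambda>s. (simple_process (R k) s \<omega> + \<theta> * indicator {0<..t} s)\<^sup>2)" for k \<omega> \<theta>
    using simple_process_square_integrable[OF Q(1)[of \<theta> k], of \<omega>] by (simp add: Q(2))
  have E1: "(\<integral>\<^sup>+\<omega>. ennreal (E \<theta> k \<omega>) \<partial>M) = ennreal 1" for \<theta> k
    using simple_exponential[OF Q(1)[of \<theta> k]] by (simp add: E_def J_def Q)
  have Hm: "(\<lambda>(\<omega>, s). H s \<omega> + \<theta> * indicator {0<..t} s) \<in> borel_measurable (M \<Otimes>\<^sub>M borel)" for \<theta>
  proof -
    note [measurable] = H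
    have "(\<lambda>z. (case z of (\<omega>, s) \<Rightarrow> H s \<omega>) + \<theta> * indicator {0<..t} (snd z)) \<in> borel_measurable (M \<Otimes>\<^sub>M borel)"
      by measurable
    then show ?thesis by (simp add: split_beta')
  qed
  have [measurable]: "J' \<theta> \<in> borel_measurable M" for \<theta>
    unfolding J'_def by (rule time_integral_measurable(2)[OF Hm])
  have [measurable]: "J \<theta> k \<in> borel_measurable M" for \<theta> k
    unfolding J_def Q(2)[symmetric] by (rule time_integral_measurable(2)[OF simple_process_measurable[OF Q(1)]])
  have [measurable]: "E \<theta> k \<in> borel_measurable M" "E' \<theta> \<in> borel_measurable M" for \<theta> k
    unfolding E_def E'_def by measurable
  have "AE \<omega> in M. (\<integral>\<^sup>+s. ennreal ((H s \<omega>)\<^sup>2) \<partial>\<nu>) \<noteq> \<infinity>"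
    using fin time_integral_measurable(1)[OF H] by (intro nn_integral_noteq_infinite) auto
  then have AEJ: "AE \<omega> in M. (\<lambda>k. J \<theta> k \<omega>) \<longlonglongrightarrow> J' \<theta> \<omega>" for \<theta>
    using AEproc AE_space
  proof eventually_elim
    case (elim \<omega>)
    have [measurable]: "(\<lambda>s. H s \<omega>) \<in> borel_measurable \<nu>"
      using time_integral_measurable(3)[OF H] elim by auto
    have [measurable]: "(\<lambda>s. simple_process (R k) s \<omega>) \<in> borel_measurable \<nu>" for k
      using time_integral_measurable(3)[OF simple_process_measurable[OF R]] elim by auto
    have "integrable \<nu> (\<lambda>s. (H s \<omega>)\<^sup>2)"
      using elim(1) by (intro integrableI_bounded) (auto simp: less_top)
    moreover have "integrable \<nu> (\<lambda>s. (\<theta> * indicator {0<..t} s :: real)\<^sup>2)"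
      by (rule \<nu>.integrable_const_bound[where B = "\<theta>\<^sup>2"]) (auto simp: indicator_def)
    ultimately have "integrable \<nu> (\<lambda>s. 2 * (H s \<omega>)\<^sup>2 + 2 * (\<theta> * indicator {0<..t} s)\<^sup>2)" by simp
    then have "integrable \<nu> (\<lambda>s. (H s \<omega> + \<theta> * indicator {0<..t} s)\<^sup>2)"
      by (rule Bochner_Integration.integrable_bound) (auto intro!: order_trans[OF square_add_le])
    then show ?case
      unfolding J_def J'_def using elim(2) sqi by (intro integral_square_tendsto) (auto simp: algebra_simps)
  qed
  have AEE: "AE \<omega> in M. (\<lambda>k. E \<theta> k \<omega>) \<longlonglongrightarrow> E' \<theta> \<omega>" for \<theta>
    using AEJ[of \<theta>] AEint by eventually_elim (auto simp: E_def E'_def intro!: tendsto_intros)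
  have dom: "(E l k \<omega>)\<^sup>2 = exp (l\<^sup>2 * measure \<nu> {0<..t}) * E 0 k \<omega> * E (2 * l) k \<omega>" for k \<omega>
  proof -
    have ii: "integrable \<nu> (\<lambda>s. l\<^sup>2 * indicator {0<..t} s :: real)"
      by (rule \<nu>.integrable_const_bound[where B = "l\<^sup>2"]) (auto simp: indicator_def)
    have "J l k \<omega> = (\<integral>s. (simple_process (R k) s \<omega> + 0 * indicator {0<..t} s)\<^sup>2 / 2
        + (simple_process (R k) s \<omega> + (2 * l) * indicator {0<..t} s)\<^sup>2 / 2 - l\<^sup>2 * indicator {0<..t} s \<partial>\<nu>)"
      unfolding J_def by (intro Bochner_Integration.integral_cong) (auto simp: indicator_def power2_eq_square field_simps)
    also have "\<dots> = J 0 k \<omega> / 2 + J (2 * l) k \<omega> / 2 - l\<^sup>2 * measure \<nu> {0<..t}"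
      using sqi[of k \<omega> 0] sqi[of k \<omega> "2 * l"] ii
      by (simp add: J_def sets_\<nu> sets_eq_imp_space_eq[OF sets_\<nu>])
    finally have "J l k \<omega> = J 0 k \<omega> / 2 + J (2 * l) k \<omega> / 2 - l\<^sup>2 * measure \<nu> {0<..t}" .
    then show ?thesis
      by (simp add: E_def power2_eq_square field_simps flip: exp_add)
  qed
  have "(\<integral>\<^sup>+\<omega>. ennreal (E' l \<omega>) \<partial>M) = ennreal 1"
  proof (rule nn_integral_limit_by_domination[where f = "E 0" and F = "E' 0" and g = "E (2 * l)" and G = "E' (2 * l)"
        and h = "E l" and C = "exp (l\<^sup>2 * measure \<nu> {0<..t})" and B = 1])
    show "(\<integral>\<^sup>+\<omega>. ennreal (E' 0 \<omega>) \<partial>M) = ennreal 1" using one by (simp add: E'_def J'_def)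
  qed (use dom E1 AEE in \<open>auto simp: E_def[symmetric] E'_def[symmetric]\<close>, auto simp: E_def E'_def)
  then show ?thesis by (simp add: E'_def J'_def D_def)
qed

end

section \<open>Natural and augmented filtrations\<close>

lemma space_natural_filtration [simp]: "space (natural_filtration M X t) = space M"
  by (simp add: natural_filtration_def space_measure_of_conv)

lemma sets_natural_filtration:
  "sets (natural_filtration M X t) = sigma_sets (space M) (\<Union>s\<in>{0..t}. {X s -` A \<inter> space M | A. A \<in> sets borel})"
  unfolding natural_filtration_def by (rule sets_measure_of) auto

lemma subalgebra_natural_filtration:
  assumes "space G = space M" "\<And>s. s \<in> {0..t} \<Longrightarrow> X s \<in> borel_measurable G"
  shows "subalgebra G (natural_filtration M X t)"
  unfolding subalgebra_def sets_natural_filtration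
proof (intro conjI)
  have "(\<Union>s\<in>{0..t}. {X s -` A \<inter> space M | A. A \<in> sets borel}) \<subseteq> sets G"
    using measurable_sets[OF assms(2)] by (auto simp: assms(1))
  then show "sigma_sets (space M) (\<Union>s\<in>{0..t}. {X s -` A \<inter> space M | A. A \<in> sets borel}) \<subseteq> sets G"
    unfolding assms(1)[symmetric] by (rule sets.sigma_sets_subset)
qed (simp add: assms)

lemma natural_filtration_mono: "s \<le> t \<Longrightarrow> sets (natural_filtration M X s) \<subseteq> sets (natural_filtration M X t)"
  unfolding sets_natural_filtration by (intro sigma_sets_mono' UN_mono) auto

lemma natural_filtration_adapted:
  assumes "s \<in> {0..t}"
  shows "X s \<in> borel_measurable (natural_filtration M X t)"
proof (rule measurableI)
  fix A :: "real set" assume "A \<in> sets borel"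
  then have "X s -` A \<inter> space M \<in> (\<Union>s\<in>{0..t}. {X s -` A \<inter> space M | A. A \<in> sets borel})"
    by (intro UN_I[OF assms]) auto
  then show "X s -` A \<inter> space (natural_filtration M X t) \<in> sets (natural_filtration M X t)"
    unfolding sets_natural_filtration space_natural_filtration by (rule sigma_sets.Basic)
qed simp

text \<open>
  A limit of variables that are measurable for the past of \<open>W\<close> is measurable for that past only up to null sets. As
  null sets do not affect independence, the \<sigma>-algebras may be enlarged by them.
\<close>

definition augmented :: "'a measure \<Rightarrow> 'a measure \<Rightarrow> 'a measure" where
  "augmented M F = sigma (space M) {B \<in> sets M. \<exists>B'\<in>sets F. AE \<omega> in M. \<omega> \<in> B \<longleftrightarrow> \<omega> \<in> B'}"

lemma space_augmented [simp]: "space (augmented M F) = space M"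
  by (simp add: augmented_def space_measure_of_conv)

lemma sets_augmented:
  assumes "subalgebra M F"
  shows "sets (augmented M F) = {B \<in> sets M. \<exists>B'\<in>sets F. AE \<omega> in M. \<omega> \<in> B \<longleftrightarrow> \<omega> \<in> B'}" (is "_ = ?C")
proof -
  have sF: "space F = space M" "sets F \<subseteq> sets M" using assms by (auto simp: subalgebra_def)
  have "sigma_algebra (space M) ?C"
    unfolding sigma_algebra_iff2
  proof (intro conjI ballI allI impI)
    show "?C \<subseteq> Pow (space M)" using sets.sets_into_space by auto
    show "{} \<in> ?C" by (auto intro!: bexI[of _ "{}"])
    fix B assume "B \<in> ?C"
    then obtain B' where B: "B \<in> sets M" "B' \<in> sets F" "AE \<omega> in M. \<omega> \<in> B \<longleftrightarrow> \<omega> \<in> B'" by auto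
    have "AE \<omega> in M. \<omega> \<in> space M - B \<longleftrightarrow> \<omega> \<in> space F - B'"
      using B(3) by eventually_elim (auto simp: sF)
    then show "space M - B \<in> ?C" using B by blast
  next
    fix A :: "nat \<Rightarrow> 'a set" assume "range A \<subseteq> ?C"
    then have "\<forall>i. \<exists>B'. A i \<in> sets M \<and> B' \<in> sets F \<and> (AE \<omega> in M. \<omega> \<in> A i \<longleftrightarrow> \<omega> \<in> B')" by blast
    then obtain A' where A: "\<And>i. A i \<in> sets M" "\<And>i. A' i \<in> sets F" "\<And>i. AE \<omega> in M. \<omega> \<in> A i \<longleftrightarrow> \<omega> \<in> A' i"
      by metis
    have "AE \<omega> in M. \<forall>i. \<omega> \<in> A i \<longleftrightarrow> \<omega> \<in> A' i" using A(3) by (simp add: AE_all_countable)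
    then have "AE \<omega> in M. \<omega> \<in> (\<Union>i. A i) \<longleftrightarrow> \<omega> \<in> (\<Union>i. A' i)" by eventually_elim auto
    moreover have "(\<Union>i. A' i) \<in> sets F" "(\<Union>i. A i) \<in> sets M" using A by auto
    ultimately show "(\<Union>i. A i) \<in> ?C" by blast
  qed
  then show ?thesis
    unfolding augmented_def by (rule sigma_algebra.sets_measure_of_eq)
qed

lemma subalgebra_augmented: "subalgebra M F \<Longrightarrow> subalgebra M (augmented M F)"
  by (auto simp: subalgebra_def sets_augmented)

lemma measurable_augmented:
  assumes F: "subalgebra M F" and f: "f \<in> borel_measurable F"
  shows "f \<in> borel_measurable (augmented M F)"
proof (rule measurable_from_subalg[OF _ f])
  show "subalgebra (augmented M F) F"
    using F by (auto simp: subalgebra_def sets_augmented)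
qed

lemma measurable_augmented_AE:
  fixes f g :: "'a \<Rightarrow> real"
  assumes F: "subalgebra M F" and f: "f \<in> borel_measurable (augmented M F)" and g: "g \<in> borel_measurable M"
    and ae: "AE \<omega> in M. g \<omega> = f \<omega>"
  shows "g \<in> borel_measurable (augmented M F)"
proof (rule measurableI)
  fix A :: "real set" assume A: "A \<in> sets borel"
  have "f -` A \<inter> space M \<in> sets (augmented M F)"
    using measurable_sets[OF f A] by simp
  then obtain B' where B: "B' \<in> sets F" "AE \<omega> in M. \<omega> \<in> f -` A \<inter> space M \<longleftrightarrow> \<omega> \<in> B'"
    by (auto simp: sets_augmented[OF F])
  have "AE \<omega> in M. \<omega> \<in> g -` A \<inter> space M \<longleftrightarrow> \<omega> \<in> B'"
    using B(2) ae by eventually_elim auto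
  then show "g -` A \<inter> space (augmented M F) \<in> sets (augmented M F)"
    using B(1) measurable_sets[OF g A] by (auto simp: sets_augmented[OF F])
qed simp

lemma (in prob_space) indep_set_augmented:
  assumes F: "subalgebra M F" and ind: "indep_set (sets F) E"
  shows "indep_set (sets (augmented M F)) E"
  unfolding indep_sets2_eq
proof (intro conjI ballI)
  have E: "E \<subseteq> events" using ind by (simp add: indep_sets2_eq)
  then show "E \<subseteq> events" .
  show "sets (augmented M F) \<subseteq> events" by (auto simp: sets_augmented[OF F])
  fix B C assume "B \<in> sets (augmented M F)" and C: "C \<in> E"
  then obtain B' where B: "B \<in> events" "B' \<in> sets F" "AE \<omega> in M. \<omega> \<in> B \<longleftrightarrow> \<omega> \<in> B'"
    by (auto simp: sets_augmented[OF F])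
  have B': "B' \<in> events" using B F by (auto simp: subalgebra_def)
  have "prob (B \<inter> C) = prob (B' \<inter> C)"
    using B B' C E by (intro finite_measure_eq_AE) auto
  also have "\<dots> = prob B' * prob C" using ind B C by (intro indep_setD) auto
  also have "prob B' = prob B" using B B' by (intro finite_measure_eq_AE) auto
  finally show "prob (B \<inter> C) = prob B * prob C" .
qed

section \<open>Weighted time and Brownian motion\<close>

definition weight_measure :: "real \<Rightarrow> (real \<Rightarrow> real) \<Rightarrow> real measure" where
  "weight_measure T a = density lborel (\<lambda>s. ennreal (indicator {0..T} s * a s))"

lemma sets_weight_measure [measurable_cong]: "sets (weight_measure T a) = sets borel"
  by (simp add: weight_measure_def)

lemma nn_integral_weight_measure:
  fixes a x x' :: "real \<Rightarrow> real"
  assumes [measurable]: "(\<lambda>s. indicator {0..T} s * a s) \<in> borel_measurable borel" "x' \<in> borel_measurable borel"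
    and nn: "\<And>s. 0 \<le> a s" "\<And>s. 0 \<le> x' s" and eq: "\<And>s. s \<in> {0..T} \<Longrightarrow> x s = x' s"
  shows "(\<integral>\<^sup>+s\<in>{0..T}. ennreal (x s * a s) \<partial>lborel) = (\<integral>\<^sup>+s. ennreal (x' s) \<partial>weight_measure T a)"
proof -
  have "(\<integral>\<^sup>+s. ennreal (x' s) \<partial>weight_measure T a)
      = (\<integral>\<^sup>+s. ennreal (indicator {0..T} s * a s) * ennreal (x' s) \<partial>lborel)"
    unfolding weight_measure_def by (rule nn_integral_density) measurable
  also have "\<dots> = (\<integral>\<^sup>+s\<in>{0..T}. ennreal (x s * a s) \<partial>lborel)"
    using nn eq by (intro nn_integral_cong) (auto simp: indicator_def ennreal_mult mult.commute)
  finally show ?thesis by simp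
qed

text \<open>
  Clamping the time to \<open>[0, T]\<close> turns a process that is measurable only there into a function that is
  measurable for all times.
\<close>

lemma measurable_process_clamp:
  assumes "measurable_process M T H" "0 \<le> T"
  shows "(\<lambda>(\<omega>, s). H (max 0 (min T s)) \<omega>) \<in> borel_measurable (M \<Otimes>\<^sub>M borel)"
proof -
  have [measurable]: "(\<lambda>s. max 0 (min T s)) \<in> measurable borel (restrict_space borel {0..T})"
    by (rule measurable_restrict_space2) (use assms(2) in auto)
  have [measurable]: "(\<lambda>(\<omega>, t). H t \<omega>) \<in> borel_measurable (M \<Otimes>\<^sub>M restrict_space borel {0..T})"
    using assms(1) by (simp add: measurable_process_def)
  have "(\<lambda>z. (case (fst z, max 0 (min T (snd z))) of (\<omega>, t) \<Rightarrow> H t \<omega>)) \<in> borel_measurable (M \<Otimes>\<^sub>M borel)"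
    by measurable
  then show ?thesis by (simp add: split_beta')
qed

lemma (in gaussian_martingale) has_ito_integral_weight_iff:
  fixes a :: "real \<Rightarrow> real"
  assumes \<nu>: "\<nu> = weight_measure T a" and T: "0 \<le> T"
    and a: "(\<lambda>s. indicator {0..T} s * a s) \<in> borel_measurable borel" "\<And>s. 0 \<le> a s"
    and H': "(\<lambda>(\<omega>, s). H' s \<omega>) \<in> borel_measurable (M \<Otimes>\<^sub>M borel)" "\<And>s \<omega>. s \<in> {0..T} \<Longrightarrow> \<omega> \<in> space M \<Longrightarrow> H s \<omega> = H' s \<omega>"
    and H: "measurable_process M T H"
  shows "has_ito_integral M F T Y a H Z \<longleftrightarrow> Z \<in> borel_measurable M \<and> (\<exists>S. ito_approximates S H' Z)"
proof -
  have eq: "(\<integral>\<^sup>+\<omega>. (\<integral>\<^sup>+s\<in>{0..T}. ennreal ((simple_process S s \<omega> - H s \<omega>)\<^sup>2 * a s) \<partial>lborel) \<partial>M)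
     = mean_square (\<lambda>s \<omega>. simple_process S s \<omega> - H' s \<omega>)" if "is_simple M F T S" for S
  proof (intro nn_integral_cong)
    fix \<omega> assume \<omega>: "\<omega> \<in> space M"
    have "(\<lambda>s. (simple_process S s \<omega> - H' s \<omega>)\<^sup>2) \<in> borel_measurable borel"
      using measurable_compose_Pair1[OF \<omega> simple_process_measurable[OF that]]
        measurable_compose_Pair1[OF \<omega> H'(1)] by simp
    then show "(\<integral>\<^sup>+s\<in>{0..T}. ennreal ((simple_process S s \<omega> - H s \<omega>)\<^sup>2 * a s) \<partial>lborel)
     = (\<integral>\<^sup>+s. ennreal ((simple_process S s \<omega> - H' s \<omega>)\<^sup>2) \<partial>\<nu>)"
      unfolding \<nu> by (intro nn_integral_weight_measure a) (use H'(2) \<omega> in auto)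
  qed
  show ?thesis
    unfolding has_ito_integral_def ito_approximates_def by (simp add: H eq cong: conj_cong)
qed

lemma (in prob_space) brownian_gaussian_martingale:
  assumes T: "0 < T" and W: "brownian_motion M T W"
  shows "gaussian_martingale M (\<lambda>t. augmented M (natural_filtration M W t)) T W (weight_measure T (\<lambda>_. 1))"
proof (rule gaussian_martingale.intro[OF prob_space_axioms gaussian_martingale_axioms.intro])
  have Wm: "W t \<in> borel_measurable M" if "t \<in> {0..T}" for t using W that by (auto simp: brownian_motion_def)
  have sub: "subalgebra M (natural_filtration M W t)" if "t \<in> {0..T}" for t
    by (rule subalgebra_natural_filtration) (use Wm that in auto)
  have meas: "(\<lambda>s. indicator {0..T} s * 1 :: real) \<in> borel_measurable borel" by simp
  show "subalgebra M (augmented M (natural_filtration M W t))" if "t \<in> {0..T}" for t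
    using sub that by (intro subalgebra_augmented)
  show "sets (augmented M (natural_filtration M W s)) \<subseteq> sets (augmented M (natural_filtration M W t))"
    if "0 \<le> s" "s \<le> t" "t \<le> T" for s t
    using that natural_filtration_mono[of s t M W] by (auto simp: sets_augmented sub)
  show "W t \<in> borel_measurable (augmented M (natural_filtration M W t))" if "t \<in> {0..T}" for t
    using that by (intro measurable_augmented sub natural_filtration_adapted) auto
  show "sets (weight_measure T (\<lambda>_. 1)) = sets borel" by (rule sets_weight_measure)
  have em: "emeasure (weight_measure T (\<lambda>_. 1)) A = emeasure lborel ({0..T} \<inter> A)" if "A \<in> sets borel" for A
    using that unfolding weight_measure_def
    by (subst emeasure_density) (auto simp: nn_integral_indicator[symmetric] indicator_inter_arith
        intro!: nn_integral_cong split: split_indicator)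
  show "finite_measure (weight_measure T (\<lambda>_. 1))"
    using T by (intro finite_measureI) (simp add: em space_measure_of_conv sets_eq_imp_space_eq[OF sets_weight_measure])
  fix s t assume st: "0 \<le> s" "s < t" "t \<le> T"
  have "{0..T} \<inter> {s<..t} = {s<..t}" using st by auto
  then have v: "measure (weight_measure T (\<lambda>_. 1)) {s<..t} = t - s"
    using st by (simp add: measure_def em)
  show "gaussian_increment M (augmented M (natural_filtration M W s)) (\<lambda>\<omega>. W t \<omega> - W s \<omega>) (measure (weight_measure T (\<lambda>_. 1)) {s<..t})"
    unfolding v
    using W st by (intro gaussian_increment_of_independent subalgebra_augmented sub indep_set_augmented)
      (auto simp: brownian_motion_def)
qed

section \<open>Wiener integrals\<close>

text \<open>
  The coefficients are frozen at the sample point \<open>w\<close> and the partition is clamped to \<open>[s, t]\<close>; as a process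
  this is the deterministic step function \<open>S(w)\<close>, cut off outside of \<open>(s, t]\<close>.
\<close>

definition clip_at :: "real \<Rightarrow> real \<Rightarrow> 'a \<Rightarrow> nat \<times> (nat \<Rightarrow> real) \<times> (nat \<Rightarrow> 'a \<Rightarrow> real)
    \<Rightarrow> nat \<times> (nat \<Rightarrow> real) \<times> (nat \<Rightarrow> 'a \<Rightarrow> real)" where
  "clip_at s t w = (\<lambda>(n, \<tau>, \<xi>). (n, \<lambda>i. max s (min t (\<tau> i)), \<lambda>i _. \<xi> i w))"

lemma clip_process:
  assumes "is_simple M F T S" "s \<le> t"
  shows "simple_process (clip_at s t w S) u \<omega> = indicator {s<..t} u * simple_process S u w"
proof -
  obtain n \<tau> \<xi> where S: "S = (n, \<tau>, \<xi>)" by (cases S)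
  have "indicator {max s (min t (\<tau> i))<..max s (min t (\<tau> (Suc i)))} u
      = (indicator {s<..t} u * indicator {\<tau> i<..\<tau> (Suc i)} u :: real)" if "i < n" for i
    using is_simpleD(2)[OF assms(1)[unfolded S] that] assms(2) by (auto simp: indicator_def)
  then show ?thesis
    unfolding S clip_at_def simple_process_def prod.case sum_distrib_left
    by (intro sum.cong) auto
qed

context gaussian_martingale
begin

lemma clip_simple:
  assumes S: "is_simple M F T S" and st: "0 \<le> s" "s \<le> t" "t \<le> T"
  shows "is_simple M F T (clip_at s t w S)"
proof -
  obtain n \<tau> \<xi> where eq: "S = (n, \<tau>, \<xi>)" by (cases S)
  show ?thesis
    unfolding eq clip_at_def is_simple_def prod.case
  proof (intro allI impI)
    fix i assume "i < n"
    then have "\<tau> i \<le> \<tau> (Suc i)" by (rule is_simpleD(2)[OF S[unfolded eq]])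
    then show "0 \<le> max s (min t (\<tau> i)) \<and> max s (min t (\<tau> i)) \<le> max s (min t (\<tau> (Suc i))) \<and>
        max s (min t (\<tau> (Suc i))) \<le> T \<and> (\<lambda>_. \<xi> i w) \<in> borel_measurable (F (max s (min t (\<tau> i)))) \<and>
        bounded ((\<lambda>_. \<xi> i w) ` space M)"
      using st by (auto simp: bounded_iff)
  qed
qed

lemma clip_measurable:
  assumes S: "is_simple M F T S" and st: "0 \<le> s" "s \<le> t" "t \<le> T"
  shows "simple_integral Y (clip_at s t w S) \<in> borel_measurable (F t)"
proof -
  obtain n \<tau> \<xi> where eq: "S = (n, \<tau>, \<xi>)" by (cases S)
  show ?thesis
    unfolding eq clip_at_def simple_integral_def prod.case using st
    by (intro borel_measurable_sum borel_measurable_times borel_measurable_diff Y_measurable_le) auto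
qed

lemma deterministic_integral_gaussian:
  assumes S: "is_simple M F T (n, \<tau>, \<lambda>i _. c i)" and s: "0 \<le> s" "s \<le> T" and ge: "\<And>i. s \<le> \<tau> i"
  shows "gaussian_increment M (F s) (simple_integral Y (n, \<tau>, \<lambda>i _. c i))
    (\<Sum>i<n. (c i)\<^sup>2 * measure \<nu> {\<tau> i<..\<tau> (Suc i)})"
proof -
  note D = is_simpleD[OF S] and mono = is_simple_mono[OF S]
  have "gaussian_increment M (F s) (\<lambda>\<omega>. \<Sum>i<m. c i * (Y (\<tau> (Suc i)) \<omega> - Y (\<tau> i) \<omega>))
    (\<Sum>i<m. (c i)\<^sup>2 * measure \<nu> {\<tau> i<..\<tau> (Suc i)})" if "m \<le> n" for m
    using that
  proof (induction m)
    case 0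
    then show ?case using gaussian_increment_zero[OF subalg[of s]] s by simp
  next
    case (Suc m)
    then have m: "m < n" by simp
    have "(\<lambda>\<omega>. \<Sum>i<m. c i * (Y (\<tau> (Suc i)) \<omega> - Y (\<tau> i) \<omega>)) \<in> borel_measurable (F (\<tau> m))"
    proof (intro borel_measurable_sum borel_measurable_times borel_measurable_diff borel_measurable_const)
      fix i assume "i \<in> {..<m}"
      then have i: "i < n" "\<tau> (Suc i) \<le> \<tau> m" "\<tau> i \<le> \<tau> m" using m mono[of "Suc i" m] mono[of i m] by auto
      show "Y (\<tau> (Suc i)) \<in> borel_measurable (F (\<tau> m))" "Y (\<tau> i) \<in> borel_measurable (F (\<tau> m))"
        using D[OF i(1)] D[OF m] i by (auto intro!: Y_measurable_le)
    qed
    moreover have "subalgebra (F (\<tau> m)) (F s)"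
      using D[OF m] ge[of m] s by (intro subalg_le) auto
    ultimately have "gaussian_increment M (F s)
      (\<lambda>\<omega>. (\<Sum>i<m. c i * (Y (\<tau> (Suc i)) \<omega> - Y (\<tau> i) \<omega>)) + c m * (Y (\<tau> (Suc m)) \<omega> - Y (\<tau> m) \<omega>))
      ((\<Sum>i<m. (c i)\<^sup>2 * measure \<nu> {\<tau> i<..\<tau> (Suc i)}) + (c m)\<^sup>2 * measure \<nu> {\<tau> m<..\<tau> (Suc m)})"
      using Suc m D[OF m] by (intro gaussian_increment_add[where G' = "F (\<tau> m)"] gaussian_increment_cmult increment) auto
    then show ?case by simp
  qed
  from this[of n] show ?thesis by (simp add: simple_integral_def)
qed

lemma clip_gaussian:
  assumes S: "is_simple M F T S" and st: "0 \<le> s" "s \<le> t" "t \<le> T"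
  shows "gaussian_increment M (F s) (simple_integral Y (clip_at s t w S))
    (\<integral>u. (simple_process (clip_at s t w S) u w)\<^sup>2 \<partial>\<nu>)"
proof -
  obtain n \<tau> \<xi> where eq: "S = (n, \<tau>, \<xi>)" by (cases S)
  define \<rho> where "\<rho> i = max s (min t (\<tau> i))" for i
  define c where "c i = \<xi> i w" for i
  have C: "clip_at s t w S = (n, \<rho>, \<lambda>i _. c i)" by (auto simp: eq clip_at_def \<rho>_def c_def)
  note simple = clip_simple[OF assms, of w, unfolded C]
  have "(\<integral>u. (simple_process (n, \<rho>, \<lambda>i _. c i) u w)\<^sup>2 \<partial>\<nu>) = (\<Sum>i<n. (c i)\<^sup>2 * measure \<nu> {\<rho> i<..\<rho> (Suc i)})"
    unfolding simple_process_def prod.case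
    by (rule has_bochner_integral_integral_eq[OF step_square_integral[OF finite_\<nu> sets_\<nu> is_simple_mono[OF simple]]])
  then show ?thesis
    unfolding C using deterministic_integral_gaussian[OF simple, of s] st by (simp add: \<rho>_def)
qed

lemma exists_le_integral:
  assumes [measurable]: "f \<in> borel_measurable M" and e: "0 < (e :: real)"
  shows "\<exists>w\<in>space M. f w \<le> (\<integral>\<^sup>+\<omega>. f \<omega> \<partial>M) + ennreal e"
proof (rule ccontr)
  assume "\<not> ?thesis"
  then have less: "(\<integral>\<^sup>+\<omega>. f \<omega> \<partial>M) + ennreal e < f w" if "w \<in> space M" for w using that by (auto simp: not_le)
  obtain w where "w \<in> space M" using not_empty by auto
  with less have "(\<integral>\<^sup>+\<omega>. f \<omega> \<partial>M) + ennreal e < top" by (metis top.not_eq_extremum not_less_iff_gr_or_eq top.extremum_strict order.strict_trans)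
  then obtain c where c: "(\<integral>\<^sup>+\<omega>. f \<omega> \<partial>M) = ennreal c" "0 \<le> c"
    by (cases "\<integral>\<^sup>+\<omega>. f \<omega> \<partial>M") auto
  have "(\<integral>\<^sup>+\<omega>. ennreal (c + e) \<partial>M) \<le> (\<integral>\<^sup>+\<omega>. f \<omega> \<partial>M)"
    using less c e by (intro nn_integral_mono) (auto simp: less_imp_le)
  then show False using c e by (simp add: emeasure_space_1 del: ennreal_plus)
qed

text \<open>
  The processes \<open>S t k\<close> approximate the deterministic integrand \<open>1\<^bsub>[0,t]\<^esub> h\<close> in the mean over \<open>\<omega>\<close>, so for a suitable
  sample point \<open>w t k\<close> the step function \<open>S t k (w t k)\<close> approximates it too (\<open>exists_le_integral\<close>). By the isometry,
  \<open>X t - X s\<close> is the limit of the integrals of these step functions over \<open>(s, t]\<close>. These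
  are Gaussian relative to \<open>F s\<close> and measurable for \<open>F t\<close>, and both properties pass to the limit.
\<close>

lemma wiener_transform:
  fixes h :: "real \<Rightarrow> real" and X :: "real \<Rightarrow> 'a \<Rightarrow> real"
  assumes T: "0 \<le> T" and [measurable]: "h \<in> borel_measurable borel" and h2: "integrable \<nu> (\<lambda>u. (h u)\<^sup>2)" and \<nu>0: "emeasure \<nu> {0} = 0"
    and complete: "\<And>t f g. t \<in> {0..T} \<Longrightarrow> f \<in> borel_measurable (F t) \<Longrightarrow> g \<in> borel_measurable M \<Longrightarrow>
        (AE \<omega> in M. g \<omega> = f \<omega>) \<Longrightarrow> (g :: 'a \<Rightarrow> real) \<in> borel_measurable (F t)"
    and Xm: "\<And>t. t \<in> {0..T} \<Longrightarrow> X t \<in> borel_measurable M"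
    and A: "\<And>t. t \<in> {0..T} \<Longrightarrow> ito_approximates (S t) (\<lambda>u _. indicator {0..t} u * h u) (X t)"
  shows "AE \<omega> in M. X 0 \<omega> = 0"
    and "\<And>t. t \<in> {0..T} \<Longrightarrow> X t \<in> borel_measurable (F t)"
    and "\<And>s t. 0 \<le> s \<Longrightarrow> s \<le> t \<Longrightarrow> t \<le> T \<Longrightarrow>
      gaussian_increment M (F s) (\<lambda>\<omega>. X t \<omega> - X s \<omega>) (\<integral>u. (indicator {s<..t} u * h u)\<^sup>2 \<partial>\<nu>)"
proof -
  note S = ito_approximatesD(1)[OF A] and approx = ito_approximatesD(2)[OF A] and lim = ito_approximatesD(3)[OF A]
  have z: "is_simple M F T (0, \<lambda>_. 0, \<lambda>_ _. 0)" by (simp add: is_simple_def)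
  show X0: "AE \<omega> in M. X 0 \<omega> = 0"
  proof (rule ito_integral_unique)
    show "ito_approximates (S 0) (\<lambda>u _. indicator {0..0} u * h u) (X 0)" using A[of 0] T by simp
    have "AE u in \<nu>. u \<noteq> 0" using \<nu>0 by (intro AE_I[of _ _ "{0}"]) (auto simp: sets_\<nu>)
    then have "(\<integral>\<^sup>+u. ennreal ((indicator {0..0} u * h u)\<^sup>2) \<partial>\<nu>) = (\<integral>\<^sup>+u. 0 \<partial>\<nu>)"
      by (intro nn_integral_cong_AE, eventually_elim) (auto simp: indicator_def)
    then show "ito_approximates (\<lambda>_. (0, \<lambda>_. 0, \<lambda>_ _. 0)) (\<lambda>u _. indicator {0..0} u * h u) (\<lambda>_. 0)"
      using z by (simp add: ito_approximates_def simple_process_def simple_integral_def)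
    show "X 0 \<in> borel_measurable M" using T Xm by simp
    show "(\<lambda>(\<omega>, u). indicator {0..0} u * h u) \<in> borel_measurable (M \<Otimes>\<^sub>M borel)" by measurable
  qed simp
  define near where "near t k w \<longleftrightarrow> (\<integral>\<^sup>+u. ennreal ((simple_process (S t k) u w - indicator {0..t} u * h u)\<^sup>2) \<partial>\<nu>)
     \<le> mean_square (\<lambda>u \<omega>. simple_process (S t k) u \<omega> - indicator {0..t} u * h u) + ennreal (inverse (real (Suc k)))"
    for t k w
  have near: "\<exists>w\<in>space M. near t k w" if "t \<in> {0..T}" for t k
    unfolding near_def
  proof (intro exists_le_integral time_integral_measurable(1))
    have [measurable]: "(\<lambda>(\<omega>, u). simple_process (S t k) u \<omega>) \<in> borel_measurable (M \<Otimes>\<^sub>M borel)"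
      by (rule simple_process_measurable[OF S[OF that]])
    have "(\<lambda>z. (case z of (\<omega>, u) \<Rightarrow> simple_process (S t k) u \<omega>) - indicator {0..t} (snd z) * h (snd z)) \<in> borel_measurable (M \<Otimes>\<^sub>M borel)"
      by measurable
    then show "(\<lambda>(\<omega>, u). simple_process (S t k) u \<omega> - indicator {0..t} u * h u) \<in> borel_measurable (M \<Otimes>\<^sub>M borel)"
      by (simp add: split_beta')
  qed simp
  define w where "w t k = (SOME x. x \<in> space M \<and> near t k x)" for t k
  have w: "w t k \<in> space M" "near t k (w t k)" if "t \<in> {0..T}" for t k
    using someI_ex[of "\<lambda>x. x \<in> space M \<and> near t k x"] near[OF that, of k] unfolding w_def by blast+
  have det: "(\<lambda>k. \<integral>\<^sup>+u. ennreal ((simple_process (S t k) u (w t k) - indicator {0..t} u * h u)\<^sup>2) \<partial>\<nu>) \<longlonglongrightarrow> 0"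
    if t: "t \<in> {0..T}" for t
  proof (rule tendsto_sandwich[OF _ _ tendsto_const])
    have "(\<lambda>k. ennreal (inverse (real (Suc k)))) \<longlonglongrightarrow> ennreal 0"
      by (intro tendsto_ennrealI LIMSEQ_inverse_real_of_nat)
    from tendsto_add[OF approx[OF t] this]
    show "(\<lambda>k. mean_square (\<lambda>u \<omega>. simple_process (S t k) u \<omega> - indicator {0..t} u * h u) + ennreal (inverse (real (Suc k)))) \<longlonglongrightarrow> 0"
      by simp
  qed (use w(2)[OF t] in \<open>auto simp: near_def\<close>)
  define D where "D s t k = clip_at s t (w t k) (S t k)" for s t k
  have conv_det: "(\<lambda>k. \<integral>\<^sup>+u. ennreal ((simple_process (D s t k) u (w t k) - indicator {s<..t} u * h u)\<^sup>2) \<partial>\<nu>) \<longlonglongrightarrow> 0"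
    if st: "0 \<le> s" "s \<le> t" "t \<le> T" for s t
  proof (rule tendsto_sandwich[OF _ _ tendsto_const det[of t]])
    show "\<forall>\<^sub>F k in sequentially. (\<integral>\<^sup>+u. ennreal ((simple_process (D s t k) u (w t k) - indicator {s<..t} u * h u)\<^sup>2) \<partial>\<nu>)
      \<le> (\<integral>\<^sup>+u. ennreal ((simple_process (S t k) u (w t k) - indicator {0..t} u * h u)\<^sup>2) \<partial>\<nu>)"
      using st by (intro always_eventually allI nn_integral_mono)
        (auto simp: D_def clip_process[OF S] indicator_def)
  qed (use st in auto)
  have conv: "(\<lambda>k. \<integral>\<^sup>+\<omega>. ennreal ((simple_integral Y (D s t k) \<omega> - (X t \<omega> - X s \<omega>))\<^sup>2) \<partial>M) \<longlonglongrightarrow> 0"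
    if st: "0 \<le> s" "s \<le> t" "t \<le> T" for s t
  proof -
    have t: "t \<in> {0..T}" and s: "s \<in> {0..T}" using st by auto
    have Ds: "is_simple M F T (D s t k)" for k unfolding D_def by (rule clip_simple[OF S[OF t] st])
    note [measurable] = Xm[OF t] Xm[OF s]
    have [measurable]: "simple_integral Y (D s t k) \<in> borel_measurable M" "simple_integral Y (S t k) \<in> borel_measurable M"
      "simple_integral Y (S s k) \<in> borel_measurable M" for k
      using Ds S[OF t] S[OF s] simple_integral_measurable by auto
    have pm [measurable]: "(\<lambda>(\<omega>, u). simple_process (D s t k) u \<omega>) \<in> borel_measurable (M \<Otimes>\<^sub>M borel)"
      "(\<lambda>(\<omega>, u). simple_process (S t k) u \<omega>) \<in> borel_measurable (M \<Otimes>\<^sub>M borel)"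
      "(\<lambda>(\<omega>, u). simple_process (S s k) u \<omega>) \<in> borel_measurable (M \<Otimes>\<^sub>M borel)" for k
      using Ds S[OF t] S[OF s] simple_process_measurable by auto
    have "(\<lambda>z. (case z of (\<omega>, u) \<Rightarrow> simple_process (S t k) u \<omega>) - indicator {0..t} (snd z) * h (snd z)) \<in> borel_measurable (M \<Otimes>\<^sub>M borel)"
      "(\<lambda>z. indicator {0..s} (snd z) * h (snd z) - (case z of (\<omega>, u) \<Rightarrow> simple_process (S s k) u \<omega>)) \<in> borel_measurable (M \<Otimes>\<^sub>M borel)"
      "(\<lambda>z. indicator {s<..t} (snd z) * h (snd z) - (case z of (\<omega>, u) \<Rightarrow> simple_process (D s t k) u \<omega>)) \<in> borel_measurable (M \<Otimes>\<^sub>M borel)" for k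
      by measurable
    then have p: "(\<lambda>(\<omega>, u). simple_process (S t k) u \<omega> - indicator {0..t} u * h u) \<in> borel_measurable (M \<Otimes>\<^sub>M borel)"
      "(\<lambda>(\<omega>, u). indicator {0..s} u * h u - simple_process (S s k) u \<omega>) \<in> borel_measurable (M \<Otimes>\<^sub>M borel)"
      "(\<lambda>(\<omega>, u). indicator {s<..t} u * h u - simple_process (D s t k) u \<omega>) \<in> borel_measurable (M \<Otimes>\<^sub>M borel)" for k
      by (simp_all add: split_beta')
    have "(\<lambda>z. (case z of (\<omega>, u) \<Rightarrow> indicator {0..s} u * h u - simple_process (S s k) u \<omega>)
        + (case z of (\<omega>, u) \<Rightarrow> indicator {s<..t} u * h u - simple_process (D s t k) u \<omega>)) \<in> borel_measurable (M \<Otimes>\<^sub>M borel)" for k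
      by (intro borel_measurable_add p)
    then have p': "(\<lambda>(\<omega>, u). (indicator {0..s} u * h u - simple_process (S s k) u \<omega>)
        + (indicator {s<..t} u * h u - simple_process (D s t k) u \<omega>)) \<in> borel_measurable (M \<Otimes>\<^sub>M borel)" for k
      by (simp add: split_beta')
    have l2: "(\<lambda>k. mean_square (\<lambda>u \<omega>. indicator {0..s} u * h u - simple_process (S s k) u \<omega>)) \<longlonglongrightarrow> 0"
      using approx[OF s] by (simp add: power2_commute[of "simple_process _ _ _"])
    have "mean_square (\<lambda>u \<omega>. indicator {s<..t} u * h u - simple_process (D s t k) u \<omega>)
        = (\<integral>\<^sup>+u. ennreal ((simple_process (D s t k) u (w t k) - indicator {s<..t} u * h u)\<^sup>2) \<partial>\<nu>)" for k
      by (simp add: D_def clip_process[OF S[OF t] st(2)] power2_commute emeasure_space_1)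
    then have l3: "(\<lambda>k. mean_square (\<lambda>u \<omega>. indicator {s<..t} u * h u - simple_process (D s t k) u \<omega>)) \<longlonglongrightarrow> 0"
      using conv_det[OF st] by simp
    \<comment> \<open>the three errors add up to the integrand of the isometry, as the deterministic terms cancel\<close>
    have ind: "indicator {0..t} u = (indicator {s<..t} u + indicator {0..s} u :: real)" for u
      using st by (auto simp: indicator_def)
    have E: "simple_process (S t k) u \<omega> - indicator {0..t} u * h u + ((indicator {0..s} u * h u - simple_process (S s k) u \<omega>)
        + (indicator {s<..t} u * h u - simple_process (D s t k) u \<omega>))
      = simple_process (S t k) u \<omega> - simple_process (S s k) u \<omega> - simple_process (D s t k) u \<omega>" for k \<omega> u
      unfolding ind by (simp add: algebra_simps)
    have mid: "(\<lambda>k. \<integral>\<^sup>+\<omega>. ennreal ((simple_integral Y (S t k) \<omega> - simple_integral Y (S s k) \<omega> - simple_integral Y (D s t k) \<omega>)\<^sup>2) \<partial>M) \<longlonglongrightarrow> 0"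
      using mean_square_add_tendsto_0[OF p(1) p' approx[OF t] mean_square_add_tendsto_0[OF p(2,3) l2 l3]]
      unfolding simple_integral_isometry[OF S[OF t] S[OF s] Ds] E .
    have "(\<lambda>k. \<integral>\<^sup>+\<omega>. ennreal (((simple_integral Y (S t k) \<omega> - simple_integral Y (S s k) \<omega> - simple_integral Y (D s t k) \<omega>) +
        ((X t \<omega> - simple_integral Y (S t k) \<omega>) + (simple_integral Y (S s k) \<omega> - X s \<omega>)))\<^sup>2) \<partial>M) \<longlonglongrightarrow> 0"
      using mid lim[OF t] lim[OF s] by (intro nn_integral_square_add_tendsto_0) (auto simp: power2_commute[of "X t _"])
    then have "(\<lambda>k. \<integral>\<^sup>+\<omega>. ennreal (((X t \<omega> - X s \<omega>) - simple_integral Y (D s t k) \<omega>)\<^sup>2) \<partial>M) \<longlonglongrightarrow> 0"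
      by (simp add: algebra_simps)
    then show ?thesis by (simp add: power2_commute[of "simple_integral _ _ _"])
  qed
  show "gaussian_increment M (F s) (\<lambda>\<omega>. X t \<omega> - X s \<omega>) (\<integral>u. (indicator {s<..t} u * h u)\<^sup>2 \<partial>\<nu>)"
    if st: "0 \<le> s" "s \<le> t" "t \<le> T" for s t
  proof (rule gaussian_increment_limit)
    have t: "t \<in> {0..T}" and s: "s \<in> {0..T}" using st by auto
    show "gaussian_increment M (F s) (simple_integral Y (D s t k)) (\<integral>u. (simple_process (D s t k) u (w t k))\<^sup>2 \<partial>\<nu>)" for k
      unfolding D_def by (rule clip_gaussian[OF S[OF t] st])
    show "(\<lambda>\<omega>. X t \<omega> - X s \<omega>) \<in> borel_measurable M" using Xm[OF t] Xm[OF s] by simp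
    have Ds: "is_simple M F T (D s t k)" for k unfolding D_def by (rule clip_simple[OF S[OF t] st])
    show "(\<lambda>k. \<integral>u. (simple_process (D s t k) u (w t k))\<^sup>2 \<partial>\<nu>) \<longlonglongrightarrow> (\<integral>u. (indicator {s<..t} u * h u)\<^sup>2 \<partial>\<nu>)"
    proof (rule integral_square_tendsto)
      show "(\<lambda>u. simple_process (D s t k) u (w t k)) \<in> borel_measurable \<nu>" for k
        by (rule time_integral_measurable(3)[OF simple_process_measurable[OF Ds]]) (use w(1)[OF t] in auto)
      show "integrable \<nu> (\<lambda>u. (simple_process (D s t k) u (w t k))\<^sup>2)" for k
        by (rule simple_process_square_integrable[OF Ds])
      show "integrable \<nu> (\<lambda>u. (indicator {s<..t} u * h u)\<^sup>2)"
        by (rule Bochner_Integration.integrable_bound[OF h2]) (auto simp: indicator_def)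
    qed (use conv_det[OF st] in auto)
  qed (use conv[OF st] in auto)
  show "X t \<in> borel_measurable (F t)" if t: "t \<in> {0..T}" for t
  proof -
    have st: "0 \<le> (0::real)" "0 \<le> t" "t \<le> T" using t by auto
    have Im: "simple_integral Y (D 0 t k) \<in> borel_measurable (F t)" for k
      unfolding D_def by (rule clip_measurable[OF S[OF t] st])
    note IM = measurable_M[OF t Im]
    note [measurable] = IM
    have [measurable]: "X t \<in> borel_measurable M" "X 0 \<in> borel_measurable M" using Xm T t by auto
    obtain r where r: "strict_mono (r :: nat \<Rightarrow> nat)"
      "AE \<omega> in M. (\<lambda>k. ennreal ((simple_integral Y (D 0 t (r k)) \<omega> - (X t \<omega> - X 0 \<omega>))\<^sup>2)) \<longlonglongrightarrow> 0"
      by (rule AE_subseq_of_nn_integral_tendsto_0[OF _ conv[OF st]]) auto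
    have "(\<lambda>\<omega>. lim (\<lambda>k. simple_integral Y (D 0 t (r k)) \<omega>)) \<in> borel_measurable (F t)"
      by (rule borel_measurable_lim_metric) (rule Im)
    moreover have "AE \<omega> in M. X t \<omega> = lim (\<lambda>k. simple_integral Y (D 0 t (r k)) \<omega>)"
      using r(2) X0
    proof eventually_elim
      case (elim \<omega>)
      have "(\<lambda>k. simple_integral Y (D 0 t (r k)) \<omega>) \<longlonglongrightarrow> X t \<omega>"
        using tendsto_of_ennreal_square[OF elim(1)] elim(2) by simp
      then show ?case by (simp add: limI)
    qed
    ultimately show ?thesis by (rule complete[OF t _ \<open>X t \<in> borel_measurable M\<close>])
  qed
qed

end

lemma has_ito_integral_mono:
  fixes M :: "'a measure"
  assumes "has_ito_integral M F T Y a H Z"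
    and "\<And>t f. t \<in> {0..T} \<Longrightarrow> f \<in> borel_measurable (F t) \<Longrightarrow> (f :: 'a \<Rightarrow> real) \<in> borel_measurable (F' t)"
  shows "has_ito_integral M F' T Y a H Z"
proof -
  have "is_simple M F' T S" if "is_simple M F T S" for S
  proof -
    obtain n \<tau> \<xi> where S: "S = (n, \<tau>, \<xi>)" by (cases S)
    note D = is_simpleD[OF that[unfolded S]]
    have "\<xi> i \<in> borel_measurable (F' (\<tau> i))" if "i < n" for i
      by (rule assms(2)[of "\<tau> i"]) (use D[OF that] in auto)
    then show ?thesis using D by (auto simp: S is_simple_def)
  qed
  then show ?thesis using assms(1) unfolding has_ito_integral_def by blast
qed

lemma weight_measure_integral:
  fixes a f :: "real \<Rightarrow> real"
  assumes [measurable]: "(\<lambda>s. indicator {0..T} s * a s) \<in> borel_measurable borel" "f \<in> borel_measurable borel"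
    and nn: "\<And>s. 0 \<le> a s"
  shows "integrable (weight_measure T a) f \<longleftrightarrow> integrable lborel (\<lambda>s. indicator {0..T} s * a s * f s)"
    "(\<integral>s. f s \<partial>weight_measure T a) = (\<integral>s. indicator {0..T} s * a s * f s \<partial>lborel)"
proof -
  have m: "f \<in> borel_measurable lborel" "(\<lambda>s. indicator {0..T} s * a s) \<in> borel_measurable lborel"
    by simp_all
  have "AE s in lborel. 0 \<le> indicator {0..T} s * a s" using nn by simp
  from integrable_density[OF m this] integral_density[OF m this]
  show "integrable (weight_measure T a) f \<longleftrightarrow> integrable lborel (\<lambda>s. indicator {0..T} s * a s * f s)"
    "(\<integral>s. f s \<partial>weight_measure T a) = (\<integral>s. indicator {0..T} s * a s * f s \<partial>lborel)"
    unfolding weight_measure_def by simp_all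
qed

lemma finite_weight_measure:
  fixes a :: "real \<Rightarrow> real"
  assumes "integrable lborel (\<lambda>s. indicator {0..T} s * a s)" and nn: "\<And>s. 0 \<le> a s"
  shows "finite_measure (weight_measure T a)"
proof (rule finite_measureI)
  have "emeasure (weight_measure T a) (space (weight_measure T a)) = (\<integral>\<^sup>+s. ennreal (indicator {0..T} s * a s) \<partial>lborel)"
    using assms(1) unfolding weight_measure_def by (subst emeasure_density) (auto simp: mult.commute)
  also have "\<dots> \<noteq> \<infinity>"
    using assms by (subst nn_integral_eq_integral) auto
  finally show "emeasure (weight_measure T a) (space (weight_measure T a)) \<noteq> \<infinity>" .
qed

lemma emeasure_weight_measure_singleton:
  assumes "(\<lambda>s. indicator {0..T} s * a s :: real) \<in> borel_measurable borel"
  shows "emeasure (weight_measure T a) {x} = 0"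
proof -
  have "AE y in lborel. y \<in> {x} \<longrightarrow> ennreal (indicator {0..T} y * a y) = 0"
    using AE_lborel_singleton[of x] by eventually_elim auto
  then have "{x} \<in> null_sets (weight_measure T a)"
    unfolding weight_measure_def using assms by (subst null_sets_density_iff) auto
  then show ?thesis by auto
qed

text \<open>
  \<open>X\<close> has Gaussian increments relative to the augmented filtration of \<open>W\<close>, and is adapted to it; hence the
  smaller natural filtration of \<open>X\<close> inherits the property.
\<close>

lemma wiener_gaussian_martingale:
  fixes M :: "'a measure"
  assumes M: "prob_space M" and T: "0 < T" and \<sigma>: "set_borel_measurable lborel {0..T} \<sigma>"
    and \<sigma>2: "set_integrable lborel {0..T} (\<lambda>s. (\<sigma> s)\<^sup>2)"
    and W: "brownian_motion M T W" and X: "wiener_integral_process M T \<sigma> W X"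
  shows "gaussian_martingale M (natural_filtration M X) T X (weight_measure T (\<lambda>s. (\<sigma> s)\<^sup>2))"
    "AE \<omega> in M. X 0 \<omega> = 0"
proof -
  interpret prob_space M by fact
  define G where "G t = augmented M (natural_filtration M W t)" for t
  define \<nu> where "\<nu> = weight_measure T (\<lambda>_. 1)"
  interpret W: gaussian_martingale M G T W \<nu>
    unfolding G_def \<nu>_def by (rule brownian_gaussian_martingale[OF T W])
  have subW: "subalgebra M (natural_filtration M W t)" if "t \<in> {0..T}" for t
    by (rule subalgebra_natural_filtration) (use W that in \<open>auto simp: brownian_motion_def\<close>)
  define h where "h s = indicator {0..T} s * \<sigma> s" for s
  have hm [measurable]: "h \<in> borel_measurable borel" using \<sigma> by (simp add: set_borel_measurable_def h_def[abs_def])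
  have one: "(\<lambda>s. indicator {0..T} s * 1 :: real) \<in> borel_measurable borel" by simp
  have h2: "indicator {0..T} s * (\<sigma> s)\<^sup>2 = (h s)\<^sup>2" for s by (simp add: h_def indicator_def)
  have \<sigma>m: "(\<lambda>s. indicator {0..T} s * (\<sigma> s)\<^sup>2) \<in> borel_measurable borel" unfolding h2 by measurable
  have \<sigma>i: "integrable lborel (\<lambda>s. indicator {0..T} s * (\<sigma> s)\<^sup>2)" using \<sigma>2 by (simp add: set_integrable_def)
  have h2i: "integrable \<nu> (\<lambda>u. (h u)\<^sup>2)"
  proof -
    have "(\<lambda>s. indicator {0..T} s * 1 * (h s)\<^sup>2) = (\<lambda>s. indicator {0..T} s * (\<sigma> s)\<^sup>2)"
      by (auto simp: h_def indicator_def)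
    then show ?thesis
      unfolding \<nu>_def using \<sigma>i by (subst weight_measure_integral(1)[OF one]) auto
  qed
  have \<nu>0: "emeasure \<nu> {0} = 0" unfolding \<nu>_def by (rule emeasure_weight_measure_singleton) (rule one)
  have Xm: "X t \<in> borel_measurable M" if "t \<in> {0..T}" for t
    using X that by (auto simp: wiener_integral_process_def has_ito_integral_def)
  have ex: "\<exists>S. W.ito_approximates S (\<lambda>u _. indicator {0..t} u * h u) (X t)" if t: "t \<in> {0..T}" for t
  proof -
    have I: "has_ito_integral M (natural_filtration M W) T W (\<lambda>s. 1) (\<lambda>s \<omega>. \<sigma> s * indicator {0..t} s) (X t)"
      using X t by (auto simp: wiener_integral_process_def)
    have I': "has_ito_integral M G T W (\<lambda>s. 1) (\<lambda>s \<omega>. \<sigma> s * indicator {0..t} s) (X t)"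
      by (rule has_ito_integral_mono[OF I]) (auto simp: G_def intro!: measurable_augmented subW)
    have "(\<lambda>(\<omega>, s). indicator {0..t} s * h s) \<in> borel_measurable (M \<Otimes>\<^sub>M borel)" by measurable
    from W.has_ito_integral_weight_iff[THEN iffD1, OF \<nu>_def _ _ _ this _ _ I'] show ?thesis
      using T I' by (auto simp: h_def has_ito_integral_def)
  qed
  define S where "S t = (SOME S. W.ito_approximates S (\<lambda>u _. indicator {0..t} u * h u) (X t))" for t
  have S: "W.ito_approximates (S t) (\<lambda>u _. indicator {0..t} u * h u) (X t)" if "t \<in> {0..T}" for t
    unfolding S_def by (rule someI_ex[OF ex[OF that]])
  have complete: "(g :: 'a \<Rightarrow> real) \<in> borel_measurable (G t)"
    if "t \<in> {0..T}" "f \<in> borel_measurable (G t)" "g \<in> borel_measurable M" "AE \<omega> in M. g \<omega> = f \<omega>" for t f g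
    unfolding G_def by (rule measurable_augmented_AE[OF subW[OF that(1)] that(2)[unfolded G_def] that(3,4)])
  have tr: "AE \<omega> in M. X 0 \<omega> = 0" "\<And>t. t \<in> {0..T} \<Longrightarrow> X t \<in> borel_measurable (G t)"
    "\<And>s t. 0 \<le> s \<Longrightarrow> s \<le> t \<Longrightarrow> t \<le> T \<Longrightarrow>
      gaussian_increment M (G s) (\<lambda>\<omega>. X t \<omega> - X s \<omega>) (\<integral>u. (indicator {s<..t} u * h u)\<^sup>2 \<partial>\<nu>)"
  proof -
    have T': "0 \<le> T" using T by simp
    show "AE \<omega> in M. X 0 \<omega> = 0"
      by (rule W.wiener_transform(1)[OF T' hm h2i \<nu>0 complete Xm S])
    show "X t \<in> borel_measurable (G t)" if "t \<in> {0..T}" for t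
      by (rule W.wiener_transform(2)[OF T' hm h2i \<nu>0 complete Xm S that])
    show "gaussian_increment M (G s) (\<lambda>\<omega>. X t \<omega> - X s \<omega>) (\<integral>u. (indicator {s<..t} u * h u)\<^sup>2 \<partial>\<nu>)"
      if "0 \<le> s" "s \<le> t" "t \<le> T" for s t
      by (rule W.wiener_transform(3)[OF T' hm h2i \<nu>0 complete Xm S that])
  qed
  show "AE \<omega> in M. X 0 \<omega> = 0" by (rule tr(1))
  show "gaussian_martingale M (natural_filtration M X) T X (weight_measure T (\<lambda>s. (\<sigma> s)\<^sup>2))"
  proof (rule gaussian_martingale.intro[OF M gaussian_martingale_axioms.intro])
    show "subalgebra M (natural_filtration M X t)" if "t \<in> {0..T}" for t
      by (rule subalgebra_natural_filtration) (use Xm that in auto)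
    show "sets (natural_filtration M X s) \<subseteq> sets (natural_filtration M X t)" if "s \<le> t" for s t
      using that by (rule natural_filtration_mono)
    show "X t \<in> borel_measurable (natural_filtration M X t)" if "t \<in> {0..T}" for t
      using that by (intro natural_filtration_adapted) auto
    show "sets (weight_measure T (\<lambda>s. (\<sigma> s)\<^sup>2)) = sets borel" by (rule sets_weight_measure)
    show fin: "finite_measure (weight_measure T (\<lambda>s. (\<sigma> s)\<^sup>2))"
      by (rule finite_weight_measure[OF \<sigma>i]) simp
    fix s t :: real assume st: "0 \<le> s" "s < t" "t \<le> T"
    have "measure (weight_measure T (\<lambda>s. (\<sigma> s)\<^sup>2)) {s<..t} = (\<integral>u. indicator {s<..t} u \<partial>weight_measure T (\<lambda>s. (\<sigma> s)\<^sup>2))"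
      by (simp add: sets_eq_imp_space_eq[OF sets_weight_measure])
    also have "\<dots> = (\<integral>u. indicator {0..T} u * (\<sigma> u)\<^sup>2 * indicator {s<..t} u \<partial>lborel)"
      by (rule weight_measure_integral(2)[OF \<sigma>m]) auto
    also have "\<dots> = (\<integral>u. indicator {0..T} u * 1 * (indicator {s<..t} u * h u)\<^sup>2 \<partial>lborel)"
      by (intro Bochner_Integration.integral_cong) (auto simp: h_def indicator_def)
    also have "\<dots> = (\<integral>u. (indicator {s<..t} u * h u)\<^sup>2 \<partial>\<nu>)"
      unfolding \<nu>_def by (subst weight_measure_integral(2)[OF one]) auto
    finally have v: "measure (weight_measure T (\<lambda>s. (\<sigma> s)\<^sup>2)) {s<..t} = (\<integral>u. (indicator {s<..t} u * h u)\<^sup>2 \<partial>\<nu>)" .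
    have "subalgebra (G s) (natural_filtration M X s)"
    proof (rule subalgebra_natural_filtration)
      fix r assume "r \<in> {0..s}"
      then show "X r \<in> borel_measurable (G s)"
        using st by (intro W.measurable_le[OF _ _ _ tr(2)[of r]]) auto
    qed (simp add: G_def)
    then show "gaussian_increment M (natural_filtration M X s) (\<lambda>\<omega>. X t \<omega> - X s \<omega>) (measure (weight_measure T (\<lambda>s. (\<sigma> s)\<^sup>2)) {s<..t})"
      unfolding v using st by (intro gaussian_increment_antimono[OF tr(3)]) auto
  qed
qed

section \<open>Drifts and their densities\<close>

lemma measurable_processI:
  assumes H': "(\<lambda>(\<omega>, s). H' s \<omega>) \<in> borel_measurable (N \<Otimes>\<^sub>M borel)"
    and eq: "\<And>s \<omega>. s \<in> {0..T} \<Longrightarrow> \<omega> \<in> space N \<Longrightarrow> H s \<omega> = H' s \<omega>"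
  shows "measurable_process N T H"
proof -
  have [measurable]: "(\<lambda>s. s) \<in> measurable (restrict_space borel {0..T}) (borel :: real measure)"
    by (rule measurable_restrict_space1) simp
  note [measurable] = H'
  have "(\<lambda>z. case (fst z, snd z) of (\<omega>, s) \<Rightarrow> H' s \<omega>) \<in> borel_measurable (N \<Otimes>\<^sub>M restrict_space borel {0..T})"
    by measurable
  also have "?this \<longleftrightarrow> (\<lambda>(\<omega>, s). H s \<omega>) \<in> borel_measurable (N \<Otimes>\<^sub>M restrict_space borel {0..T})"
    by (rule measurable_cong) (auto simp: space_pair_measure space_restrict_space eq)
  finally show ?thesis by (simp add: measurable_process_def)
qed

locale drifted_wiener = gaussian_martingale M "natural_filtration M X" T X "weight_measure T (\<lambda>s. (\<sigma> s)\<^sup>2)"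
  for M :: "'a measure" and X :: "real \<Rightarrow> 'a \<Rightarrow> real" and T :: real and \<sigma> :: "real \<Rightarrow> real" +
  assumes T: "0 < T" and \<sigma>: "set_borel_measurable lborel {0..T} \<sigma>"
    and \<sigma>2: "set_integrable lborel {0..T} (\<lambda>s. (\<sigma> s)\<^sup>2)"
    and \<sigma>0: "AE s in lborel. s \<in> {0..T} \<longrightarrow> \<sigma> s \<noteq> 0"
    and X0: "AE \<omega> in M. X 0 \<omega> = 0"
begin

abbreviation vol :: "real measure" where "vol \<equiv> weight_measure T (\<lambda>s. (\<sigma> s)\<^sup>2)"

text \<open>
  Measurability is assumed for \<open>\<sigma>\<close> on \<open>[0, T]\<close>; outside of this interval \<open>\<sigma>\<close> is arbitrary.
\<close>

definition cut_sigma :: "real \<Rightarrow> real" where "cut_sigma s = indicator {0..T} s * \<sigma> s"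

lemma cut_sigma_measurable [measurable]: "cut_sigma \<in> borel_measurable borel"
  using \<sigma> by (simp add: set_borel_measurable_def cut_sigma_def[abs_def])

lemma \<sigma>2_measurable: "(\<lambda>s. indicator {0..T} s * (\<sigma> s)\<^sup>2) \<in> borel_measurable borel"
proof -
  have "(\<lambda>s. indicator {0..T} s * (\<sigma> s)\<^sup>2) = (\<lambda>s. (cut_sigma s)\<^sup>2)" by (auto simp: cut_sigma_def indicator_def)
  then show ?thesis by simp
qed

lemma AE_vol_nonzero: "AE s in vol. s \<in> {0..T} \<and> cut_sigma s \<noteq> 0"
  unfolding weight_measure_def using \<sigma>2_measurable
  by (subst AE_density) (auto simp: cut_sigma_def indicator_def intro!: AE_I2)

text \<open>
  The integrand \<open>\<sigma>\<^sup>-\<^sup>2 (du/dt)\<close> of the Girsanov exponent, extended by \<open>0\<close> beyond \<open>[0, T]\<close> to be jointly measurable in all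
  times.
\<close>

definition score :: "(real \<Rightarrow> 'a \<Rightarrow> real) \<Rightarrow> real \<Rightarrow> 'a \<Rightarrow> real" where
  "score vdot s \<omega> = indicator {0..T} s * vdot (max 0 (min T s)) \<omega> / (cut_sigma s)\<^sup>2"

lemma score_eq: "s \<in> {0..T} \<Longrightarrow> vdot s \<omega> / (\<sigma> s)\<^sup>2 = score vdot s \<omega>"
  by (simp add: score_def cut_sigma_def)

lemma score_measurable:
  assumes "measurable_process M T vdot"
  shows "(\<lambda>(\<omega>, s). score vdot s \<omega>) \<in> borel_measurable (M \<Otimes>\<^sub>M borel)"
proof -
  have [measurable]: "(\<lambda>(\<omega>, s). vdot (max 0 (min T s)) \<omega>) \<in> borel_measurable (M \<Otimes>\<^sub>M borel)"
    using assms T by (intro measurable_process_clamp) auto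
  have "(\<lambda>z. indicator {0..T} (snd z) * (case z of (\<omega>, s) \<Rightarrow> vdot (max 0 (min T s)) \<omega>) / (cut_sigma (snd z))\<^sup>2) \<in> borel_measurable (M \<Otimes>\<^sub>M borel)"
    by measurable
  then show ?thesis by (simp add: score_def split_beta')
qed

lemma score_section:
  assumes "measurable_process M T vdot" "\<omega> \<in> space M"
  shows "(\<lambda>s. score vdot s \<omega>) \<in> borel_measurable borel"
  using time_integral_measurable(3)[OF score_measurable[OF assms(1)] assms(2)]
  by (simp cong: measurable_cong_sets add: sets_weight_measure)

lemma square_div: "(a / b\<^sup>2)\<^sup>2 * b\<^sup>2 = a\<^sup>2 / b\<^sup>2" for a b :: real
  by (cases "b = 0") (auto simp: power2_eq_square field_simps)

lemma energy_nn_integral: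
  assumes "measurable_process M T vdot" "\<omega> \<in> space M"
  shows "(\<integral>\<^sup>+s\<in>{0..T}. ennreal ((vdot s \<omega>)\<^sup>2 / (\<sigma> s)\<^sup>2) \<partial>lborel) = (\<integral>\<^sup>+s. ennreal ((score vdot s \<omega>)\<^sup>2) \<partial>vol)"
proof -
  note [measurable] = score_section[OF assms]
  have "(\<integral>\<^sup>+s\<in>{0..T}. ennreal ((vdot s \<omega> / (\<sigma> s)\<^sup>2)\<^sup>2 * (\<sigma> s)\<^sup>2) \<partial>lborel) = (\<integral>\<^sup>+s. ennreal ((score vdot s \<omega>)\<^sup>2) \<partial>vol)"
    by (rule nn_integral_weight_measure[OF \<sigma>2_measurable]) (auto simp: score_eq)
  then show ?thesis by (simp add: square_div)
qed

lemma energy_integral: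
  assumes "measurable_process M T vdot" "\<omega> \<in> space M"
  shows "(LBINT s:{0..T}. (vdot s \<omega>)\<^sup>2 / (\<sigma> s)\<^sup>2) = (\<integral>s. (score vdot s \<omega>)\<^sup>2 \<partial>vol)"
proof -
  note [measurable] = score_section[OF assms]
  have "(\<integral>s. (score vdot s \<omega>)\<^sup>2 \<partial>vol) = (\<integral>s. indicator {0..T} s * (\<sigma> s)\<^sup>2 * (score vdot s \<omega>)\<^sup>2 \<partial>lborel)"
    by (rule weight_measure_integral(2)[OF \<sigma>2_measurable]) auto
  also have "\<dots> = (\<integral>s. indicator {0..T} s *\<^sub>R ((vdot s \<omega>)\<^sup>2 / (\<sigma> s)\<^sup>2) \<partial>lborel)"
  proof (intro Bochner_Integration.integral_cong refl)
    fix s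
    show "indicator {0..T} s * (\<sigma> s)\<^sup>2 * (score vdot s \<omega>)\<^sup>2 = indicator {0..T} s *\<^sub>R ((vdot s \<omega>)\<^sup>2 / (\<sigma> s)\<^sup>2)"
      using square_div[of "vdot s \<omega>" "\<sigma> s"] by (cases "s \<in> {0..T}") (simp_all add: score_eq[symmetric] mult.commute)
  qed
  finally show ?thesis by (simp add: set_lebesgue_integral_def)
qed

lemma has_ito_integral_score_iff:
  assumes "measurable_process M T vdot"
  shows "has_ito_integral M (natural_filtration M X) T X (\<lambda>s. (\<sigma> s)\<^sup>2) (\<lambda>s \<omega>. vdot s \<omega> / (\<sigma> s)\<^sup>2) Z \<longleftrightarrow>
    Z \<in> borel_measurable M \<and> (\<exists>S. ito_approximates S (score vdot) Z)"
proof (rule has_ito_integral_weight_iff)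
  show "(\<lambda>(\<omega>, s). score vdot s \<omega>) \<in> borel_measurable (M \<Otimes>\<^sub>M borel)" by (rule score_measurable) fact
  then show "measurable_process M T (\<lambda>s \<omega>. vdot s \<omega> / (\<sigma> s)\<^sup>2)"
    by (rule measurable_processI) (rule score_eq)
qed (use T in \<open>auto simp: score_eq intro!: \<sigma>2_measurable\<close>)

abbreviation stoch_int :: "(real \<Rightarrow> 'a \<Rightarrow> real) \<Rightarrow> 'a \<Rightarrow> real" where
  "stoch_int vdot \<equiv> ito_integral M (natural_filtration M X) T X (\<lambda>s. (\<sigma> s)\<^sup>2) (\<lambda>s \<omega>. vdot s \<omega> / (\<sigma> s)\<^sup>2)"

abbreviation score_integrable :: "(real \<Rightarrow> 'a \<Rightarrow> real) \<Rightarrow> bool" where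
  "score_integrable vdot \<equiv> ito_integrable M (natural_filtration M X) T X (\<lambda>s. (\<sigma> s)\<^sup>2) (\<lambda>s \<omega>. vdot s \<omega> / (\<sigma> s)\<^sup>2)"

lemma stoch_int:
  assumes "score_integrable vdot"
  shows "has_ito_integral M (natural_filtration M X) T X (\<lambda>s. (\<sigma> s)\<^sup>2) (\<lambda>s \<omega>. vdot s \<omega> / (\<sigma> s)\<^sup>2) (stoch_int vdot)"
  using assms unfolding ito_integrable_def ito_integral_def by (rule someI_ex)

lemma girsanov_density_eq:
  assumes "measurable_process M T vdot" "\<omega> \<in> space M"
  shows "girsanov_density M T \<sigma> X vdot \<omega> = exp (stoch_int vdot \<omega> - (\<integral>s. (score vdot s \<omega>)\<^sup>2 \<partial>vol) / 2)"
  by (simp add: girsanov_density_def energy_integral[OF assms])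

lemma girsanov_density_measurable:
  assumes "measurable_process M T vdot"
    "score_integrable vdot"
  shows "girsanov_density M T \<sigma> X vdot \<in> borel_measurable M"
proof -
  have [measurable]: "stoch_int vdot \<in> borel_measurable M"
    using stoch_int[OF assms(2)] by (simp add: has_ito_integral_def)
  have [measurable]: "(\<lambda>\<omega>. \<integral>s. (score vdot s \<omega>)\<^sup>2 \<partial>vol) \<in> borel_measurable M"
    by (rule time_integral_measurable(2)[OF score_measurable[OF assms(1)]])
  have "(\<lambda>\<omega>. exp (stoch_int vdot \<omega> - (\<integral>s. (score vdot s \<omega>)\<^sup>2 \<partial>vol) / 2)) \<in> borel_measurable M"
    by measurable
  then show ?thesis by (subst measurable_cong[OF girsanov_density_eq[OF assms(1)]]) auto
qed

lemma prob_space_girsanov_iff: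
  assumes "measurable_process M T vdot"
    "score_integrable vdot"
  shows "prob_space (girsanov_measure M T \<sigma> X vdot) \<longleftrightarrow> (\<integral>\<^sup>+\<omega>. ennreal (girsanov_density M T \<sigma> X vdot \<omega>) \<partial>M) = 1"
proof -
  have [measurable]: "girsanov_density M T \<sigma> X vdot \<in> borel_measurable M"
    by (rule girsanov_density_measurable[OF assms])
  have "emeasure (girsanov_measure M T \<sigma> X vdot) (space (girsanov_measure M T \<sigma> X vdot)) = (\<integral>\<^sup>+\<omega>. ennreal (girsanov_density M T \<sigma> X vdot \<omega>) \<partial>M)"
    unfolding girsanov_measure_def by (simp add: emeasure_density cong: nn_integral_cong)
  then show ?thesis
    by (metis prob_space.emeasure_space_1 prob_spaceI)
qed

definition var_to :: "real \<Rightarrow> real" where "var_to t = measure vol {0<..t}"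

lemma var_to_eq: "var_to t = (\<integral>s. indicator {0..T} s * (\<sigma> s)\<^sup>2 * indicator {0<..t} s \<partial>lborel)"
proof -
  have "var_to t = (\<integral>s. indicator {0<..t} s \<partial>vol)"
    by (simp add: var_to_def sets_eq_imp_space_eq[OF sets_weight_measure])
  also have "\<dots> = (\<integral>s. indicator {0..T} s * (\<sigma> s)\<^sup>2 * indicator {0<..t} s \<partial>lborel)"
    by (rule weight_measure_integral(2)[OF \<sigma>2_measurable]) auto
  finally show ?thesis .
qed

text \<open>
  The density of \<open>u + l h\<close>, where \<open>h\<^sub>s = \<integral>\<^sub>0\<^bsup>s \<and> t\<^esup> \<sigma>\<^sub>r\<^sup>2 dr\<close>: in this direction the integrand of the Girsanov exponent changes
  by the constant \<open>l\<close> on \<open>(0, t]\<close>.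
\<close>

definition shift :: "real \<Rightarrow> real \<Rightarrow> (real \<Rightarrow> 'a \<Rightarrow> real) \<Rightarrow> real \<Rightarrow> 'a \<Rightarrow> real" where
  "shift l t vdot s \<omega> = vdot s \<omega> + l * ((\<sigma> s)\<^sup>2 * indicator {0<..t} s)"

lemma shift_measurable:
  assumes "measurable_process M T vdot"
  shows "measurable_process M T (shift l t vdot)"
proof (rule measurable_processI)
  have [measurable]: "(\<lambda>(\<omega>, s). vdot (max 0 (min T s)) \<omega>) \<in> borel_measurable (M \<Otimes>\<^sub>M borel)"
    using assms T by (intro measurable_process_clamp) auto
  have "(\<lambda>z. (case z of (\<omega>, s) \<Rightarrow> vdot (max 0 (min T s)) \<omega>) + l * ((cut_sigma (snd z))\<^sup>2 * indicator {0<..t} (snd z))) \<in> borel_measurable (M \<Otimes>\<^sub>M borel)"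
    by measurable
  then show "(\<lambda>(\<omega>, s). vdot (max 0 (min T s)) \<omega> + l * ((cut_sigma s)\<^sup>2 * indicator {0<..t} s)) \<in> borel_measurable (M \<Otimes>\<^sub>M borel)"
    by (simp add: split_beta')
qed (simp add: shift_def cut_sigma_def)

lemma AE_score_shift: "AE s in vol. score (shift l t vdot) s \<omega> = score vdot s \<omega> + l * indicator {0<..t} s"
  using AE_vol_nonzero by eventually_elim (auto simp: score_def shift_def cut_sigma_def field_simps)

text \<open>
  The factor \<open>\<sigma>\<^sub>s\<^sup>2\<close> of the time measure cancels against the score; this is where \<open>\<sigma>\<close> must not vanish.
\<close>

lemma score_drift:
  assumes v: "measurable_process M T vdot" "\<omega> \<in> space M" "set_integrable lborel {0..T} (\<lambda>s. vdot s \<omega>)" and t: "t \<in> {0..T}"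
  shows "(\<integral>s. indicator {0<..t} s * score vdot s \<omega> \<partial>vol) = (LBINT s:{0..t}. vdot s \<omega>)"
proof -
  note [measurable] = score_section[OF v(1,2)] \<sigma>2_measurable
  have vm: "(\<lambda>s. indicator {0..T} s * vdot s \<omega>) \<in> borel_measurable lborel"
    using v(3) by (auto simp: set_integrable_def)
  have "(\<lambda>s. indicator {0..t} s * (indicator {0..T} s * vdot s \<omega>)) \<in> borel_measurable lborel"
    by (intro borel_measurable_times vm) auto
  also have "(\<lambda>s. indicator {0..t} s * (indicator {0..T} s * vdot s \<omega>)) = (\<lambda>s. indicator {0..t} s *\<^sub>R vdot s \<omega>)"
    using t by (auto simp: indicator_def fun_eq_iff)
  finally have vm': "(\<lambda>s. indicator {0..t} s *\<^sub>R vdot s \<omega>) \<in> borel_measurable lborel" .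
  have "(\<integral>s. indicator {0<..t} s * score vdot s \<omega> \<partial>vol)
     = (\<integral>s. indicator {0..T} s * (\<sigma> s)\<^sup>2 * (indicator {0<..t} s * score vdot s \<omega>) \<partial>lborel)"
    by (rule weight_measure_integral(2)[OF \<sigma>2_measurable]) auto
  also have "\<dots> = (\<integral>s. indicator {0..t} s *\<^sub>R vdot s \<omega> \<partial>lborel)"
  proof (rule integral_cong_AE)
    show "(\<lambda>s. indicator {0..T} s * (\<sigma> s)\<^sup>2 * (indicator {0<..t} s * score vdot s \<omega>)) \<in> borel_measurable lborel"
      by measurable
    show "AE s in lborel. indicator {0..T} s * (\<sigma> s)\<^sup>2 * (indicator {0<..t} s * score vdot s \<omega>) = indicator {0..t} s *\<^sub>R vdot s \<omega>"
      using \<sigma>0 AE_lborel_singleton[of 0] by eventually_elim (use t in \<open>auto simp: score_eq[symmetric] indicator_def\<close>)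
  qed (rule vm')
  finally show ?thesis by (simp add: set_lebesgue_integral_def)
qed

lemma shift_drift:
  assumes v: "set_integrable lborel {0..T} (\<lambda>s. vdot s \<omega>)"
  shows "set_integrable lborel {0..T} (\<lambda>s. shift l t vdot s \<omega>)"
    "r \<in> {0..T} \<Longrightarrow> (LBINT s:{0..r}. shift l t vdot s \<omega>) = (LBINT s:{0..r}. vdot s \<omega>) + l * var_to (min r t)"
proof -
  have i: "set_integrable lborel {0..T} (\<lambda>s. (\<sigma> s)\<^sup>2 * indicator {0<..t} s)"
  proof -
    have "integrable lborel (\<lambda>s. (indicator {0..T} s *\<^sub>R (\<sigma> s)\<^sup>2) * indicator {0<..t} s)"
      using \<sigma>2 unfolding set_integrable_def by (intro integrable_real_mult_indicator) auto
    then show ?thesis by (simp add: set_integrable_def mult.assoc)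
  qed
  show "set_integrable lborel {0..T} (\<lambda>s. shift l t vdot s \<omega>)"
    unfolding shift_def using v i by (intro set_integral_add set_integrable_mult_right) auto
  assume r: "r \<in> {0..T}"
  have sub: "set_integrable lborel {0..r} (\<lambda>s. vdot s \<omega>)" "set_integrable lborel {0..r} (\<lambda>s. (\<sigma> s)\<^sup>2 * indicator {0<..t} s)"
    using r by (auto intro: set_integrable_subset[OF v] set_integrable_subset[OF i])
  have "(LBINT s:{0..r}. (\<sigma> s)\<^sup>2 * indicator {0<..t} s) = var_to (min r t)"
    unfolding var_to_eq set_lebesgue_integral_def
    using r by (intro Bochner_Integration.integral_cong) (auto simp: indicator_def)
  then show "(LBINT s:{0..r}. shift l t vdot s \<omega>) = (LBINT s:{0..r}. vdot s \<omega>) + l * var_to (min r t)"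
    unfolding shift_def using sub by (simp add: set_integral_add set_integral_mult_right)
qed

end

text \<open>
  A process with continuous paths is the limit of its values at the times \<open>\<lfloor>(n + 1) s\<rfloor> / (n + 1)\<close>, and these depend on
  \<open>s\<close> through an integer only.
\<close>

lemma continuous_process_measurable:
  fixes X :: "real \<Rightarrow> 'a \<Rightarrow> real"
  assumes T: "0 \<le> T" and X: "\<And>t. t \<in> {0..T} \<Longrightarrow> X t \<in> borel_measurable N"
    and cont: "\<And>\<omega>. \<omega> \<in> space N \<Longrightarrow> continuous_on {0..T} (\<lambda>t. X t \<omega>)"
  shows "measurable_process N T X"
proof (rule measurable_processI)
  define c where "c s = max 0 (min T s)" for s :: real
  have c: "c s \<in> {0..T}" for s using T by (auto simp: c_def)
  define g where "g n s = real_of_int \<lfloor>real (Suc n) * s\<rfloor> / real (Suc n)" for n s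
  have g: "(\<lambda>n. g n s) \<longlonglongrightarrow> s" for s
  proof (rule tendsto_sandwich)
    show "(\<lambda>n. s - inverse (real (Suc n))) \<longlonglongrightarrow> s"
      using tendsto_diff[OF tendsto_const LIMSEQ_inverse_real_of_nat, of s] by simp
    have "real (Suc n) * s - 1 \<le> real_of_int \<lfloor>real (Suc n) * s\<rfloor>" for n by linarith
    then have "(real (Suc n) * s - 1) / real (Suc n) \<le> g n s" for n unfolding g_def by (intro divide_right_mono) auto
    then show "\<forall>\<^sub>F n in sequentially. s - inverse (real (Suc n)) \<le> g n s"
      by (intro always_eventually allI) (simp add: diff_divide_distrib inverse_eq_divide)
    have "g n s \<le> (real (Suc n) * s) / real (Suc n)" for n unfolding g_def by (intro divide_right_mono) auto
    then show "\<forall>\<^sub>F n in sequentially. g n s \<le> s" by (intro always_eventually allI) (simp del: of_nat_Suc)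
  qed simp
  have "(\<lambda>z. X (c (snd z)) (fst z)) \<in> borel_measurable (N \<Otimes>\<^sub>M borel)"
  proof (rule borel_measurable_LIMSEQ_real)
    fix n
    have [measurable]: "(\<lambda>\<omega>. X (c (real_of_int i / real (Suc n))) \<omega>) \<in> borel_measurable N" for i
      by (rule X[OF c])
    have "(\<lambda>z. X (c (real_of_int i / real (Suc n))) (fst z)) \<in> borel_measurable (N \<Otimes>\<^sub>M borel)" for i :: int
      by measurable
    moreover have "(\<lambda>z. \<lfloor>real (Suc n) * snd z\<rfloor>) \<in> measurable (N \<Otimes>\<^sub>M borel) (count_space UNIV)"
      by measurable
    ultimately show "(\<lambda>z. X (c (g n (snd z))) (fst z)) \<in> borel_measurable (N \<Otimes>\<^sub>M borel)"
      unfolding g_def by (rule measurable_compose_countable)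
  next
    fix z assume "z \<in> space (N \<Otimes>\<^sub>M (borel :: real measure))"
    then have z: "fst z \<in> space N" by (auto simp: space_pair_measure)
    have "(\<lambda>n. c (g n (snd z))) \<longlonglongrightarrow> c (snd z)" unfolding c_def by (intro tendsto_intros g)
    then show "(\<lambda>n. X (c (g n (snd z))) (fst z)) \<longlonglongrightarrow> X (c (snd z)) (fst z)"
      by (rule continuous_on_tendsto_compose[OF cont[OF z]]) (use c in auto)
  qed
  then show "(\<lambda>(\<omega>, s). X (c s) \<omega>) \<in> borel_measurable (N \<Otimes>\<^sub>M borel)" by (simp add: split_beta')
  show "X s \<omega> = X (c s) \<omega>" if "s \<in> {0..T}" for s \<omega> using that by (simp add: c_def)
qed

text \<open>
  As \<open>\<integral> a = 0\<close>, one has \<open>e g = \<integral> a (L\<^sub>e - 1)\<close>. Young's inequality with weight \<open>e\<close> bounds this by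
  \<open>e/2 \<integral> a\<^sup>2 + (exp (e\<^sup>2g) - 1) / (2e)\<close>; after division by \<open>e\<close>, the limit \<open>e \<rightarrow> 0\<close> gives
  \<open>g \<le> (\<integral> a\<^sup>2 + g) / 2\<close>.
\<close>

lemma (in prob_space) chapman_robbins:
  fixes a :: "'a \<Rightarrow> real" and L :: "real \<Rightarrow> 'a \<Rightarrow> real"
  assumes a2: "integrable M (\<lambda>\<omega>. (a \<omega>)\<^sup>2)" and a: "integrable M a" "(\<integral>\<omega>. a \<omega> \<partial>M) = 0"
    and L: "\<And>e. e > 0 \<Longrightarrow> integrable M (L e)" "\<And>e. e > 0 \<Longrightarrow> (\<integral>\<omega>. L e \<omega> \<partial>M) = 1"
      "\<And>e. e > 0 \<Longrightarrow> integrable M (\<lambda>\<omega>. (L e \<omega>)\<^sup>2)" "\<And>e. e > 0 \<Longrightarrow> (\<integral>\<omega>. (L e \<omega>)\<^sup>2 \<partial>M) = exp (e\<^sup>2 * g)"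
    and aL: "\<And>e. e > 0 \<Longrightarrow> integrable M (\<lambda>\<omega>. L e \<omega> * a \<omega>)" "\<And>e. e > 0 \<Longrightarrow> (\<integral>\<omega>. L e \<omega> * a \<omega> \<partial>M) = e * g"
  shows "g \<le> (\<integral>\<omega>. (a \<omega>)\<^sup>2 \<partial>M)"
proof -
  define c where "c = (\<integral>\<omega>. (a \<omega>)\<^sup>2 \<partial>M)"
  have bound: "g \<le> c / 2 + ((exp (e\<^sup>2 * g) - 1) / e\<^sup>2) / 2" if e: "e > 0" for e
  proof -
    have i2: "integrable M (\<lambda>\<omega>. (L e \<omega> - 1)\<^sup>2)"
      using L(1,3)[OF e] by (simp add: power2_diff)
    have v2: "(\<integral>\<omega>. (L e \<omega> - 1)\<^sup>2 \<partial>M) = exp (e\<^sup>2 * g) - 1"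
      using L[OF e] by (simp add: power2_diff prob_space)
    have "e * g = (\<integral>\<omega>. L e \<omega> * a \<omega> - a \<omega> \<partial>M)"
      using aL[OF e] a by simp
    also have "\<dots> \<le> (\<integral>\<omega>. e / 2 * (a \<omega>)\<^sup>2 + 1 / (2 * e) * (L e \<omega> - 1)\<^sup>2 \<partial>M)"
    proof (rule integral_mono)
      fix \<omega>
      have "0 \<le> (e * a \<omega> - (L e \<omega> - 1))\<^sup>2" by simp
      then have "2 * e * (L e \<omega> * a \<omega> - a \<omega>) \<le> e\<^sup>2 * (a \<omega>)\<^sup>2 + (L e \<omega> - 1)\<^sup>2"
        by (simp add: power2_eq_square algebra_simps)
      then have "(2 * e * (L e \<omega> * a \<omega> - a \<omega>)) / (2 * e) \<le> (e\<^sup>2 * (a \<omega>)\<^sup>2 + (L e \<omega> - 1)\<^sup>2) / (2 * e)"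
        using e by (intro divide_right_mono) auto
      then show "L e \<omega> * a \<omega> - a \<omega> \<le> e / 2 * (a \<omega>)\<^sup>2 + 1 / (2 * e) * (L e \<omega> - 1)\<^sup>2"
        using e by (simp add: add_divide_distrib power2_eq_square)
    qed (use aL[OF e] a a2 i2 in auto)
    also have "\<dots> = e / 2 * c + 1 / (2 * e) * (exp (e\<^sup>2 * g) - 1)"
      using a2 i2 v2 by (simp add: c_def)
    finally have "(e * g) / e \<le> (e / 2 * c + 1 / (2 * e) * (exp (e\<^sup>2 * g) - 1)) / e"
      using e by (intro divide_right_mono) auto
    then show ?thesis using e by (simp add: add_divide_distrib power2_eq_square mult.assoc)
  qed
  have "((\<lambda>y. exp (y * g)) has_real_derivative g) (at 0)"
    by (auto intro!: derivative_eq_intros)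
  then have lim: "((\<lambda>y. (exp (y * g) - 1) / y) \<longlongrightarrow> g) (at 0)" by (simp add: DERIV_def)
  define e where "e n = inverse (real (Suc n))" for n
  have e: "e n > 0" for n by (simp add: e_def)
  have e0: "e \<longlonglongrightarrow> 0" unfolding e_def[abs_def] by (rule LIMSEQ_inverse_real_of_nat)
  have "filterlim (\<lambda>n. (e n)\<^sup>2) (at 0) sequentially"
    using tendsto_power[OF e0, of 2] less_imp_neq[OF e] by (auto simp: filterlim_at intro!: always_eventually)
  from filterlim_compose[OF lim this] have "(\<lambda>n. (exp ((e n)\<^sup>2 * g) - 1) / (e n)\<^sup>2) \<longlonglongrightarrow> g" .
  then have "(\<lambda>n. c / 2 + ((exp ((e n)\<^sup>2 * g) - 1) / (e n)\<^sup>2) / 2) \<longlonglongrightarrow> c / 2 + g / 2"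
    by (intro tendsto_add tendsto_divide tendsto_const) auto
  then have "g \<le> c / 2 + g / 2"
    by (rule LIMSEQ_le_const) (use bound[OF e] in auto)
  then show ?thesis by (simp add: c_def)
qed

section \<open>Admissible drifts under a deterministic shift\<close>

context drifted_wiener
begin

text \<open>
  The shifted simple processes approximate the shifted score. The stochastic integral in the density
  is an arbitrary version, so uniqueness is needed to identify it.
\<close>

lemma stoch_int_shift:
  assumes vdot: "measurable_process M T vdot"
    and ito: "score_integrable vdot"
    and t: "t \<in> {0..T}"
  shows "score_integrable (shift l t vdot)"
    "AE \<omega> in M. stoch_int (shift l t vdot) \<omega> = stoch_int vdot \<omega> + l * (X t \<omega> - X 0 \<omega>)"
proof -
  define Z where "Z = stoch_int vdot"
  obtain S where Zm [measurable]: "Z \<in> borel_measurable M" and A: "ito_approximates S (score vdot) Z"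
    using has_ito_integral_score_iff[OF vdot, THEN iffD1, OF stoch_int[OF ito]] unfolding Z_def by blast
  note S = ito_approximatesD[OF A]
  have "\<forall>k. \<exists>S'. is_simple M (natural_filtration M X) T S' \<and>
    (\<forall>s \<omega>. simple_process S' s \<omega> = simple_process (S k) s \<omega> + l * indicator {0<..t} s) \<and>
    (\<forall>\<omega>. simple_integral X S' \<omega> = simple_integral X (S k) \<omega> + l * (X t \<omega> - X 0 \<omega>))"
    by (intro allI, rule simple_add_indicator[OF S(1) t]) auto
  then obtain S' where S': "\<And>k. is_simple M (natural_filtration M X) T (S' k)"
    "\<And>k s \<omega>. simple_process (S' k) s \<omega> = simple_process (S k) s \<omega> + l * indicator {0<..t} s"
    "\<And>k \<omega>. simple_integral X (S' k) \<omega> = simple_integral X (S k) \<omega> + l * (X t \<omega> - X 0 \<omega>)"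
    by metis
  define Z' where "Z' \<omega> = Z \<omega> + l * (X t \<omega> - X 0 \<omega>)" for \<omega>
  have [measurable]: "X t \<in> borel_measurable M" "X 0 \<in> borel_measurable M" using t by (auto intro!: Y_measurable)
  have Zm' [measurable]: "Z' \<in> borel_measurable M" unfolding Z'_def by measurable
  have "mean_square (\<lambda>s \<omega>. simple_process (S' k) s \<omega> - score (shift l t vdot) s \<omega>)
    = mean_square (\<lambda>s \<omega>. simple_process (S k) s \<omega> - score vdot s \<omega>)" for k
  proof (rule nn_integral_cong, rule nn_integral_cong_AE)
    fix \<omega>
    show "AE s in vol. ennreal ((simple_process (S' k) s \<omega> - score (shift l t vdot) s \<omega>)\<^sup>2) = ennreal ((simple_process (S k) s \<omega> - score vdot s \<omega>)\<^sup>2)"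
      using AE_score_shift[of l t vdot \<omega>] by eventually_elim (simp add: S')
  qed
  then have ap': "(\<lambda>k. mean_square (\<lambda>s \<omega>. simple_process (S' k) s \<omega> - score (shift l t vdot) s \<omega>)) \<longlonglongrightarrow> 0"
    using S(2) by simp
  have A': "ito_approximates S' (score (shift l t vdot)) Z'"
    using S'(1) ap' S(3) by (simp add: ito_approximates_def S' Z'_def)
  note shm = shift_measurable[OF vdot, of l t]
  have "has_ito_integral M (natural_filtration M X) T X (\<lambda>s. (\<sigma> s)\<^sup>2) (\<lambda>s \<omega>. shift l t vdot s \<omega> / (\<sigma> s)\<^sup>2) Z'"
    unfolding has_ito_integral_score_iff[OF shm] using Zm' A' by blast
  then show ito': "score_integrable (shift l t vdot)"
    unfolding ito_integrable_def by blast
  obtain Q where Qm: "stoch_int (shift l t vdot) \<in> borel_measurable M"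
    and Q: "ito_approximates Q (score (shift l t vdot)) (stoch_int (shift l t vdot))"
    using has_ito_integral_score_iff[OF shm, THEN iffD1, OF stoch_int[OF ito']] by blast
  have "AE \<omega> in M. stoch_int (shift l t vdot) \<omega> = Z' \<omega>"
    by (rule ito_integral_unique[OF Q A' score_measurable[OF shm] Qm Zm'])
  then show "AE \<omega> in M. stoch_int (shift l t vdot) \<omega> = stoch_int vdot \<omega> + l * (X t \<omega> - X 0 \<omega>)"
    by (simp add: Z'_def Z_def)
qed

lemma energy_shift:
  assumes v: "admissible_drift M T \<sigma> X v vdot" and t: "t \<in> {0..T}"
  shows "AE \<omega> in M. (\<integral>s. (score (shift l t vdot) s \<omega>)\<^sup>2 \<partial>vol) = (\<integral>s. (score vdot s \<omega>)\<^sup>2 \<partial>vol) + 2 * l * v t \<omega> + l\<^sup>2 * var_to t"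
proof -
  have vm: "measurable_process M T vdot" using v by (simp add: admissible_drift_def)
  have "mean_square (\<lambda>s \<omega>. score vdot s \<omega>)
    = (\<integral>\<^sup>+\<omega>. (\<integral>\<^sup>+s\<in>{0..T}. ennreal ((vdot s \<omega>)\<^sup>2 / (\<sigma> s)\<^sup>2) \<partial>lborel) \<partial>M)"
    by (intro nn_integral_cong energy_nn_integral[OF vm, symmetric])
  also have "\<dots> < \<infinity>" using v by (simp add: admissible_drift_def)
  finally have "AE \<omega> in M. (\<integral>\<^sup>+s. ennreal ((score vdot s \<omega>)\<^sup>2) \<partial>vol) \<noteq> \<infinity>"
    using time_integral_measurable(1)[OF score_measurable[OF vm]] by (intro nn_integral_noteq_infinite) auto
  moreover have "AE \<omega> in M. set_integrable lborel {0..T} (\<lambda>s. vdot s \<omega>) \<and> (\<forall>t\<in>{0..T}. v t \<omega> = (LBINT s:{0..t}. vdot s \<omega>))"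
    using v by (simp add: admissible_drift_def)
  ultimately show ?thesis
    using AE_space
  proof eventually_elim
    case (elim \<omega>)
    have sm [measurable]: "(\<lambda>s. score vdot s \<omega>) \<in> borel_measurable borel" by (rule score_section[OF vm elim(3)])
    have [measurable]: "(\<lambda>s. score (shift l t vdot) s \<omega>) \<in> borel_measurable borel"
      by (rule score_section[OF shift_measurable[OF vm] elim(3)])
    have i2: "integrable vol (\<lambda>s. (score vdot s \<omega>)\<^sup>2)"
      using elim(1) by (intro integrableI_bounded) (auto simp: less_top)
    have ii: "integrable vol (\<lambda>s. indicator {0<..t} s :: real)"
      by (rule \<nu>.integrable_const_bound[where B = 1]) (auto simp: indicator_def)
    have i1: "integrable vol (\<lambda>s. indicator {0<..t} s * score vdot s \<omega>)"
    proof (rule Bochner_Integration.integrable_bound)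
      show "integrable vol (\<lambda>s. 1 + (score vdot s \<omega>)\<^sup>2)" using i2 by simp
      show "AE s in vol. norm (indicator {0<..t} s * score vdot s \<omega>) \<le> norm (1 + (score vdot s \<omega>)\<^sup>2)"
      proof (rule AE_I2)
        fix s
        have "2 * \<bar>score vdot s \<omega>\<bar> \<le> 1 + (score vdot s \<omega>)\<^sup>2"
          using zero_le_power2[of "\<bar>score vdot s \<omega>\<bar> - 1"] by (simp add: power2_diff)
        then show "norm (indicator {0<..t} s * score vdot s \<omega>) \<le> norm (1 + (score vdot s \<omega>)\<^sup>2)"
          by (auto simp: indicator_def)
      qed
    qed measurable
    have "(\<integral>s. (score (shift l t vdot) s \<omega>)\<^sup>2 \<partial>vol)
      = (\<integral>s. (score vdot s \<omega>)\<^sup>2 + 2 * l * (indicator {0<..t} s * score vdot s \<omega>) + l\<^sup>2 * indicator {0<..t} s \<partial>vol)"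
    proof (rule integral_cong_AE)
      show "AE s in vol. (score (shift l t vdot) s \<omega>)\<^sup>2 =
        (score vdot s \<omega>)\<^sup>2 + 2 * l * (indicator {0<..t} s * score vdot s \<omega>) + l\<^sup>2 * indicator {0<..t} s"
        using AE_score_shift[of l t vdot \<omega>]
        by eventually_elim (auto simp: indicator_def power2_eq_square algebra_simps)
    qed measurable
    also have "\<dots> = (\<integral>s. (score vdot s \<omega>)\<^sup>2 \<partial>vol) + 2 * l * (\<integral>s. indicator {0<..t} s * score vdot s \<omega> \<partial>vol) + l\<^sup>2 * var_to t"
      using i2 i1 ii by (simp add: var_to_def sets_eq_imp_space_eq[OF sets_weight_measure])
    also have "(\<integral>s. indicator {0<..t} s * score vdot s \<omega> \<partial>vol) = v t \<omega>"
      using score_drift[OF vm elim(3) _ t] elim(2) t by simp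
    finally show ?case .
  qed
qed

lemma girsanov_density_shift:
  assumes v: "admissible_drift M T \<sigma> X v vdot" and t: "t \<in> {0..T}"
  shows "AE \<omega> in M. girsanov_density M T \<sigma> X (shift l t vdot) \<omega>
    = girsanov_density M T \<sigma> X vdot \<omega> * exp (l * (X t \<omega> - v t \<omega>) - l\<^sup>2 * var_to t / 2)"
proof -
  have vm: "measurable_process M T vdot"
    and ito: "score_integrable vdot"
    using v by (simp_all add: admissible_drift_def)
  show ?thesis
    using stoch_int_shift(2)[OF vm ito t, of l] energy_shift[OF v t, of l] X0 AE_space
  proof eventually_elim
    case (elim \<omega>)
    show ?case
      unfolding girsanov_density_eq[OF vm elim(4)] girsanov_density_eq[OF shift_measurable[OF vm] elim(4)] elim(1,2,3) mult_exp_exp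
      by (simp add: field_simps)
  qed
qed

text \<open>
  The point is that the new density has total mass \<open>1\<close>, by \<open>exponential_shift_expectation\<close>.
\<close>

lemma admissible_shift:
  assumes v: "admissible_drift M T \<sigma> X v vdot" and t: "t \<in> {0..T}"
  shows "admissible_drift M T \<sigma> X (\<lambda>s \<omega>. v s \<omega> + l * var_to (min s t)) (shift l t vdot)"
proof -
  have vm: "measurable_process M T vdot"
    and ito: "score_integrable vdot"
    and ad: "adapted (natural_filtration M X) T v"
    and ae: "AE \<omega> in M. set_integrable lborel {0..T} (\<lambda>s. vdot s \<omega>) \<and> (\<forall>t\<in>{0..T}. v t \<omega> = (LBINT s:{0..t}. vdot s \<omega>))"
    and en: "(\<integral>\<^sup>+\<omega>. (\<integral>\<^sup>+s\<in>{0..T}. ennreal ((vdot s \<omega>)\<^sup>2 / (\<sigma> s)\<^sup>2) \<partial>lborel) \<partial>M) < \<infinity>"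
    and pr: "prob_space (girsanov_measure M T \<sigma> X vdot)"
    using v by (simp_all add: admissible_drift_def)
  note shm = shift_measurable[OF vm, of l t] and ito' = stoch_int_shift(1)[OF vm ito t, of l]
  have fin: "mean_square (\<lambda>s \<omega>. score vdot s \<omega>) < \<infinity>"
    using en by (simp add: energy_nn_integral[OF vm, symmetric] cong: nn_integral_cong)
  have "(\<integral>\<^sup>+\<omega>. (\<integral>\<^sup>+s\<in>{0..T}. ennreal ((shift l t vdot s \<omega>)\<^sup>2 / (\<sigma> s)\<^sup>2) \<partial>lborel) \<partial>M)
    = mean_square (\<lambda>s \<omega>. score vdot s \<omega> + l * indicator {0<..t} s)"
  proof (intro nn_integral_cong)
    fix \<omega> assume \<omega>: "\<omega> \<in> space M"
    show "(\<integral>\<^sup>+s\<in>{0..T}. ennreal ((shift l t vdot s \<omega>)\<^sup>2 / (\<sigma> s)\<^sup>2) \<partial>lborel) = (\<integral>\<^sup>+s. ennreal ((score vdot s \<omega> + l * indicator {0<..t} s)\<^sup>2) \<partial>vol)"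
      unfolding energy_nn_integral[OF shm \<omega>] using AE_score_shift[of l t vdot \<omega>]
      by (intro nn_integral_cong_AE, eventually_elim) simp
  qed
  also have "\<dots> \<le> (\<integral>\<^sup>+\<omega>. 2 * (\<integral>\<^sup>+s. ennreal ((score vdot s \<omega>)\<^sup>2) \<partial>vol) + 2 * (\<integral>\<^sup>+s. ennreal ((l * indicator {0<..t} s)\<^sup>2) \<partial>vol) \<partial>M)"
    by (intro nn_integral_mono nn_integral_square_add_le) (use score_section[OF vm] in auto)
  also have "\<dots> = 2 * mean_square (\<lambda>s \<omega>. score vdot s \<omega>) + 2 * (\<integral>\<^sup>+s. ennreal ((l * indicator {0<..t} s)\<^sup>2) \<partial>vol)"
    using time_integral_measurable(1)[OF score_measurable[OF vm]]
    by (simp add: nn_integral_add nn_integral_cmult emeasure_space_1)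
  also have "\<dots> < \<infinity>"
  proof -
    have "integrable vol (\<lambda>s. (l * indicator {0<..t} s)\<^sup>2)"
      by (rule \<nu>.integrable_const_bound[where B = "l\<^sup>2"]) (auto simp: indicator_def)
    then have "(\<integral>\<^sup>+s. ennreal ((l * indicator {0<..t} s)\<^sup>2) \<partial>vol) < \<infinity>"
      by (subst nn_integral_eq_integral) auto
    then show ?thesis using fin by (simp add: ennreal_mult_less_top)
  qed
  finally have en': "(\<integral>\<^sup>+\<omega>. (\<integral>\<^sup>+s\<in>{0..T}. ennreal ((shift l t vdot s \<omega>)\<^sup>2 / (\<sigma> s)\<^sup>2) \<partial>lborel) \<partial>M) < \<infinity>" .
  obtain S where Zm: "stoch_int vdot \<in> borel_measurable M" and S: "ito_approximates S (score vdot) (stoch_int vdot)"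
    using has_ito_integral_score_iff[OF vm, THEN iffD1, OF stoch_int[OF ito]] by blast
  have one: "(\<integral>\<^sup>+\<omega>. ennreal (exp (stoch_int vdot \<omega> - (\<integral>s. (score vdot s \<omega>)\<^sup>2 \<partial>vol) / 2)) \<partial>M) = 1"
    using pr unfolding prob_space_girsanov_iff[OF vm ito] by (simp add: girsanov_density_eq[OF vm] cong: nn_integral_cong)
  have "(\<integral>\<^sup>+\<omega>. ennreal (girsanov_density M T \<sigma> X (shift l t vdot) \<omega>) \<partial>M)
    = (\<integral>\<^sup>+\<omega>. ennreal (exp (stoch_int vdot \<omega> + l * (X t \<omega> - X 0 \<omega>) - (\<integral>s. (score vdot s \<omega> + l * indicator {0<..t} s)\<^sup>2 \<partial>vol) / 2)) \<partial>M)"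
  proof (rule nn_integral_cong_AE)
    show "AE \<omega> in M. ennreal (girsanov_density M T \<sigma> X (shift l t vdot) \<omega>) =
      ennreal (exp (stoch_int vdot \<omega> + l * (X t \<omega> - X 0 \<omega>) - (\<integral>s. (score vdot s \<omega> + l * indicator {0<..t} s)\<^sup>2 \<partial>vol) / 2))"
      using stoch_int_shift(2)[OF vm ito t, of l] AE_space
    proof eventually_elim
      case (elim \<omega>)
      have [measurable]: "(\<lambda>s. score vdot s \<omega>) \<in> borel_measurable borel"
        "(\<lambda>s. score (shift l t vdot) s \<omega>) \<in> borel_measurable borel"
        by (rule score_section[OF vm elim(2)], rule score_section[OF shm elim(2)])
      have "(\<integral>s. (score (shift l t vdot) s \<omega>)\<^sup>2 \<partial>vol) = (\<integral>s. (score vdot s \<omega> + l * indicator {0<..t} s)\<^sup>2 \<partial>vol)"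
      proof (rule integral_cong_AE)
        show "AE s in vol. (score (shift l t vdot) s \<omega>)\<^sup>2 = (score vdot s \<omega> + l * indicator {0<..t} s)\<^sup>2"
          using AE_score_shift[of l t vdot \<omega>] by eventually_elim simp
      qed measurable
      then show ?case by (simp add: girsanov_density_eq[OF shm elim(2)] elim(1))
    qed
  qed
  also have "\<dots> = 1"
    by (rule exponential_shift_expectation[OF S score_measurable[OF vm] Zm t fin one])
  finally have "prob_space (girsanov_measure M T \<sigma> X (shift l t vdot))"
    unfolding prob_space_girsanov_iff[OF shm ito'] .
  moreover have "adapted (natural_filtration M X) T (\<lambda>s \<omega>. v s \<omega> + l * var_to (min s t))"
    using ad by (auto simp: adapted_def)
  moreover have "AE \<omega> in M. set_integrable lborel {0..T} (\<lambda>s. shift l t vdot s \<omega>) \<and>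
     (\<forall>r\<in>{0..T}. v r \<omega> + l * var_to (min r t) = (LBINT s:{0..r}. shift l t vdot s \<omega>))"
    using ae by eventually_elim (simp add: shift_drift)
  ultimately show ?thesis
    unfolding admissible_drift_def using shm ito' en' by simp
qed

section \<open>Unbiased estimation of the drift\<close>

abbreviation P :: "(real \<Rightarrow> 'a \<Rightarrow> real) \<Rightarrow> 'a measure" where
  "P vdot \<equiv> girsanov_measure M T \<sigma> X vdot"

lemma girsanov_measure_basics:
  assumes "admissible_drift M T \<sigma> X v vdot"
  shows "prob_space (P vdot)" "sets (P vdot) = sets M" "space (P vdot) = space M"
    "girsanov_density M T \<sigma> X vdot \<in> borel_measurable M"
    "f \<in> borel_measurable M \<Longrightarrow> f \<in> borel_measurable (P vdot)"
  using assms girsanov_density_measurable[of vdot] by (auto simp: admissible_drift_def girsanov_measure_def)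

lemma drift_measurable:
  assumes "admissible_drift M T \<sigma> X v vdot" "t \<in> {0..T}"
  shows "v t \<in> borel_measurable M"
  using assms by (intro measurable_M[of t]) (auto simp: admissible_drift_def adapted_def)

lemma girsanov_shift_integral:
  fixes f :: "'a \<Rightarrow> real"
  assumes v: "admissible_drift M T \<sigma> X v vdot" and t: "t \<in> {0..T}" and f: "f \<in> borel_measurable M"
  shows "integrable (P (shift l t vdot)) f \<longleftrightarrow>
      integrable (P vdot) (\<lambda>\<omega>. exp (l * (X t \<omega> - v t \<omega>) - l\<^sup>2 * var_to t / 2) * f \<omega>)"
    "(\<integral>\<omega>. f \<omega> \<partial>P (shift l t vdot)) =
      (\<integral>\<omega>. exp (l * (X t \<omega> - v t \<omega>) - l\<^sup>2 * var_to t / 2) * f \<omega> \<partial>P vdot)"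
proof -
  define d where "d = girsanov_density M T \<sigma> X vdot"
  define d' where "d' = girsanov_density M T \<sigma> X (shift l t vdot)"
  define L where "L \<omega> = exp (l * (X t \<omega> - v t \<omega>) - l\<^sup>2 * var_to t / 2)" for \<omega>
  have [measurable]: "d \<in> borel_measurable M" "d' \<in> borel_measurable M"
    unfolding d_def d'_def by (rule girsanov_measure_basics(4)[OF v], rule girsanov_measure_basics(4)[OF admissible_shift[OF v t]])
  have [measurable]: "X t \<in> borel_measurable M" "v t \<in> borel_measurable M" "f \<in> borel_measurable M"
    using t f by (auto intro!: Y_measurable drift_measurable[OF v])
  have [measurable]: "L \<in> borel_measurable M" unfolding L_def by measurable
  have nn: "AE \<omega> in M. 0 \<le> d \<omega>" "AE \<omega> in M. 0 \<le> d' \<omega>" by (auto simp: d_def d'_def girsanov_density_def)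
  have ae: "AE \<omega> in M. d' \<omega> *\<^sub>R f \<omega> = d \<omega> *\<^sub>R (L \<omega> * f \<omega>)"
    using girsanov_density_shift[OF v t, of l] by eventually_elim (simp add: d_def d'_def L_def)
  have "integrable (P (shift l t vdot)) f \<longleftrightarrow> integrable M (\<lambda>\<omega>. d' \<omega> *\<^sub>R f \<omega>)"
    unfolding girsanov_measure_def d'_def[symmetric] by (rule integrable_density) (use nn in auto)
  also have "\<dots> \<longleftrightarrow> integrable M (\<lambda>\<omega>. d \<omega> *\<^sub>R (L \<omega> * f \<omega>))"
    by (rule integrable_cong_AE[OF _ _ ae]) measurable
  also have "\<dots> \<longleftrightarrow> integrable (P vdot) (\<lambda>\<omega>. L \<omega> * f \<omega>)"
    unfolding girsanov_measure_def d_def[symmetric] by (rule integrable_density[symmetric]) (use nn in auto)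
  finally show "integrable (P (shift l t vdot)) f \<longleftrightarrow>
      integrable (P vdot) (\<lambda>\<omega>. exp (l * (X t \<omega> - v t \<omega>) - l\<^sup>2 * var_to t / 2) * f \<omega>)" by (simp add: L_def)
  have "(\<integral>\<omega>. f \<omega> \<partial>P (shift l t vdot)) = (\<integral>\<omega>. d' \<omega> *\<^sub>R f \<omega> \<partial>M)"
    unfolding girsanov_measure_def d'_def[symmetric] by (rule integral_density) (use nn in auto)
  also have "\<dots> = (\<integral>\<omega>. d \<omega> *\<^sub>R (L \<omega> * f \<omega>) \<partial>M)"
    by (rule integral_cong_AE[OF _ _ ae]) measurable
  also have "\<dots> = (\<integral>\<omega>. L \<omega> * f \<omega> \<partial>P vdot)"
    unfolding girsanov_measure_def d_def[symmetric] by (rule integral_density[symmetric]) (use nn in auto)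
  finally show "(\<integral>\<omega>. f \<omega> \<partial>P (shift l t vdot)) =
      (\<integral>\<omega>. exp (l * (X t \<omega> - v t \<omega>) - l\<^sup>2 * var_to t / 2) * f \<omega> \<partial>P vdot)" by (simp add: L_def)
qed

lemma likelihood_ratio_integral:
  assumes v: "admissible_drift M T \<sigma> X v vdot" and t: "t \<in> {0..T}"
  shows "integrable (P vdot) (\<lambda>\<omega>. exp (l * (X t \<omega> - v t \<omega>) - l\<^sup>2 * var_to t / 2))"
    "(\<integral>\<omega>. exp (l * (X t \<omega> - v t \<omega>) - l\<^sup>2 * var_to t / 2) \<partial>P vdot) = 1"
proof -
  interpret Q: prob_space "P (shift l t vdot)" by (rule girsanov_measure_basics(1)[OF admissible_shift[OF v t]])
  show "integrable (P vdot) (\<lambda>\<omega>. exp (l * (X t \<omega> - v t \<omega>) - l\<^sup>2 * var_to t / 2))"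
    "(\<integral>\<omega>. exp (l * (X t \<omega> - v t \<omega>) - l\<^sup>2 * var_to t / 2) \<partial>P vdot) = 1"
    using girsanov_shift_integral[OF v t, of "\<lambda>_. 1" l] by (simp_all add: Q.prob_space)
qed

lemma centred_mgf:
  assumes v: "admissible_drift M T \<sigma> X v vdot" and t: "t \<in> {0..T}"
  shows "integrable (P vdot) (\<lambda>\<omega>. exp (l * (X t \<omega> - v t \<omega>)))"
    "(\<integral>\<omega>. exp (l * (X t \<omega> - v t \<omega>)) \<partial>P vdot) = exp (l\<^sup>2 * var_to t / 2)"
proof -
  have eq: "exp (l * (X t \<omega> - v t \<omega>)) = exp (l\<^sup>2 * var_to t / 2) * exp (l * (X t \<omega> - v t \<omega>) - l\<^sup>2 * var_to t / 2)" for \<omega>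
    by (simp add: mult_exp_exp)
  show "integrable (P vdot) (\<lambda>\<omega>. exp (l * (X t \<omega> - v t \<omega>)))"
    unfolding eq by (rule integrable_mult_right) (rule likelihood_ratio_integral[OF v t])
  show "(\<integral>\<omega>. exp (l * (X t \<omega> - v t \<omega>)) \<partial>P vdot) = exp (l\<^sup>2 * var_to t / 2)"
    unfolding eq by (simp add: likelihood_ratio_integral[OF v t])
qed

lemma centred_moments:
  assumes v: "admissible_drift M T \<sigma> X v vdot" and t: "t \<in> {0..T}"
  shows "integrable (P vdot) (\<lambda>\<omega>. X t \<omega> - v t \<omega>)" "(\<integral>\<omega>. X t \<omega> - v t \<omega> \<partial>P vdot) = 0"
    "integrable (P vdot) (\<lambda>\<omega>. (X t \<omega> - v t \<omega>)\<^sup>2)" "(\<integral>\<omega>. (X t \<omega> - v t \<omega>)\<^sup>2 \<partial>P vdot) = var_to t"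
proof -
  interpret Q: prob_space "P vdot" by (rule girsanov_measure_basics(1)[OF v])
  have m: "(\<lambda>\<omega>. X t \<omega> - v t \<omega>) \<in> borel_measurable (P vdot)"
    using t by (intro girsanov_measure_basics(5)[OF v] borel_measurable_diff Y_measurable drift_measurable[OF v])
  have mgf: "(\<integral>\<^sup>+\<omega>. ennreal (exp (l * (X t \<omega> - v t \<omega>))) \<partial>P vdot) = ennreal (1 * exp (l\<^sup>2 * var_to t / 2))" for l
    using centred_mgf[OF v t, of l] by (subst nn_integral_eq_integral) auto
  show "integrable (P vdot) (\<lambda>\<omega>. X t \<omega> - v t \<omega>)" "(\<integral>\<omega>. X t \<omega> - v t \<omega> \<partial>P vdot) = 0"
    "integrable (P vdot) (\<lambda>\<omega>. (X t \<omega> - v t \<omega>)\<^sup>2)" "(\<integral>\<omega>. (X t \<omega> - v t \<omega>)\<^sup>2 \<partial>P vdot) = var_to t"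
    using moments_of_gaussian_mgf[OF Q.finite_measure_axioms m _ mgf] by auto
qed

lemma unbiased_X: "unbiased M T \<sigma> X X"
  unfolding unbiased_def Let_def
proof (intro allI impI ballI)
  fix v vdot t
  assume v: "admissible_drift M T \<sigma> X v vdot" and t: "t \<in> {0..T}" and i: "integrable (P vdot) (v t)"
  note m = centred_moments[OF v t]
  show "integrable (P vdot) (X t) \<and> (\<integral>\<omega>. X t \<omega> \<partial>P vdot) = (\<integral>\<omega>. v t \<omega> \<partial>P vdot)"
    using Bochner_Integration.integrable_add[OF m(1) i] Bochner_Integration.integral_add[OF m(1) i] m(2) by simp
qed

text \<open>
  The derivative of \<open>E\<^sub>v[\<xi>\<^sub>t]\<close> in the direction \<open>h\<close> is known for an unbiased estimator, and the
  likelihood ratio \<open>L\<^sub>l\<close> of \<open>u + l h\<close> against \<open>u\<close> is explicit. Square integrability of \<open>u\<^sub>t\<close> makes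
  \<open>u\<^sub>t\<close> integrable also under the shifted law, so that unbiasedness applies there.
\<close>

lemma cramer_rao_pointwise:
  assumes u: "admissible_drift M T \<sigma> X u udot" and t: "t \<in> {0..T}" and u2: "integrable (P udot) (\<lambda>\<omega>. (u t \<omega>)\<^sup>2)"
    and \<xi>m: "\<xi> t \<in> borel_measurable M" and unb: "unbiased M T \<sigma> X \<xi>"
  shows "ennreal (var_to t) \<le> (\<integral>\<^sup>+\<omega>. ennreal (\<bar>\<xi> t \<omega> - u t \<omega>\<bar>\<^sup>2) \<partial>P udot)"
proof (cases "(\<integral>\<^sup>+\<omega>. ennreal (\<bar>\<xi> t \<omega> - u t \<omega>\<bar>\<^sup>2) \<partial>P udot) = \<infinity>")
  case False
  interpret Q: prob_space "P udot" by (rule girsanov_measure_basics(1)[OF u])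
  define a where "a \<omega> = \<xi> t \<omega> - u t \<omega>" for \<omega>
  define L where "L l \<omega> = exp (l * (X t \<omega> - u t \<omega>) - l\<^sup>2 * var_to t / 2)" for l \<omega>
  have um: "u t \<in> borel_measurable M" by (rule drift_measurable[OF u t])
  have Xm: "X t \<in> borel_measurable M" using t by (rule Y_measurable)
  have [measurable]: "u t \<in> borel_measurable (P udot)" "\<xi> t \<in> borel_measurable (P udot)" "X t \<in> borel_measurable (P udot)"
    using um \<xi>m Xm girsanov_measure_basics(5)[OF u] by auto
  have am [measurable]: "a \<in> borel_measurable (P udot)" unfolding a_def by measurable
  have Lm [measurable]: "L l \<in> borel_measurable (P udot)" for l unfolding L_def by measurable
  have a2: "integrable (P udot) (\<lambda>\<omega>. (a \<omega>)\<^sup>2)"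
    using False by (intro integrableI_bounded) (auto simp: a_def less_top)
  have iu: "integrable (P udot) (u t)"
    by (rule Q.square_integrable_imp_integrable[OF _ u2]) measurable
  have \<xi>u: "integrable (P udot) (\<xi> t)" "(\<integral>\<omega>. \<xi> t \<omega> \<partial>P udot) = (\<integral>\<omega>. u t \<omega> \<partial>P udot)"
    using unb u t iu unfolding unbiased_def Let_def by blast+
  have LI: "integrable (P udot) (L l)" "(\<integral>\<omega>. L l \<omega> \<partial>P udot) = 1" for l
    unfolding L_def using likelihood_ratio_integral[OF u t] by auto
  \<comment> \<open>the second moment of the likelihood ratio is again a first moment, for the shift \<open>2 l\<close>\<close>
  have sq: "(L l \<omega>)\<^sup>2 = exp (l\<^sup>2 * var_to t) * L (2 * l) \<omega>" for l \<omega>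
    by (simp add: L_def power2_eq_square mult_exp_exp algebra_simps flip: exp_add)
  have L2: "integrable (P udot) (\<lambda>\<omega>. (L l \<omega>)\<^sup>2)" "(\<integral>\<omega>. (L l \<omega>)\<^sup>2 \<partial>P udot) = exp (l\<^sup>2 * var_to t)" for l
    unfolding sq using LI[of "2 * l"] by auto
  have La: "integrable (P udot) (\<lambda>\<omega>. L l \<omega> * a \<omega>)" "(\<integral>\<omega>. L l \<omega> * a \<omega> \<partial>P udot) = l * var_to t" for l
  proof -
    have Lu: "integrable (P udot) (\<lambda>\<omega>. L l \<omega> * u t \<omega>)"
    proof (rule Bochner_Integration.integrable_bound)
      show "integrable (P udot) (\<lambda>\<omega>. (L l \<omega>)\<^sup>2 + (u t \<omega>)\<^sup>2)" using L2(1) u2 by simp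
      show "AE \<omega> in P udot. norm (L l \<omega> * u t \<omega>) \<le> norm ((L l \<omega>)\<^sup>2 + (u t \<omega>)\<^sup>2)"
      proof (rule AE_I2)
        fix \<omega>
        have "2 * \<bar>L l \<omega> * u t \<omega>\<bar> \<le> (L l \<omega>)\<^sup>2 + (u t \<omega>)\<^sup>2"
          using zero_le_power2[of "\<bar>L l \<omega>\<bar> - \<bar>u t \<omega>\<bar>"] by (simp add: power2_diff abs_mult)
        then show "norm (L l \<omega> * u t \<omega>) \<le> norm ((L l \<omega>)\<^sup>2 + (u t \<omega>)\<^sup>2)" by simp
      qed
    qed measurable
    note ad = admissible_shift[OF u t, of l] and I = girsanov_shift_integral[OF u t, of _ l, folded L_def]
    interpret Q': prob_space "P (shift l t udot)" by (rule girsanov_measure_basics(1)[OF ad])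
    have iu': "integrable (P (shift l t udot)) (u t)" unfolding I(1)[OF um] by (rule Lu)
    have "integrable (P (shift l t udot)) (\<lambda>\<omega>. u t \<omega> + l * var_to (min t t))" using iu' by simp
    then have *: "integrable (P (shift l t udot)) (\<xi> t)"
      "(\<integral>\<omega>. \<xi> t \<omega> \<partial>P (shift l t udot)) = (\<integral>\<omega>. u t \<omega> + l * var_to (min t t) \<partial>P (shift l t udot))"
      using unb ad t unfolding unbiased_def Let_def by blast+
    have L\<xi>: "integrable (P udot) (\<lambda>\<omega>. L l \<omega> * \<xi> t \<omega>)" using *(1) unfolding I(1)[OF \<xi>m] .
    have "(\<integral>\<omega>. \<xi> t \<omega> \<partial>P (shift l t udot)) = (\<integral>\<omega>. u t \<omega> \<partial>P (shift l t udot)) + l * var_to t"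
      unfolding *(2) using iu' by (simp add: Q'.prob_space)
    then have e: "(\<integral>\<omega>. L l \<omega> * \<xi> t \<omega> \<partial>P udot) = (\<integral>\<omega>. L l \<omega> * u t \<omega> \<partial>P udot) + l * var_to t"
      unfolding I(2)[OF \<xi>m] I(2)[OF um] .
    show "integrable (P udot) (\<lambda>\<omega>. L l \<omega> * a \<omega>)" "(\<integral>\<omega>. L l \<omega> * a \<omega> \<partial>P udot) = l * var_to t"
      using L\<xi> Lu e by (simp_all add: a_def right_diff_distrib)
  qed
  have a1: "integrable (P udot) a" "(\<integral>\<omega>. a \<omega> \<partial>P udot) = 0"
    unfolding a_def[abs_def] using \<xi>u iu by simp_all
  have "var_to t \<le> (\<integral>\<omega>. (a \<omega>)\<^sup>2 \<partial>P udot)"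
    by (rule Q.chapman_robbins[OF a2 a1, where L = L]) (use LI L2 La in auto)
  then have "ennreal (var_to t) \<le> ennreal (\<integral>\<omega>. (a \<omega>)\<^sup>2 \<partial>P udot)" by (rule ennreal_leI)
  also have "\<dots> = (\<integral>\<^sup>+\<omega>. ennreal ((a \<omega>)\<^sup>2) \<partial>P udot)"
    using a2 by (subst nn_integral_eq_integral) auto
  finally show ?thesis by (simp add: a_def)
qed simp

lemma risk_bound_eq:
  assumes sets: "sets \<mu> = sets (restrict_space borel {0..T})"
  shows "risk_bound \<sigma> \<mu> = (\<integral>\<^sup>+t. ennreal (var_to t) \<partial>\<mu>)"
  unfolding risk_bound_def
proof (rule nn_integral_cong)
  fix t assume "t \<in> space \<mu>"
  then have t: "t \<in> {0..T}" using sets_eq_imp_space_eq[OF sets] by (simp add: space_restrict_space)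
  have i: "integrable lborel (\<lambda>s. indicator {0..T} s * (\<sigma> s)\<^sup>2 * indicator {0<..t} s)"
    using \<sigma>2 unfolding set_integrable_def by (intro integrable_real_mult_indicator) auto
  have "(\<integral>\<^sup>+s\<in>{0..t}. ennreal ((\<sigma> s)\<^sup>2) \<partial>lborel) = (\<integral>\<^sup>+s. ennreal (indicator {0..T} s * (\<sigma> s)\<^sup>2 * indicator {0<..t} s) \<partial>lborel)"
    using AE_lborel_singleton[of 0]
    by (intro nn_integral_cong_AE, eventually_elim) (use t in \<open>auto simp: indicator_def\<close>)
  also have "\<dots> = ennreal (var_to t)"
    unfolding var_to_eq by (rule nn_integral_eq_integral[OF i]) simp
  finally show "(\<integral>\<^sup>+s\<in>{0..t}. ennreal ((\<sigma> s)\<^sup>2) \<partial>lborel) = ennreal (var_to t)" .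
qed

lemma quadratic_risk_swap:
  assumes \<mu>: "finite_measure \<mu>" "sets \<mu> = sets (restrict_space borel {0..T})"
    and u: "admissible_drift M T \<sigma> X u udot"
    and um: "(\<lambda>(\<omega>, t). u t \<omega>) \<in> borel_measurable (P udot \<Otimes>\<^sub>M \<mu>)"
    and \<xi>: "drift_estimator M T X \<xi>"
  shows "quadratic_risk (P udot) \<mu> \<xi> u = (\<integral>\<^sup>+t. (\<integral>\<^sup>+\<omega>. ennreal (\<bar>\<xi> t \<omega> - u t \<omega>\<bar>\<^sup>2) \<partial>P udot) \<partial>\<mu>)"
proof -
  interpret Q: prob_space "P udot" by (rule girsanov_measure_basics(1)[OF u])
  interpret \<mu>: finite_measure \<mu> by fact
  interpret pair_sigma_finite "P udot" \<mu> ..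
  have id: "(\<lambda>\<omega>. \<omega>) \<in> measurable (P udot) (natural_filtration M X T)"
    using T subalg[of T] by (intro measurableI) (auto simp: girsanov_measure_basics[OF u] subalgebra_def Int_absorb2 sets.sets_into_space)
  have [measurable]: "(\<lambda>(\<omega>, t). \<xi> t \<omega>) \<in> borel_measurable (natural_filtration M X T \<Otimes>\<^sub>M restrict_space borel {0..T})"
    using \<xi> by (simp add: drift_estimator_def measurable_process_def)
  note [measurable] = id um
  have [measurable]: "(\<lambda>t. t) \<in> measurable \<mu> (restrict_space borel {0..T})"
    using measurable_ident_sets[OF \<mu>(2)] by (simp add: id_def)
  have "(\<lambda>z. case (fst z, snd z) of (\<omega>, t) \<Rightarrow> \<xi> t \<omega>) \<in> borel_measurable (P udot \<Otimes>\<^sub>M \<mu>)"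
    by measurable
  then have [measurable]: "(\<lambda>z. \<xi> (snd z) (fst z)) \<in> borel_measurable (P udot \<Otimes>\<^sub>M \<mu>)" by simp
  have [measurable]: "(\<lambda>z. u (snd z) (fst z)) \<in> borel_measurable (P udot \<Otimes>\<^sub>M \<mu>)"
    using um by (simp add: split_beta')
  have "(\<lambda>z. ennreal (\<bar>\<xi> (snd z) (fst z) - u (snd z) (fst z)\<bar>\<^sup>2)) \<in> borel_measurable (P udot \<Otimes>\<^sub>M \<mu>)"
    by measurable
  from Fubini[OF this] show ?thesis by (simp add: quadratic_risk_def)
qed

end

theorem proposition2p2:
  fixes M :: "'a measure" and T :: real and \<sigma> :: "real \<Rightarrow> real"
    and W X u udot :: "real \<Rightarrow> 'a \<Rightarrow> real" and \<mu> :: "real measure"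
  assumes "prob_space M"
    and "T > 0"
    and "set_borel_measurable lborel {0..T} \<sigma>"
    and "set_integrable lborel {0..T} (\<lambda>s. (\<sigma> s)\<^sup>2)"
    and "AE s in lborel. s \<in> {0..T} \<longrightarrow> \<sigma> s \<noteq> 0"
    and "brownian_motion M T W"
    and "wiener_integral_process M T \<sigma> W X"
    and "finite_measure \<mu>"
    and "sets \<mu> = sets (restrict_space borel {0..T})"
    and "admissible_drift M T \<sigma> X u udot"
    and "(\<lambda>(\<omega>, t). u t \<omega>) \<in> borel_measurable (girsanov_measure M T \<sigma> X udot \<Otimes>\<^sub>M \<mu>)"
    and "integrable (girsanov_measure M T \<sigma> X udot \<Otimes>\<^sub>M \<mu>) (\<lambda>(\<omega>, t). (u t \<omega>)\<^sup>2)"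
  shows "(\<forall>\<xi>. drift_estimator M T X \<xi> \<and> adapted (natural_filtration M X) T \<xi> \<and>
            unbiased M T \<sigma> X \<xi> \<longrightarrow>
            quadratic_risk (girsanov_measure M T \<sigma> X udot) \<mu> \<xi> u \<ge> risk_bound \<sigma> \<mu>) \<and>
         drift_estimator M T X X \<and> adapted (natural_filtration M X) T X \<and>
         unbiased M T \<sigma> X X \<and>
         quadratic_risk (girsanov_measure M T \<sigma> X udot) \<mu> X u = risk_bound \<sigma> \<mu>"
proof -
  note wiener = wiener_gaussian_martingale[OF assms(1,2,3,4,6,7)]
  interpret drifted_wiener M X T \<sigma>
    by (rule drifted_wiener.intro[OF wiener(1) drifted_wiener_axioms.intro]) (use assms wiener(2) in auto)
  note u = assms(10)
  interpret Q: prob_space "P udot" by (rule girsanov_measure_basics(1)[OF u])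
  interpret \<mu>: finite_measure \<mu> by fact
  interpret pair_sigma_finite "P udot" \<mu> ..
  have space_\<mu>: "space \<mu> = {0..T}" using sets_eq_imp_space_eq[OF assms(9)] by (simp add: space_restrict_space)
  have est: "drift_estimator M T X X"
    unfolding drift_estimator_def
  proof (rule continuous_process_measurable)
    show "X t \<in> borel_measurable (natural_filtration M X T)" if "t \<in> {0..T}" for t
      using that by (rule natural_filtration_adapted)
    show "continuous_on {0..T} (\<lambda>t. X t \<omega>)" if "\<omega> \<in> space (natural_filtration M X T)" for \<omega>
      using assms(7) that by (simp add: wiener_integral_process_def)
  qed (use assms(2) in simp)
  have ad: "adapted (natural_filtration M X) T X"
    by (auto simp: adapted_def intro!: natural_filtration_adapted)
  have "quadratic_risk (P udot) \<mu> X u = (\<integral>\<^sup>+t. ennreal (var_to t) \<partial>\<mu>)"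
    unfolding quadratic_risk_swap[OF assms(8,9) u assms(11) est]
  proof (rule nn_integral_cong)
    fix t assume "t \<in> space \<mu>"
    then have t: "t \<in> {0..T}" by (simp add: space_\<mu>)
    show "(\<integral>\<^sup>+\<omega>. ennreal (\<bar>X t \<omega> - u t \<omega>\<bar>\<^sup>2) \<partial>P udot) = ennreal (var_to t)"
      using centred_moments(3,4)[OF u t] by (simp add: nn_integral_eq_integral)
  qed
  then have attained: "quadratic_risk (P udot) \<mu> X u = risk_bound \<sigma> \<mu>" by (simp add: risk_bound_eq[OF assms(9)])
  have u2: "AE t in \<mu>. integrable (P udot) (\<lambda>\<omega>. (u t \<omega>)\<^sup>2)"
    using AE_integrable_snd[of "\<lambda>\<omega> t. (u t \<omega>)\<^sup>2"] assms(12) by simp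
  have "risk_bound \<sigma> \<mu> \<le> quadratic_risk (P udot) \<mu> \<xi> u"
    if \<xi>: "drift_estimator M T X \<xi>" "adapted (natural_filtration M X) T \<xi>" "unbiased M T \<sigma> X \<xi>" for \<xi>
    unfolding quadratic_risk_swap[OF assms(8,9) u assms(11) \<xi>(1)] risk_bound_eq[OF assms(9)]
  proof (rule nn_integral_mono_AE)
    show "AE t in \<mu>. ennreal (var_to t) \<le> (\<integral>\<^sup>+\<omega>. ennreal (\<bar>\<xi> t \<omega> - u t \<omega>\<bar>\<^sup>2) \<partial>P udot)"
      using u2 AE_space
    proof eventually_elim
      case (elim t)
      then have t: "t \<in> {0..T}" by (simp add: space_\<mu>)
      have "\<xi> t \<in> borel_measurable M"
        by (rule measurable_M[OF t]) (use \<xi>(2) t in \<open>auto simp: adapted_def\<close>)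
      then show ?case by (rule cramer_rao_pointwise[OF u t elim(1) _ \<xi>(3)])
    qed
  qed
  then show ?thesis using est ad unbiased_X attained by blast
qed

end
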